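(* Let $H=\mathbb{R}^n$, let $Z=(Z_t)$ be an $n$-dimensional symmetric non-degenerate $\alpha$-stable process with $\alpha\in(0,2)$, and let $A$ be any real $n\times n$ matrix. Let $R_t$ be the Ornstein–Uhlenbeck semigroup associated with $$dX_t=AX_t\,dt+dZ_t,\qquad X_0=x.$$ Then there exists a constant $c>0$ such that $$\|DR_tf\|_0\le\frac{c}{t^{1/\alpha}}\,\|f\|_0\qquad\text{for all }t\in(0,1],\ f\in B_b(H).$$
   Context: $B_b(H)$ is the space of bounded Borel-measurable functions $f:H\to\mathbb{R}$ with $\|f\|_0=\sup_{x}|f(x)|$. $DR_tf$ is the gradient of $R_tf$ in $x$, and $\|DR_tf\|_0=\sup_{x\in H}|DR_tf(x)|$; the estimate includes the assertion that $R_tf$ is differentiable. $R_tf(x)=\mathbb{E}[f(X^x_t)]$ with $X^x_t=e^{tA}x+\int_0^te^{(t-s)A}\,dZ_s$. Symmetric non-degenerate $\alpha$-stable process on $\mathbb{R}^n$: a Lévy process $Z=(Z_t)$ with $\mathbb{E}[e^{i\langle Z_t,u\rangle}]=e^{-t\psi(u)}$, $u\in\mathbb{R}^n$, where $$\psi(u)=-\int_{\mathbb{R}^n}\big(e^{i\langle u,y\rangle}-1-i\langle u,y\rangle 1_{\{|y|\le1\}}(y)\big)\,\nu(dy),$$ and the Lévy measure is $\nu(D)=\int_S\mu(d\xi)\int_0^\infty 1_D(r\xi)\frac{dr}{r^{1+\alpha}}$ for Borel $D\subset\mathbb{R}^n$, with $\mu$ a symmetric, non-zero finite measure on the unit sphere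 $S$ of $\mathbb{R}^n$. Non-degeneracy means that there is $C_\alpha>0$ with $\psi(u)\ge C_\alpha|u|^\alpha$ for all $u\in\mathbb{R}^n$. *)

theory Defs
  imports "HOL-Probability.Probability"
begin

section \<open>Stable processes\<close>

text \<open>
  Levy processes are indexed by the times \<open>t \<ge> 0\<close>; values at negative times are irrelevant.
  Path regularity is not part of the definition (every Levy process in this sense has a cadlag
  modification), so processes with cadlag paths are covered as well.
\<close>

definition levy_process ::
    "'w measure \<Rightarrow> (real \<Rightarrow> 'w \<Rightarrow> 'a::euclidean_space) \<Rightarrow> bool" where
  "levy_process M Z \<longleftrightarrow>
     prob_space M \<and>
     (\<forall>t\<ge>0. Z t \<in> borel_measurable M) \<and>
     (AE \<omega> in M. Z 0 \<omega> = 0) \<and>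
     (\<forall>(N::nat) s. 0 \<le> s 0 \<and> (\<forall>i<N. s i \<le> s (Suc i)) \<longrightarrow>
        prob_space.indep_vars M (\<lambda>_. borel) (\<lambda>i \<omega>. Z (s (Suc i)) \<omega> - Z (s i) \<omega>) {..<N}) \<and>
     (\<forall>s\<ge>0. \<forall>h\<ge>0. distr M borel (\<lambda>\<omega>. Z (s + h) \<omega> - Z s \<omega>) = distr M borel (Z h)) \<and>
     (\<forall>s\<ge>0. \<forall>e>0.
        ((\<lambda>t. measure M {\<omega> \<in> space M. norm (Z t \<omega> - Z s \<omega>) > e}) \<longlongrightarrow> 0) (at s within {0..}))"

text \<open>The spectral measure lives on the unit sphere, with the trace of the Borel sets.\<close>

definition symmetric_spectral_measure :: "'a::euclidean_space measure \<Rightarrow> bool" where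
  "symmetric_spectral_measure \<mu> \<longleftrightarrow>
     sets \<mu> = sets (restrict_space borel (sphere 0 1)) \<and>
     finite_measure \<mu> \<and>
     (\<forall>B\<in>sets \<mu>. emeasure \<mu> (uminus ` B) = emeasure \<mu> B) \<and>
     emeasure \<mu> (space \<mu>) \<noteq> 0"

definition stable_levy_measure ::
    "real \<Rightarrow> 'a::euclidean_space measure \<Rightarrow> 'a measure" where
  "stable_levy_measure \<alpha> \<mu> = measure_of UNIV (sets borel)
     (\<lambda>D. \<integral>\<^sup>+\<xi>. (\<integral>\<^sup>+r\<in>{0<..}. indicator D (r *\<^sub>R \<xi>) * ennreal (1 / r powr (1 + \<alpha>)) \<partial>lborel) \<partial>\<mu>)"

text \<open>\<^const>\<open>measure_of\<close> silently yields the null measure when the given set function is not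
  countably additive; this does not happen here.\<close>

lemma sets_stable_levy_measure [simp, measurable_cong]:
  fixes \<mu> :: "'a::euclidean_space measure"
  shows "sets (stable_levy_measure \<alpha> \<mu>) = sets borel"
  unfolding stable_levy_measure_def
  using sets.sets_measure_of_eq[of "borel :: 'a measure"] by (simp only: space_borel)

lemma emeasure_stable_levy_measure:
  fixes \<mu> :: "'a::euclidean_space measure"
  assumes \<mu>: "sets \<mu> = sets (restrict_space borel (sphere 0 1))"
    and D: "D \<in> sets borel"
  shows "emeasure (stable_levy_measure \<alpha> \<mu>) D =
    (\<integral>\<^sup>+\<xi>. (\<integral>\<^sup>+r\<in>{0<..}. indicator D (r *\<^sub>R \<xi>) * ennreal (1 / r powr (1 + \<alpha>)) \<partial>lborel) \<partial>\<mu>)"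
proof -
  let ?g = "\<lambda>D \<xi> r. indicator D (r *\<^sub>R \<xi>) * ennreal (1 / r powr (1 + \<alpha>)) * indicator {0<..} r"
  let ?f = "\<lambda>D. \<integral>\<^sup>+\<xi>. (\<integral>\<^sup>+r. ?g D \<xi> r \<partial>lborel) \<partial>\<mu>"
  have id: "(\<lambda>\<xi>. \<xi>) \<in> measurable \<mu> (borel :: 'a measure)"
    using measurable_restrict_space1[OF measurable_ident, of "borel :: 'a measure" "sphere 0 1"]
    by (simp add: measurable_cong_sets[OF \<mu> refl] id_def)
  have meas: "(\<lambda>(\<xi>, r). ?g B \<xi> r) \<in> borel_measurable (\<mu> \<Otimes>\<^sub>M lborel)" if B: "B \<in> sets borel" for B
  proof -
    have 1: "(\<lambda>p. snd p *\<^sub>R fst p) \<in> measurable (\<mu> \<Otimes>\<^sub>M lborel) (borel :: 'a measure)"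
      using id by measurable
    have "(\<lambda>p. indicator B (snd p *\<^sub>R fst p) :: ennreal) \<in> borel_measurable (\<mu> \<Otimes>\<^sub>M lborel)"
      by (rule measurable_compose[OF 1]) (use B in simp)
    then show ?thesis
      unfolding split_beta' by measurable
  qed
  have meas_r: "?g B \<xi> \<in> borel_measurable lborel" if "B \<in> sets borel" for B and \<xi> :: 'a
  proof -
    have "(\<lambda>r. indicator B (r *\<^sub>R \<xi>) :: ennreal) \<in> borel_measurable lborel"
      by (rule measurable_compose[of "\<lambda>r. r *\<^sub>R \<xi>" _ borel])
         (measurable, use that in simp)
    then show ?thesis by measurable
  qed
  have "countably_additive (sets borel) ?f"
  proof (rule countably_additiveI)
    fix B :: "nat \<Rightarrow> 'a set"
    assume B: "range B \<subseteq> sets borel" "disjoint_family B"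
    have Bi: "B i \<in> sets borel" for i using B by auto
    have "(\<Sum>i. ?f (B i)) = (\<integral>\<^sup>+\<xi>. (\<Sum>i. \<integral>\<^sup>+r. ?g (B i) \<xi> r \<partial>lborel) \<partial>\<mu>)"
      using lborel.borel_measurable_nn_integral[OF meas[OF Bi]]
      by (intro nn_integral_suminf[symmetric])
    also have "\<dots> = (\<integral>\<^sup>+\<xi>. (\<integral>\<^sup>+r. (\<Sum>i. ?g (B i) \<xi> r) \<partial>lborel) \<partial>\<mu>)"
      using meas_r[OF Bi] by (intro nn_integral_cong nn_integral_suminf[symmetric])
    also have "\<dots> = ?f (\<Union>i. B i)"
      by (simp only: ennreal_suminf_multc suminf_indicator[OF B(2)])
    finally show "(\<Sum>i. ?f (B i)) = ?f (\<Union>i. B i)" .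
  qed
  moreover have "positive (sets borel) ?f"
    by (simp add: positive_def)
  ultimately show ?thesis
    by (intro emeasure_measure_of[OF stable_levy_measure_def])
       (simp_all only: sets_stable_levy_measure D, simp)
qed

definition stable_exponent ::
    "real \<Rightarrow> 'a::euclidean_space measure \<Rightarrow> 'a \<Rightarrow> complex" where
  "stable_exponent \<alpha> \<mu> u =
     - (LINT y|stable_levy_measure \<alpha> \<mu>.
          iexp (u \<bullet> y) - 1 - \<i> * complex_of_real ((u \<bullet> y) * indicator {y. norm y \<le> 1} y))"

text \<open>The exponent is real-valued because \<open>\<mu>\<close> is symmetric; this justifies using the real part in
  the non-degeneracy condition.\<close>

definition nondegenerate_symmetric_stable_process ::
    "real \<Rightarrow> 'w measure \<Rightarrow> (real \<Rightarrow> 'w \<Rightarrow> 'a::euclidean_space) \<Rightarrow> bool" where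
  "nondegenerate_symmetric_stable_process \<alpha> M Z \<longleftrightarrow>
     levy_process M Z \<and>
     (\<exists>\<mu>. symmetric_spectral_measure \<mu> \<and>
        (\<forall>t\<ge>0. \<forall>u. (LINT \<omega>|M. iexp (Z t \<omega> \<bullet> u)) = exp (- complex_of_real t * stable_exponent \<alpha> \<mu> u)) \<and>
        (\<exists>C>0. \<forall>u. Re (stable_exponent \<alpha> \<mu> u) \<ge> C * norm u powr \<alpha>))"


section \<open>Ornstein--Uhlenbeck process and semigroup\<close>

text \<open>The multiplication \<open>*\<close> on \<open>real^'n^'n\<close> is componentwise, so neither \<open>^\<close> nor
  \<^const>\<open>exp\<close> can be used for matrices.\<close>

definition matrix_exp :: "real^'n^'n \<Rightarrow> real^'n^'n" where
  "matrix_exp A = (\<Sum>k. (1 / fact k) *\<^sub>R (((**) A ^^ k) (mat 1)))"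

text \<open>
  Wiener integral \<open>\<integral>\<^sub>0\<^sup>t F(s) dZ\<^sub>s\<close> of a deterministic matrix-valued integrand, as the limit in
  probability of the Riemann--Stieltjes sums as the mesh of the partition tends to zero. The limit is
  unique up to null sets; \<open>stochastic_integral\<close> picks one version.
\<close>

definition has_stochastic_integral ::
    "'w measure \<Rightarrow> (real \<Rightarrow> 'w \<Rightarrow> real^'n) \<Rightarrow> real \<Rightarrow> (real \<Rightarrow> real^'n^'n) \<Rightarrow>
     ('w \<Rightarrow> real^'n) \<Rightarrow> bool" where
  "has_stochastic_integral M Z t F Y \<longleftrightarrow>
     Y \<in> borel_measurable M \<and>
     (\<forall>e>0. \<forall>p>0. \<exists>d>0. \<forall>(N::nat) s.
        s 0 = 0 \<and> s N = t \<and> (\<forall>i<N. s i \<le> s (Suc i) \<and> s (Suc i) - s i < d) \<longrightarrow>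
        measure M {\<omega> \<in> space M.
          norm ((\<Sum>i<N. F (s i) *v (Z (s (Suc i)) \<omega> - Z (s i) \<omega>)) - Y \<omega>) > e} < p)"

definition stochastic_integral ::
    "'w measure \<Rightarrow> (real \<Rightarrow> 'w \<Rightarrow> real^'n) \<Rightarrow> real \<Rightarrow> (real \<Rightarrow> real^'n^'n) \<Rightarrow> 'w \<Rightarrow> real^'n" where
  "stochastic_integral M Z t F = (SOME Y. has_stochastic_integral M Z t F Y)"

definition ou_process ::
    "'w measure \<Rightarrow> (real \<Rightarrow> 'w \<Rightarrow> real^'n) \<Rightarrow> real^'n^'n \<Rightarrow> real^'n \<Rightarrow> real \<Rightarrow> 'w \<Rightarrow> real^'n" where
  "ou_process M Z A x t \<omega> =
     matrix_exp (t *\<^sub>R A) *v x + stochastic_integral M Z t (\<lambda>s. matrix_exp ((t - s) *\<^sub>R A)) \<omega>"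

definition ou_semigroup ::
    "'w measure \<Rightarrow> (real \<Rightarrow> 'w \<Rightarrow> real^'n) \<Rightarrow> real^'n^'n \<Rightarrow> real \<Rightarrow>
     (real^'n \<Rightarrow> real) \<Rightarrow> real^'n \<Rightarrow> real" where
  "ou_semigroup M Z A t f x = (LINT \<omega>|M. f (ou_process M Z A x t \<omega>))"


section \<open>Bounded functions, gradients, supremum norm\<close>

definition bounded_borel :: "('a::topological_space \<Rightarrow> real) set" where
  "bounded_borel = {f. f \<in> borel_measurable borel \<and> bounded (range f)}"

definition gradient :: "('a::real_inner \<Rightarrow> real) \<Rightarrow> 'a \<Rightarrow> 'a" where
  "gradient f x = (THE D. GDERIV f x :> D)"

text \<open>Extended-valued, hence meaningful also for functions not yet known to be bounded.\<close>

definition sup_norm :: "('a \<Rightarrow> 'b::real_normed_vector) \<Rightarrow> ennreal" where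
  "sup_norm g = (SUP x. ennreal (norm (g x)))"

end

theory Submission
  imports Defs
begin

text \<open>
  The noise \<open>Y\<^sub>t = \<integral> e^((t-s)A) dZ\<^sub>s\<close> has characteristic function \<open>exp (- \<Psi>)\<close>, where \<open>\<Psi>\<close> is a limit of Riemann
  sums of \<open>u \<mapsto> \<psi> (e^((t-s)A)\<^sup>T u)\<close> and \<open>\<psi> u = \<integral> (1 - cos (u \<bullet> y)) d\<nu>\<close>. Nondegeneracy forces the directions of the
  jumps to span the space. On the event that \<open>Y\<^sub>t\<close> has, among the jumps with times close to \<open>t\<close> and lengths
  of order \<open>\<rho>\<close>, one in a neighbourhood of each of \<open>n\<close> independent directions, randomness of the
  jump lengths makes the law Lipschitz under translations in total variation with constant of order
  \<open>1 / \<rho>\<close>; the opposite event has probability of order \<open>exp (- c t \<rho> powr - \<alpha>)\<close>. Summing over the scales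
  \<open>\<rho> = t powr (1 / \<alpha>) 2 powr (- k / \<alpha>)\<close> gives the constant \<open>c / t powr (1 / \<alpha>)\<close>. The same bound for
  \<open>exp (- \<Psi> / 2)\<close>, used for both factors of \<open>exp (- \<Psi>)\<close>, controls second differences, which makes
  \<open>R\<^sub>t f\<close> differentiable for every bounded Borel function \<open>f\<close>. All of this is carried out on the level of
  characteristic functions.
\<close>

section \<open>Fourier--Stieltjes bounds\<close>

text \<open>The spectral measure may consist of finitely many atoms, so smoothing is drawn from what
  is always absolutely continuous, the jump lengths, and \<open>n\<close> jumps in independent
  directions are combined. Densities are avoided: an integrable gradient would need spatial decay
  besides smoothness, and \<open>\<psi>\<close> need not be differentiable. A total variation bound
  is exactly what passes from characteristic functions to bounded Borel functions. Jumps are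
  transported by \<open>e^((t-s)A)\<close>, which is near the identity for \<open>s\<close> near
  \<open>t\<close>. A fixed share of the Riemann slots has this property for every \<open>t\<close>
  in \<open>(0, 1]\<close>, so the constants do not depend on \<open>t\<close>. Halving the time
  divides the natural jump length by \<open>D = 2 powr (1 / \<alpha>)\<close>, so each halving
  worsens the Lipschitz constant by the factor \<open>D\<close>. The scale \<open>\<rho>\<close> is
  taken so small that missing some direction costs at most \<open>1 / (2 * D)\<close>, and the
  losses form a geometric series. A Lipschitz bound alone would not give differentiability at every
  point, hence the second differences.\<close>

text \<open>Eberlein's criterion: \<open>FS_bound \<phi> C\<close> holds iff the (continuous) function \<open>\<phi>\<close> is the Fourier
  transform of a complex measure of total variation at most \<open>C\<close>. In this form the bound is closed under
  sums, products, integrals and pointwise limits without any measure having to be constructed.\<close>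

definition FS_bound :: "('a::euclidean_space \<Rightarrow> complex) \<Rightarrow> real \<Rightarrow> bool" where
  "FS_bound \<phi> C \<longleftrightarrow> (\<forall>S c B. finite S \<longrightarrow> (\<forall>x. norm (\<Sum>u\<in>S. c u * cis (u \<bullet> x)) \<le> B) \<longrightarrow>
     norm (\<Sum>u\<in>S. c u * \<phi> u) \<le> C * B)"

lemma FS_boundD:
  assumes "FS_bound \<phi> C" "finite S" "\<And>x. norm (\<Sum>u\<in>S. c u * cis (u \<bullet> x)) \<le> B"
  shows "norm (\<Sum>u\<in>S. c u * \<phi> u) \<le> C * B"
  using assms unfolding FS_bound_def by blast

lemma FS_boundI:
  assumes "\<And>S c B. finite S \<Longrightarrow> (\<And>x. norm (\<Sum>u\<in>S. c u * cis (u \<bullet> x)) \<le> B) \<Longrightarrow> B \<ge> 0 \<Longrightarrow>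
     norm (\<Sum>u\<in>S. c u * \<phi> u) \<le> C * B"
  shows "FS_bound \<phi> C"
  unfolding FS_bound_def
proof (intro allI impI)
  fix S :: "'a set" and c B assume a: "finite S" "\<forall>x. norm (\<Sum>u\<in>S. c u * cis (u \<bullet> x)) \<le> B"
  then have "B \<ge> 0" using norm_ge_zero order_trans by blast
  then show "norm (\<Sum>u\<in>S. c u * \<phi> u) \<le> C * B" using assms a by blast
qed

lemma FS_bound_norm_le: "FS_bound \<phi> C \<Longrightarrow> norm (\<phi> u) \<le> C"
  using FS_boundD[of \<phi> C "{u}" "\<lambda>_. 1" 1] by simp

lemma FS_bound_nonneg: "FS_bound \<phi> C \<Longrightarrow> 0 \<le> C"
  using FS_bound_norm_le[of \<phi> C 0] norm_ge_zero order_trans by blast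

lemma FS_bound_mono: "FS_bound \<phi> C \<Longrightarrow> C \<le> D \<Longrightarrow> FS_bound \<phi> D"
  by (rule FS_boundI) (rule order_trans[OF FS_boundD mult_right_mono], auto)

lemma FS_bound_cis [simp]: "FS_bound (\<lambda>u. cis (u \<bullet> a)) 1"
  by (rule FS_boundI) simp

lemma FS_bound_add:
  assumes "FS_bound \<phi> C" "FS_bound \<psi> D"
  shows "FS_bound (\<lambda>u. \<phi> u + \<psi> u) (C + D)"
proof (rule FS_boundI)
  fix S :: "'a set" and c B assume S: "finite S" "\<And>x. norm (\<Sum>u\<in>S. c u * cis (u \<bullet> x)) \<le> B"
  have "(\<Sum>u\<in>S. c u * (\<phi> u + \<psi> u)) = (\<Sum>u\<in>S. c u * \<phi> u) + (\<Sum>u\<in>S. c u * \<psi> u)"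
    by (simp add: algebra_simps sum.distrib)
  also have "norm \<dots> \<le> C * B + D * B"
    using norm_triangle_mono[OF FS_boundD[OF assms(1) S] FS_boundD[OF assms(2) S]] .
  finally show "norm (\<Sum>u\<in>S. c u * (\<phi> u + \<psi> u)) \<le> (C + D) * B"
    by (simp add: algebra_simps)
qed

text \<open>The analogue of the total variation of a convolution. Translating a test polynomial by
  \<open>x\<close> multiplies its coefficients by \<open>cis (u \<bullet> x)\<close> and keeps the
  bound \<open>B\<close>. So the hypothesis on \<open>\<psi>\<close> bounds the polynomial with
  coefficients \<open>c u * \<psi> u\<close> by \<open>D * B\<close>, and the hypothesis on
  \<open>\<phi>\<close> is applied to that polynomial.\<close>

lemma FS_bound_mult:
  assumes "FS_bound \<phi> C" "FS_bound \<psi> D"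
  shows "FS_bound (\<lambda>u. \<phi> u * \<psi> u) (C * D)"
proof (rule FS_boundI)
  fix S :: "'a set" and c B assume S: "finite S" "\<And>x. norm (\<Sum>u\<in>S. c u * cis (u \<bullet> x)) \<le> B"
  have "norm (\<Sum>u\<in>S. (c u * \<psi> u) * \<phi> u) \<le> C * (D * B)"
  proof (rule FS_boundD[OF assms(1) S(1)])
    fix x
    have "norm (\<Sum>u\<in>S. (c u * cis (u \<bullet> x)) * \<psi> u) \<le> D * B"
    proof (rule FS_boundD[OF assms(2) S(1)])
      fix y
      show "norm (\<Sum>u\<in>S. c u * cis (u \<bullet> x) * cis (u \<bullet> y)) \<le> B"
        using S(2)[of "x + y"] by (simp add: cis_mult inner_add_right mult.assoc)
    qed
    then show "norm (\<Sum>u\<in>S. c u * \<psi> u * cis (u \<bullet> x)) \<le> D * B"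
      by (simp add: mult_ac)
  qed
  then show "norm (\<Sum>u\<in>S. c u * (\<phi> u * \<psi> u)) \<le> C * D * B"
    by (simp add: mult_ac)
qed

lemma FS_bound_const: "norm k \<le> C \<Longrightarrow> FS_bound (\<lambda>_. k) C"
proof (rule FS_boundI)
  fix S :: "'a set" and c B
  assume S: "norm k \<le> C" "finite S" "\<And>x. norm (\<Sum>u\<in>S. c u * cis (u \<bullet> x)) \<le> B" "B \<ge> 0"
  have "norm (\<Sum>u\<in>S. c u * k) = norm k * norm (\<Sum>u\<in>S. c u * cis (u \<bullet> 0))"
    by (simp add: sum_distrib_right[symmetric] norm_mult)
  also have "\<dots> \<le> C * B"
    using S(1) S(3)[of 0] norm_ge_zero[of k] by (intro mult_mono) (linarith | simp)+
  finally show "norm (\<Sum>u\<in>S. c u * k) \<le> C * B" .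
qed

lemma FS_bound_cmult:
  assumes "FS_bound \<phi> C" shows "FS_bound (\<lambda>u. k * \<phi> u) (norm k * C)"
  using FS_bound_mult[OF FS_bound_const[OF order_refl, of k] assms] .

lemma FS_bound_diff:
  assumes "FS_bound \<phi> C" "FS_bound \<psi> D"
  shows "FS_bound (\<lambda>u. \<phi> u - \<psi> u) (C + D)"
  using FS_bound_add[OF assms(1) FS_bound_cmult[OF assms(2), of "-1"]] by simp

lemma FS_bound_sum:
  assumes "\<And>i. i \<in> I \<Longrightarrow> FS_bound (\<phi> i) (C i)"
  shows "FS_bound (\<lambda>u. \<Sum>i\<in>I. \<phi> i u) (\<Sum>i\<in>I. C i)"
  using assms
  by (induction I rule: infinite_finite_induct) (auto intro: FS_bound_const FS_bound_add)

lemma FS_bound_prod: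
  assumes "\<And>i. i \<in> I \<Longrightarrow> FS_bound (\<phi> i) (C i)"
  shows "FS_bound (\<lambda>u. \<Prod>i\<in>I. \<phi> i u) (\<Prod>i\<in>I. C i)"
  using assms
  by (induction I rule: infinite_finite_induct) (auto intro: FS_bound_const FS_bound_mult)

lemma FS_bound_prod_1:
  assumes "\<And>i. i \<in> I \<Longrightarrow> FS_bound (\<phi> i) 1"
  shows "FS_bound (\<lambda>u. \<Prod>i\<in>I. \<phi> i u) 1"
  using FS_bound_prod[of I \<phi> "\<lambda>_. 1"] assms by simp

lemma FS_bound_power:
  assumes "FS_bound \<phi> C"
  shows "FS_bound (\<lambda>u. \<phi> u ^ k) (C ^ k)"
  by (induction k) (auto intro: FS_bound_const FS_bound_mult assms)

text \<open>Every test involves only finitely many frequencies, so pointwise convergence of the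
  transforms suffices and no tightness argument is required.\<close>

lemma FS_bound_lim:
  assumes "\<And>n. FS_bound (\<phi> n) (C n)" "\<And>u. (\<lambda>n. \<phi> n u) \<longlonglongrightarrow> \<psi> u" "C \<longlonglongrightarrow> D"
  shows "FS_bound \<psi> D"
proof (rule FS_boundI)
  fix S :: "'a set" and c B assume S: "finite S" "\<And>x. norm (\<Sum>u\<in>S. c u * cis (u \<bullet> x)) \<le> B"
  have "(\<lambda>n. norm (\<Sum>u\<in>S. c u * \<phi> n u)) \<longlonglongrightarrow> norm (\<Sum>u\<in>S. c u * \<psi> u)"
    by (intro tendsto_intros assms)
  moreover have "(\<lambda>n. C n * B) \<longlonglongrightarrow> D * B"
    by (intro tendsto_intros assms)
  ultimately show "norm (\<Sum>u\<in>S. c u * \<psi> u) \<le> D * B"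
    by (rule LIMSEQ_le) (use FS_boundD[OF assms(1) S] in auto)
qed

lemma FS_bound_suminf:
  assumes "\<And>n. FS_bound (\<phi> n) (C n)" "\<And>u. (\<lambda>n. \<phi> n u) sums \<psi> u" "C sums D"
  shows "FS_bound \<psi> D"
  by (rule FS_bound_lim[of "\<lambda>N u. \<Sum>n<N. \<phi> n u" "\<lambda>N. \<Sum>n<N. C n"])
     (use assms in \<open>auto intro: FS_bound_sum simp: sums_def\<close>)

lemma FS_bound_exp:
  assumes "FS_bound \<phi> C"
  shows "FS_bound (\<lambda>u. exp (\<phi> u)) (exp C)"
proof (rule FS_bound_suminf)
  show "FS_bound (\<lambda>u. of_real (1 / fact n) * \<phi> u ^ n) (norm (of_real (1 / fact n) :: complex) * C ^ n)" for n
    by (intro FS_bound_cmult FS_bound_power assms)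
  show "(\<lambda>n. of_real (1 / fact n) * \<phi> u ^ n) sums exp (\<phi> u)" for u
    using exp_converges[of "\<phi> u"] by (simp add: scaleR_conv_of_real divide_inverse)
  show "(\<lambda>n. norm (of_real (1 / fact n) :: complex) * C ^ n) sums exp C"
    using exp_converges[of C] by (simp add: norm_divide divide_inverse norm_inverse norm_of_real del: of_real_inverse)
qed

lemma sums_exp_minus_one_quotient:
  fixes z :: "'x::{real_normed_field,banach}"
  shows "(\<lambda>n. of_real (1 / fact (Suc n)) * z ^ n) sums (if z = 0 then 1 else (exp z - 1) / z)"
proof (cases "z = 0")
  case True
  have "(\<lambda>n. if n = 0 then 1 else 0) sums (1::'x)"
    using sums_If_finite_set[of "{0::nat}" "\<lambda>_. 1::'x"] by simp
  moreover have "(\<lambda>n. of_real (1 / fact (Suc n)) * z ^ n) = (\<lambda>n. if n = 0 then 1 else 0)"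
    using True by (auto simp: fun_eq_iff power_0_left)
  ultimately show ?thesis using True by simp
next
  case False
  have S: "(\<lambda>n. (z ^ Suc n) /\<^sub>R fact (Suc n)) sums (exp z - 1)"
      using exp_converges[of z] by (subst sums_Suc_iff) simp
  have "(\<lambda>n. ((z ^ Suc n) /\<^sub>R fact (Suc n)) / z) sums ((exp z - 1) / z)"
    by (intro sums_divide S)
  moreover have "((z ^ Suc n) /\<^sub>R fact (Suc n)) / z = of_real (1 / fact (Suc n)) * z ^ n" for n
    using False by (simp add: scaleR_conv_of_real divide_inverse del: fact_Suc)
  ultimately show ?thesis using False by simp
qed

text \<open>Division by \<open>\<phi>\<close> is not an operation that preserves such bounds, so
  \<open>(exp z - 1) / z\<close> is expanded as a power series. Its coefficients are positive, and
  the bound is therefore the same function evaluated at \<open>C\<close>.\<close>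

lemma FS_bound_exp_minus_one_quotient:
  assumes "FS_bound \<phi> C" "C > 0"
  obtains \<eta> where "\<And>u. exp (\<phi> u) - 1 = \<phi> u * \<eta> u" "FS_bound \<eta> ((exp C - 1) / C)"
proof
  define \<eta> where "\<eta> u = (\<Sum>n. of_real (1 / fact (Suc n)) * \<phi> u ^ n)" for u
  show "exp (\<phi> u) - 1 = \<phi> u * \<eta> u" for u
    using sums_exp_minus_one_quotient[of "\<phi> u"] unfolding \<eta>_def sums_iff by (auto split: if_splits)
  show "FS_bound \<eta> ((exp C - 1) / C)"
  proof (rule FS_bound_suminf)
    show "FS_bound (\<lambda>u. of_real (1 / fact (Suc n)) * \<phi> u ^ n) (norm (of_real (1 / fact (Suc n)) :: complex) * C ^ n)" for n
      by (intro FS_bound_cmult FS_bound_power assms)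
    show "(\<lambda>n. of_real (1 / fact (Suc n)) * \<phi> u ^ n) sums \<eta> u" for u
      using sums_exp_minus_one_quotient[of "\<phi> u"] unfolding \<eta>_def sums_iff by auto
    have "norm (of_real (1 / fact (Suc n)) :: complex) = of_real (1 / fact (Suc n))" for n
      by (simp only: norm_of_real) simp
    then show "(\<lambda>n. norm (of_real (1 / fact (Suc n)) :: complex) * C ^ n) sums ((exp C - 1) / C)"
      using sums_exp_minus_one_quotient[of C] assms(2) by simp
  qed
qed

lemma FS_bound_integral:
  fixes \<phi> :: "'b \<Rightarrow> 'a::euclidean_space \<Rightarrow> complex"
  assumes int: "\<And>u. integrable M (\<lambda>\<omega>. \<phi> \<omega> u)" "integrable M C"
    and "\<And>\<omega>. \<omega> \<in> space M \<Longrightarrow> FS_bound (\<phi> \<omega>) (C \<omega>)"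
  shows "FS_bound (\<lambda>u. LINT \<omega>|M. \<phi> \<omega> u) (LINT \<omega>|M. C \<omega>)"
proof (rule FS_boundI)
  fix S :: "'a set" and c B assume S: "finite S" "\<And>x. norm (\<Sum>u\<in>S. c u * cis (u \<bullet> x)) \<le> B"
  have "(\<Sum>u\<in>S. c u * (LINT \<omega>|M. \<phi> \<omega> u)) = (LINT \<omega>|M. (\<Sum>u\<in>S. c u * \<phi> \<omega> u))"
    using int by (subst Bochner_Integration.integral_sum) auto
  also have "norm \<dots> \<le> (LINT \<omega>|M. norm (\<Sum>u\<in>S. c u * \<phi> \<omega> u))"
    by (rule integral_norm_bound)
  also have "\<dots> \<le> (LINT \<omega>|M. C \<omega> * B)"
    using int assms(3) by (intro integral_mono FS_boundD[OF _ S]) auto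
  finally show "norm (\<Sum>u\<in>S. c u * (LINT \<omega>|M. \<phi> \<omega> u)) \<le> (LINT \<omega>|M. C \<omega>) * B"
    by simp
qed

lemma FS_bound_cos: "FS_bound (\<lambda>u. of_real (cos (u \<bullet> a))) 1"
proof -
  have "FS_bound (\<lambda>u. (1/2) * (cis (u \<bullet> a) + cis (u \<bullet> (- a)))) (norm (1/2::complex) * (1 + 1))"
    by (intro FS_bound_cmult FS_bound_add FS_bound_cis)
  moreover have "(1/2) * (cis (u \<bullet> a) + cis (u \<bullet> (- a))) = of_real (cos (u \<bullet> a))" for u
    by (simp add: complex_eq_iff)
  ultimately show ?thesis by (simp only:) simp
qed

lemma FS_bound_sin: "FS_bound (\<lambda>u. of_real (sin (u \<bullet> a))) 1"
proof -
  have "FS_bound (\<lambda>u. (-\<i>/2) * (cis (u \<bullet> a) - cis (u \<bullet> (- a)))) (norm (-\<i>/2) * (1 + 1))"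
    by (intro FS_bound_cmult FS_bound_diff FS_bound_cis)
  moreover have "(-\<i>/2) * (cis (u \<bullet> a) - cis (u \<bullet> (- a))) = of_real (sin (u \<bullet> a))" for u
    by (simp add: complex_eq_iff)
  ultimately show ?thesis by (simp only:) (simp add: norm_divide)
qed

text \<open>A Levy--Khintchine exponent, seen through Schoenberg's correspondence.\<close>

definition neg_def :: "('a::euclidean_space \<Rightarrow> real) \<Rightarrow> bool" where
  "neg_def g \<longleftrightarrow> (\<forall>\<theta>\<ge>0. FS_bound (\<lambda>u. of_real (exp (- \<theta> * g u))) 1)"

lemma neg_def_add:
  assumes "neg_def f" "neg_def g" shows "neg_def (\<lambda>u. f u + g u)"
  unfolding neg_def_def
proof (intro allI impI)
  fix \<theta> :: real assume "\<theta> \<ge> 0"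
  then have "FS_bound (\<lambda>u. of_real (exp (- \<theta> * f u)) * of_real (exp (- \<theta> * g u))) (1 * 1)"
    using assms unfolding neg_def_def by (intro FS_bound_mult) auto
  moreover have "of_real (exp (- \<theta> * f u)) * of_real (exp (- \<theta> * g u)) =
      (of_real (exp (- \<theta> * (f u + g u))) :: complex)" for u
    by (simp only: of_real_mult[symmetric] exp_add[symmetric]) (simp add: algebra_simps)
  ultimately show "FS_bound (\<lambda>u. of_real (exp (- \<theta> * (f u + g u)))) 1" by simp
qed

lemma neg_def_cmult:
  assumes "neg_def f" "k \<ge> 0" shows "neg_def (\<lambda>u. k * f u)"
  using assms unfolding neg_def_def by (auto simp: mult.assoc[symmetric])

lemma neg_def_0: "neg_def (\<lambda>_. 0)"
  unfolding neg_def_def by (auto intro: FS_bound_const)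

lemma neg_def_sum:
  assumes "\<And>i. i \<in> I \<Longrightarrow> neg_def (f i)" shows "neg_def (\<lambda>u. \<Sum>i\<in>I. f i u)"
  using assms by (induction I rule: infinite_finite_induct) (auto intro: neg_def_0 neg_def_add)

lemma neg_def_lim:
  assumes "\<And>n. neg_def (f n)" "\<And>u. (\<lambda>n. f n u) \<longlonglongrightarrow> g u" shows "neg_def g"
  unfolding neg_def_def
proof (intro allI impI)
  fix \<theta> :: real assume "\<theta> \<ge> 0"
  show "FS_bound (\<lambda>u. of_real (exp (- \<theta> * g u))) 1"
    by (rule FS_bound_lim[of "\<lambda>n u. of_real (exp (- \<theta> * f n u))" "\<lambda>_. 1"])
       (use assms \<open>\<theta> \<ge> 0\<close> in \<open>auto simp: neg_def_def intro!: tendsto_intros\<close>)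
qed

text \<open>A compound Poisson exponent: expand \<open>exp\<close> of the Fourier transform of the jump measure.\<close>

lemma neg_def_integral_finite:
  fixes X :: "'b \<Rightarrow> 'a::euclidean_space"
  assumes w: "integrable M w" "\<And>\<omega>. \<omega> \<in> space M \<Longrightarrow> w \<omega> \<ge> 0" and X[measurable]: "X \<in> borel_measurable M"
  shows "neg_def (\<lambda>u. LINT \<omega>|M. (1 - cos (u \<bullet> X \<omega>)) * w \<omega>)"
  unfolding neg_def_def
proof (intro allI impI)
  fix \<theta> :: real assume \<theta>: "\<theta> \<ge> 0"
  have [measurable]: "w \<in> borel_measurable M" using w by auto
  have ic: "integrable M (\<lambda>\<omega>. cos (u \<bullet> X \<omega>) * w \<omega>)" for u
    by (rule Bochner_Integration.integrable_bound[OF w(1)])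
       (auto simp: abs_mult intro!: mult_left_le_one_le)
  define z where "z u = (LINT \<omega>|M. complex_of_real (cos (u \<bullet> X \<omega>) * w \<omega>))" for u
  define \<kappa> where "\<kappa> = (LINT \<omega>|M. w \<omega>)"
  have "FS_bound z (LINT \<omega>|M. 1 * norm (complex_of_real (w \<omega>)))"
    unfolding z_def
    unfolding of_real_mult
    by (intro FS_bound_integral FS_bound_mult FS_bound_const FS_bound_cos order_refl
          integrable_of_real[OF ic, unfolded of_real_mult])
       (use w in auto)
  also have "(LINT \<omega>|M. 1 * norm (complex_of_real (w \<omega>))) = \<kappa>"
    unfolding \<kappa>_def by (rule Bochner_Integration.integral_cong) (use w in auto)
  finally have "FS_bound (\<lambda>u. of_real \<theta> * z u) (norm (complex_of_real \<theta>) * \<kappa>)"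
    by (rule FS_bound_cmult)
  then have "FS_bound (\<lambda>u. of_real (exp (- \<theta> * \<kappa>)) * exp (of_real \<theta> * z u))
      (norm (complex_of_real (exp (- \<theta> * \<kappa>))) * exp (\<theta> * \<kappa>))"
    using \<theta> by (intro FS_bound_cmult FS_bound_exp) auto
  moreover have "norm (complex_of_real (exp (- \<theta> * \<kappa>))) * exp (\<theta> * \<kappa>) = 1"
    by (simp add: exp_add[symmetric])
  moreover have "of_real (exp (- \<theta> * \<kappa>)) * exp (of_real \<theta> * z u) =
     of_real (exp (- \<theta> * (LINT \<omega>|M. (1 - cos (u \<bullet> X \<omega>)) * w \<omega>)))" for u
  proof -
    have z: "z u = of_real (LINT \<omega>|M. cos (u \<bullet> X \<omega>) * w \<omega>)"
      unfolding z_def by (rule integral_complex_of_real)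
    have "(LINT \<omega>|M. (1 - cos (u \<bullet> X \<omega>)) * w \<omega>) = \<kappa> - (LINT \<omega>|M. cos (u \<bullet> X \<omega>) * w \<omega>)"
      unfolding \<kappa>_def using ic w by (subst Bochner_Integration.integral_diff[symmetric])
        (auto simp: algebra_simps)
    then have "exp (- \<theta> * \<kappa>) * exp (\<theta> * (LINT \<omega>|M. cos (u \<bullet> X \<omega>) * w \<omega>)) =
        exp (- \<theta> * (LINT \<omega>|M. (1 - cos (u \<bullet> X \<omega>)) * w \<omega>))"
      by (simp add: exp_add[symmetric] right_diff_distrib)
    then show ?thesis
      unfolding z by (simp only: exp_of_real of_real_mult[symmetric])
  qed
  ultimately show "FS_bound (\<lambda>u. of_real (exp (- \<theta> * (LINT \<omega>|M. (1 - cos (u \<bullet> X \<omega>)) * w \<omega>)))) 1"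
    by simp
qed

text \<open>Truncating the weight to \<open>A k\<close> leaves a compound Poisson exponent, and
  dominated convergence removes the truncation. Where \<open>X \<omega> = 0\<close> the integrand
  vanishes, so the sets have to exhaust only the rest; this is what admits a jump measure of
  infinite mass near 0.\<close>

lemma neg_def_integral:
  fixes X :: "'b \<Rightarrow> 'a::euclidean_space"
  assumes X[measurable]: "X \<in> borel_measurable M" and w[measurable]: "w \<in> borel_measurable M"
    and w0: "\<And>\<omega>. \<omega> \<in> space M \<Longrightarrow> w \<omega> \<ge> 0"
    and int: "\<And>u. integrable M (\<lambda>\<omega>. (1 - cos (u \<bullet> X \<omega>)) * w \<omega>)"
    and A: "\<And>k::nat. A k \<in> sets M" "\<And>k. integrable M (\<lambda>\<omega>. indicator (A k) \<omega> * w \<omega>)"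
    and ex: "\<And>\<omega>. \<omega> \<in> space M \<Longrightarrow> X \<omega> \<noteq> 0 \<Longrightarrow> eventually (\<lambda>k. \<omega> \<in> A k) sequentially"
  shows "neg_def (\<lambda>u. LINT \<omega>|M. (1 - cos (u \<bullet> X \<omega>)) * w \<omega>)"
proof (rule neg_def_lim)
  note [measurable] = A(1)
  show "neg_def (\<lambda>u. LINT \<omega>|M. (1 - cos (u \<bullet> X \<omega>)) * (indicator (A k) \<omega> * w \<omega>))" for k
    by (rule neg_def_integral_finite) (use A w0 in auto)
  show "(\<lambda>k. LINT \<omega>|M. (1 - cos (u \<bullet> X \<omega>)) * (indicator (A k) \<omega> * w \<omega>)) \<longlonglongrightarrow>
      (LINT \<omega>|M. (1 - cos (u \<bullet> X \<omega>)) * w \<omega>)" for u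
  proof (rule integral_dominated_convergence[OF _ _ int[of u]])
    show "AE \<omega> in M. (\<lambda>k. (1 - cos (u \<bullet> X \<omega>)) * (indicator (A k) \<omega> * w \<omega>)) \<longlonglongrightarrow> (1 - cos (u \<bullet> X \<omega>)) * w \<omega>"
    proof (rule AE_I2)
      fix \<omega> assume \<omega>: "\<omega> \<in> space M"
      show "(\<lambda>k. (1 - cos (u \<bullet> X \<omega>)) * (indicator (A k) \<omega> * w \<omega>)) \<longlonglongrightarrow> (1 - cos (u \<bullet> X \<omega>)) * w \<omega>"
      proof (cases "X \<omega> = 0")
        case False
        from ex[OF \<omega> False] show ?thesis
          by (intro tendsto_eventually, elim eventually_mono) simp
      qed simp
    qed
    show "AE \<omega> in M. norm ((1 - cos (u \<bullet> X \<omega>)) * (indicator (A k) \<omega> * w \<omega>)) \<le> (1 - cos (u \<bullet> X \<omega>)) * w \<omega>" for k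
      using w0 by (intro AE_I2) (auto simp: abs_mult indicator_def)
  qed auto
qed

lemma FS_bound_cong: "FS_bound \<phi> C \<Longrightarrow> (\<And>u. \<phi> u = \<psi> u) \<Longrightarrow> FS_bound \<psi> C"
  by (subgoal_tac "\<phi> = \<psi>") auto

section \<open>Smoothing by the jumps of one scale\<close>

text \<open>Telescoping: the factors are exchanged one at a time, all other factors having bound 1,
  so the individual errors add up.\<close>

lemma FS_bound_prod_diff:
  assumes "finite I" and "\<And>i. i \<in> I \<Longrightarrow> FS_bound (\<phi> i) 1" "\<And>i. i \<in> I \<Longrightarrow> FS_bound (\<psi> i) 1"
    and "\<And>i. i \<in> I \<Longrightarrow> FS_bound (\<lambda>u. \<phi> i u - \<psi> i u) (q i)"
  shows "FS_bound (\<lambda>u. (\<Prod>i\<in>I. \<phi> i u) - (\<Prod>i\<in>I. \<psi> i u)) (\<Sum>i\<in>I. q i)"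
  using assms
proof (induction I rule: finite_induct)
  case (insert j I)
  have "FS_bound (\<lambda>u. (\<phi> j u - \<psi> j u) * (\<Prod>i\<in>I. \<phi> i u) +
     \<psi> j u * ((\<Prod>i\<in>I. \<phi> i u) - (\<Prod>i\<in>I. \<psi> i u))) (q j * 1 + 1 * (\<Sum>i\<in>I. q i))"
    using insert by (intro FS_bound_add FS_bound_mult FS_bound_prod_1) auto
  then show ?case
    using insert(1,2) by (elim FS_bound_cong[THEN FS_bound_mono]) (auto simp: algebra_simps)
qed (auto intro: FS_bound_const)

text \<open>Meant for translations \<open>E i\<close> and smoothing laws \<open>D i\<close>: a
  translation by a sum is carried out one summand at a time, each absorbed by its own factor
  \<open>D i\<close>.\<close>

lemma FS_bound_prod_minus_one_times:
  assumes "finite I" and "\<And>i. i \<in> I \<Longrightarrow> FS_bound (E i) 1" "\<And>i. i \<in> I \<Longrightarrow> FS_bound (D i) 1"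
    and "\<And>i. i \<in> I \<Longrightarrow> FS_bound (\<lambda>u. (E i u - 1) * D i u) (c i)"
  shows "FS_bound (\<lambda>u. ((\<Prod>i\<in>I. E i u) - 1) * (\<Prod>i\<in>I. D i u)) (\<Sum>i\<in>I. c i)"
proof -
  have "FS_bound (\<lambda>u. (\<Prod>i\<in>I. E i u * D i u) - (\<Prod>i\<in>I. D i u)) (\<Sum>i\<in>I. c i)"
    using assms FS_bound_mult[of "E _" 1 "D _" 1]
    by (intro FS_bound_prod_diff) (auto simp: left_diff_distrib)
  then show ?thesis
    by (rule FS_bound_cong) (simp add: prod.distrib algebra_simps)
qed

text \<open>Separating the event of no jump from the event of at least one jump,
  \<open>exp (- \<kappa> (1 - z)) = exp (- \<kappa>) + z l\<close>.\<close>

lemma compound_Poisson_split: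
  assumes z: "FS_bound z 1" and \<kappa>: "\<kappa> > 0"
  obtains l where "\<And>u. exp (- of_real \<kappa> * (1 - z u)) = of_real (exp (- \<kappa>)) + z u * l u"
    "FS_bound l (1 - exp (- \<kappa>))"
proof -
  have "FS_bound (\<lambda>u. of_real \<kappa> * z u) \<kappa>"
    using FS_bound_cmult[OF z, of "of_real \<kappa>"] \<kappa> by simp
  then obtain h where h: "\<And>u. exp (of_real \<kappa> * z u) - 1 = of_real \<kappa> * z u * h u" "FS_bound h ((exp \<kappa> - 1) / \<kappa>)"
    using FS_bound_exp_minus_one_quotient \<kappa> by blast
  let ?l = "\<lambda>u. of_real (exp (- \<kappa>) * \<kappa>) * h u"
  show ?thesis
  proof
    show "exp (- of_real \<kappa> * (1 - z u)) = of_real (exp (- \<kappa>)) + z u * ?l u" for u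
    proof -
      have "exp (- of_real \<kappa> * (1 - z u)) = exp (- of_real \<kappa>) * exp (of_real \<kappa> * z u)"
        by (simp add: exp_add[symmetric] algebra_simps)
      also have "exp (of_real \<kappa> * z u) = 1 + of_real \<kappa> * z u * h u"
        using h(1)[of u] by (simp add: algebra_simps)
      finally show ?thesis by (simp add: algebra_simps flip: exp_of_real)
    qed
    have "norm (complex_of_real (exp (- \<kappa>) * \<kappa>)) * ((exp \<kappa> - 1) / \<kappa>) = 1 - exp (- \<kappa>)"
      unfolding norm_of_real abs_mult
      using \<kappa> by (simp add: norm_mult field_simps flip: exp_add)
    then show "FS_bound ?l (1 - exp (- \<kappa>))"
      using FS_bound_cmult[OF h(2)] by metis
  qed
qed

text \<open>The expanded product has a part \<open>P\<close> in which every kind of jump occurs; it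
  contains all factors \<open>z i\<close> and is smoothed through the hypothesis on
  \<open>d u * (\<Prod>i\<in>UNIV. z i u)\<close>. On the remainder only the bound \<open>D\<close>
  for \<open>d u * H u\<close> is at hand, but its mass is small. \<open>V\<close> is the noise left
  after extracting these jumps, and \<open>H\<close> is the other factor of the halved exponent,
  kept intact for the recursion.\<close>

lemma FS_bound_single_scale:
  fixes z :: "'i::finite \<Rightarrow> 'a::euclidean_space \<Rightarrow> complex"
  assumes z: "\<And>i. FS_bound (z i) 1" and \<kappa>: "\<And>i. \<kappa> i > 0"
    and G: "FS_bound (\<lambda>u. d u * (\<Prod>i\<in>UNIV. z i u)) C"
    and V: "FS_bound V 1" and H: "FS_bound H 1" "FS_bound (\<lambda>u. d u * H u) D"
  shows "FS_bound (\<lambda>u. d u * ((\<Prod>i\<in>UNIV. exp (- of_real (\<kappa> i) * (1 - z i u))) * V u * H u))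
     (C + (\<Sum>i\<in>UNIV. exp (- \<kappa> i)) * D)"
proof -
  have "\<forall>i. \<exists>l. (\<forall>u. exp (- of_real (\<kappa> i) * (1 - z i u)) = of_real (exp (- \<kappa> i)) + z i u * l u) \<and>
    FS_bound l (1 - exp (- \<kappa> i))"
    using compound_Poisson_split[OF z \<kappa>] by metis
  then obtain l where l: "\<And>i u. exp (- of_real (\<kappa> i) * (1 - z i u)) = of_real (exp (- \<kappa> i)) + z i u * l i u"
    and lb: "\<And>i. FS_bound (l i) (1 - exp (- \<kappa> i))"
    by metis
  define P where "P u = (\<Prod>i\<in>UNIV. z i u * l i u)" for u
  define W where "W u = (\<Prod>i\<in>UNIV. of_real (exp (- \<kappa> i)) + z i u * l i u)" for u
  have lb1: "FS_bound (l i) 1" for i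
    using lb by (rule FS_bound_mono) simp
  \<comment> \<open>The union bound over the kind of jump that fails to occur: factor by factor,
    \<open>W\<close> and \<open>P\<close> differ by the constant
    \<open>exp (- \<kappa> i)\<close>.\<close>
  have R: "FS_bound (\<lambda>u. W u - P u) (\<Sum>i\<in>UNIV. exp (- \<kappa> i))"
    unfolding W_def P_def
  proof (rule FS_bound_prod_diff)
    fix i
    have "FS_bound (\<lambda>u. of_real (exp (- \<kappa> i)) + z i u * l i u) (exp (- \<kappa> i) + 1 * (1 - exp (- \<kappa> i)))"
      by (intro FS_bound_add FS_bound_mult FS_bound_const z lb) simp
    then show "FS_bound (\<lambda>u. of_real (exp (- \<kappa> i)) + z i u * l i u) 1" by simp
    show "FS_bound (\<lambda>u. z i u * l i u) 1"
      using FS_bound_mult[OF z lb1, of i i] by simp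
    show "FS_bound (\<lambda>u. of_real (exp (- \<kappa> i)) + z i u * l i u - z i u * l i u) (exp (- \<kappa> i))"
      by (simp add: FS_bound_const)
  qed simp
  have "FS_bound (\<lambda>u. (d u * (\<Prod>i\<in>UNIV. z i u)) * (\<Prod>i\<in>UNIV. l i u) * V u * H u +
      (W u - P u) * V u * (d u * H u)) (C * 1 * 1 * 1 + (\<Sum>i\<in>UNIV. exp (- \<kappa> i)) * 1 * D)"
    by (intro FS_bound_add FS_bound_mult G R V H FS_bound_prod_1 lb1)
  moreover have "(d u * (\<Prod>i\<in>UNIV. z i u)) * (\<Prod>i\<in>UNIV. l i u) * V u * H u +
      (W u - P u) * V u * (d u * H u) =
      d u * ((\<Prod>i\<in>UNIV. exp (- of_real (\<kappa> i) * (1 - z i u))) * V u * H u)" for u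
    unfolding l W_def[symmetric] by (simp add: P_def prod.distrib algebra_simps)
  ultimately show ?thesis by simp
qed

lemma FS_bound_cis_minus_one: "FS_bound (\<lambda>u. cis (u \<bullet> a) - 1) 2"
  using FS_bound_diff[OF FS_bound_cis[of a] FS_bound_const[of 1 1]] by simp

text \<open>Unrolling the recursion gives a geometric series; the a priori bound \<open>2\<close> kills the remainder.\<close>

lemma FS_bound_iterate:
  fixes W H :: "nat \<Rightarrow> 'a::euclidean_space \<Rightarrow> complex"
  assumes D: "D \<ge> 1" and c: "c \<ge> 0" and ap: "\<And>k. FS_bound (\<lambda>u. d u * H k u) 2"
    and step: "\<And>k \<beta>. FS_bound (\<lambda>u. d u * H (Suc k) u) \<beta> \<Longrightarrow>
       FS_bound (\<lambda>u. d u * H k u) (c * D ^ k + \<beta> / (2 * D))"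
  shows "FS_bound (\<lambda>u. d u * H 0 u) (2 * c)"
proof -
  \<comment> \<open>The recursion runs downwards: it starts at index \<open>m\<close> with the a
    priori bound 2 and after \<open>j\<close> steps has reached \<open>m - j\<close>. Taking
    \<open>j = m\<close> gives a bound for \<open>H 0\<close> for every \<open>m\<close>.\<close>
  have it: "FS_bound (\<lambda>u. d u * H (m - j) u) ((\<Sum>i<j. c * D ^ (m - j + i) * (1 / (2 * D)) ^ i) + 2 * (1 / (2 * D)) ^ j)"
    if "j \<le> m" for m j
    using that
  proof (induction j)
    case 0
    then show ?case using ap by simp
  next
    case (Suc j)
    define k where "k = m - Suc j"
    have k: "m - j = Suc k" "m - Suc j = k" using Suc.prems by (auto simp: k_def)
    have "FS_bound (\<lambda>u. d u * H k u)
       (c * D ^ k + ((\<Sum>i<j. c * D ^ (Suc k + i) * (1 / (2 * D)) ^ i) + 2 * (1 / (2 * D)) ^ j) / (2 * D))"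
      using Suc unfolding k by (intro step) simp
    moreover have "c * D ^ k + ((\<Sum>i<j. c * D ^ (Suc k + i) * (1 / (2 * D)) ^ i) + 2 * (1 / (2 * D)) ^ j) / (2 * D)
       = (\<Sum>i<Suc j. c * D ^ (k + i) * (1 / (2 * D)) ^ i) + 2 * (1 / (2 * D)) ^ Suc j"
      unfolding sum.lessThan_Suc_shift by (simp add: add_divide_distrib sum_divide_distrib)
    ultimately show ?case unfolding k by simp
  qed
  show ?thesis
  proof (rule FS_bound_lim)
    show "FS_bound (\<lambda>u. d u * H 0 u) ((\<Sum>i<j. c * (1 / 2) ^ i) + 2 * (1 / (2 * D)) ^ j)" for j
    proof -
      \<comment> \<open>The growth \<open>D ^ i\<close> of the inhomogeneous terms cancels against
        the contraction factor, leaving the ratio 1/2 whose series produces the constant 2.\<close>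
      have "D ^ i * (1 / (2 * D)) ^ i = (1 / 2) ^ i" for i
        using D by (simp add: power_mult_distrib[symmetric])
      then show ?thesis using it[of j j] by (simp add: mult.assoc)
    qed
    have "(\<lambda>i. c * (1 / 2) ^ i) sums (c * (1 / (1 - 1 / 2)))"
      by (intro sums_mult geometric_sums) simp
    moreover have "(\<lambda>j. (1 / (2 * D)) ^ j) \<longlonglongrightarrow> 0"
      using D by (intro LIMSEQ_realpow_zero) (auto simp: divide_less_eq)
    ultimately have "(\<lambda>j. (\<Sum>i<j. c * (1 / 2) ^ i) + 2 * (1 / (2 * D)) ^ j) \<longlonglongrightarrow> c * (1 / (1 - 1 / 2)) + 2 * 0"
      unfolding sums_def by (rule tendsto_add[OF _ tendsto_mult[OF tendsto_const]])
    then show "(\<lambda>j. (\<Sum>i<j. c * (1 / 2) ^ i) + 2 * (1 / (2 * D)) ^ j) \<longlonglongrightarrow> 2 * c"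
      by (simp add: mult.commute)
  qed simp
qed

text \<open>Uniformly distributed jump lengths smooth along the jump direction: both factors of
  \<open>(cis (b x) - 1) (sin (2 \<rho> x) - sin (\<rho> x)) / (\<rho> x)\<close> with \<open>x = u \<bullet> v\<close> are controlled
  once the division by \<open>x\<close> is moved to the first one.\<close>

definition uniform_jump :: "real \<Rightarrow> 'a::euclidean_space \<Rightarrow> 'a \<Rightarrow> complex" where
  "uniform_jump \<rho> v u = of_real (LINT s:{0..1}|lborel. cos (\<rho> * (1 + s) * (u \<bullet> v)))"

lemma FS_bound_Icc_integral:
  assumes "\<And>u. continuous_on {0..1} (\<lambda>s. \<phi> s u)" "\<And>s. FS_bound (\<phi> s) 1"
  shows "FS_bound (\<lambda>u. CLINT s:{0..1::real}|lborel. \<phi> s u) 1"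
proof -
  have "FS_bound (\<lambda>u. CLINT s|lborel. indicator {0..1} s *\<^sub>R \<phi> s u) (LINT s|lborel. indicator {0..1::real} s)"
  proof (rule FS_bound_integral)
    fix s :: real
    show "FS_bound (\<lambda>u. indicator {0..1} s *\<^sub>R \<phi> s u) (indicator {0..1} s)"
      using FS_bound_const[of 0 0] assms(2) by (cases "s \<in> {0..1}") auto
  next
    show "complex_integrable lborel (\<lambda>s. indicator {0..1} s *\<^sub>R \<phi> s u)" for u
      using borel_integrable_compact[OF compact_Icc assms(1)] by (simp add: indicator_scaleR_eq_if)
  qed simp
  then show ?thesis by (simp add: set_lebesgue_integral_def)
qed

lemma FS_bound_uniform_jump: "FS_bound (uniform_jump \<rho> v) 1"
proof -
  have "FS_bound (\<lambda>u. CLINT s:{0..1::real}|lborel. of_real (cos (u \<bullet> (\<rho> * (1 + s)) *\<^sub>R v))) 1"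
    by (intro FS_bound_Icc_integral FS_bound_cos continuous_intros)
  then show ?thesis
    by (rule FS_bound_cong)
       (simp add: uniform_jump_def set_lebesgue_integral_def scaleR_conv_of_real flip: integral_complex_of_real)
qed

lemma FS_bound_cis_minus_one_uniform_jump:
  assumes \<rho>: "\<rho> > 0"
  shows "FS_bound (\<lambda>u. (cis (u \<bullet> (b *\<^sub>R v)) - 1) * uniform_jump \<rho> v u) (2 * \<bar>b\<bar> / \<rho>)"
proof -
  \<comment> \<open>The mean of the translations along the segment from 0 to
    \<open>b *\<^sub>R v\<close>. Up to the factor \<open>\<i> * b\<close> it is the quotient of
    \<open>cis (b x) - 1\<close> by \<open>x\<close>, in a form whose bound 1 is immediate.\<close>
  define I where "I u = (CLINT s:{0..1::real}|lborel. cis (u \<bullet> ((s * b) *\<^sub>R v)))" for u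
  have I1: "FS_bound I 1"
    unfolding I_def by (intro FS_bound_Icc_integral FS_bound_cis) (auto simp: cis_conv_exp intro!: continuous_intros)
  have I: "cis (u \<bullet> (b *\<^sub>R v)) - 1 = \<i> * of_real (b * (u \<bullet> v)) * I u" for u
  proof -
    define y where "y = b * (u \<bullet> v)"
    have "(CLINT s|lborel. indicator {0..1} s *\<^sub>R (\<i> * of_real y * cis (s * y))) = cis (1 * y) - cis (0 * y)"
      by (rule integral_FTC_Icc)
         (auto simp: has_vector_derivative_def scaleR_conv_of_real mult_ac intro!: derivative_eq_intros continuous_intros)
    moreover have "(CLINT s|lborel. indicator {0..1} s *\<^sub>R (\<i> * of_real y * cis (s * y))) = \<i> * of_real y * I u"
      unfolding I_def set_lebesgue_integral_def y_def
      by (subst integral_mult_right_zero[symmetric]) (simp add: mult.assoc)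
    ultimately show ?thesis by (simp add: y_def)
  qed
  \<comment> \<open>The factor \<open>u \<bullet> v\<close> undoes the integration over jump lengths
    and leaves boundary terms at the lengths \<open>\<rho>\<close> and \<open>2 * \<rho>\<close>.
    Two sines of bound 1 divided by \<open>\<rho>\<close> account for the 2 in
    \<open>2 * \<bar>b\<bar> / \<rho>\<close>.\<close>
  have J: "of_real (u \<bullet> v) * uniform_jump \<rho> v u =
     of_real (1 / \<rho>) * (of_real (sin (u \<bullet> ((2 * \<rho>) *\<^sub>R v))) - of_real (sin (u \<bullet> (\<rho> *\<^sub>R v))))" for u
  proof -
    define x where "x = u \<bullet> v"
    have "(LINT s|lborel. indicator {0..1} s *\<^sub>R (x * cos (\<rho> * (1 + s) * x))) =
       sin (\<rho> * (1 + 1) * x) / \<rho> - sin (\<rho> * (1 + 0) * x) / \<rho>"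
      using \<rho> by (intro integral_FTC_Icc)
         (auto simp flip: has_real_derivative_iff_has_vector_derivative intro!: derivative_eq_intros continuous_intros)
    also have "(LINT s|lborel. indicator {0..1} s *\<^sub>R (x * cos (\<rho> * (1 + s) * x))) =
        x * (LINT s:{0..1}|lborel. cos (\<rho> * (1 + s) * x))"
      unfolding set_lebesgue_integral_def
      by (subst integral_mult_right_zero[symmetric]) (simp add: mult.left_commute)
    finally have "x * (LINT s:{0..1}|lborel. cos (\<rho> * (1 + s) * x)) = (sin (2 * \<rho> * x) - sin (\<rho> * x)) / \<rho>"
      by (simp add: diff_divide_distrib mult.commute)
    then show ?thesis
      unfolding uniform_jump_def x_def[symmetric] of_real_mult[symmetric]
      by (simp add: x_def mult_ac)
  qed
  have "FS_bound (\<lambda>u. (\<i> * of_real b / of_real \<rho>) * (I u * (of_real (sin (u \<bullet> ((2 * \<rho>) *\<^sub>R v))) - of_real (sin (u \<bullet> (\<rho> *\<^sub>R v))))))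
     (norm (\<i> * of_real b / of_real \<rho>) * (1 * (1 + 1)))"
    by (intro FS_bound_cmult FS_bound_mult I1 FS_bound_diff FS_bound_sin)
  then have "FS_bound (\<lambda>u. (\<i> * of_real b / of_real \<rho>) * (I u * (of_real (sin (u \<bullet> ((2 * \<rho>) *\<^sub>R v))) - of_real (sin (u \<bullet> (\<rho> *\<^sub>R v))))))
     (2 * \<bar>b\<bar> / \<rho>)"
    using \<rho> by (simp add: norm_mult norm_divide mult.commute[of _ "2::real"])
  then show ?thesis
  proof (rule FS_bound_cong)
    fix u
    have "(cis (u \<bullet> (b *\<^sub>R v)) - 1) * uniform_jump \<rho> v u = \<i> * of_real b * I u * (of_real (u \<bullet> v) * uniform_jump \<rho> v u)"
      unfolding I by (simp add: mult_ac)
    also have "\<dots> = (\<i> * of_real b / of_real \<rho>) * (I u * (of_real (sin (u \<bullet> ((2 * \<rho>) *\<^sub>R v))) - of_real (sin (u \<bullet> (\<rho> *\<^sub>R v)))))"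
      unfolding J of_real_divide of_real_1 by (simp only: divide_inverse mult_ac mult_1)
    finally show "(\<i> * of_real b / of_real \<rho>) * (I u * (of_real (sin (u \<bullet> ((2 * \<rho>) *\<^sub>R v))) - of_real (sin (u \<bullet> (\<rho> *\<^sub>R v)))))
       = (cis (u \<bullet> (b *\<^sub>R v)) - 1) * uniform_jump \<rho> v u" by simp
  qed
qed

lemma cis_sum: "finite I \<Longrightarrow> cis (\<Sum>i\<in>I. f i) = (\<Prod>i\<in>I. cis (f i))"
  by (induction I rule: finite_induct) (auto simp: cis_mult[symmetric])

lemma FS_bound_prod_uniform_jump:
  fixes v :: "'i::finite \<Rightarrow> 'a::euclidean_space"
  assumes "\<rho> > 0" "a = (\<Sum>i\<in>UNIV. b i *\<^sub>R v i)"
  shows "FS_bound (\<lambda>u. (cis (u \<bullet> a) - 1) * (\<Prod>i\<in>UNIV. uniform_jump \<rho> (v i) u)) (\<Sum>i\<in>UNIV. 2 * \<bar>b i\<bar> / \<rho>)"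
proof -
  have "FS_bound (\<lambda>u. ((\<Prod>i\<in>UNIV. cis (u \<bullet> (b i *\<^sub>R v i))) - 1) * (\<Prod>i\<in>UNIV. uniform_jump \<rho> (v i) u)) (\<Sum>i\<in>UNIV. 2 * \<bar>b i\<bar> / \<rho>)"
    using assms(1)
    by (intro FS_bound_prod_minus_one_times FS_bound_cis FS_bound_uniform_jump FS_bound_cis_minus_one_uniform_jump) auto
  then show ?thesis
    by (simp only: assms(2) inner_sum_right cis_sum[OF finite])
qed

text \<open>The hypothesis on \<open>z i\<close> states abstractly that it is an average of
  \<open>D v\<close> over \<open>v \<in> V i\<close>: a bound uniform in \<open>v\<close> survives
  the averaging. For fixed directions the product smooths; the directions are then averaged
  coordinate by coordinate.\<close>

lemma FS_bound_prod_average: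
  fixes z :: "'i::finite \<Rightarrow> 'a::euclidean_space \<Rightarrow> complex"
  assumes av: "\<And>i \<eta> C. (\<And>v. v \<in> V i \<Longrightarrow> FS_bound (\<lambda>u. \<eta> u * D v u) C) \<Longrightarrow> FS_bound (\<lambda>u. \<eta> u * z i u) C"
    and D: "\<And>v. (\<And>i. v i \<in> V i) \<Longrightarrow> FS_bound (\<lambda>u. d u * (\<Prod>i\<in>UNIV. D (v i) u)) C"
    and ne: "\<And>i. V i \<noteq> {}"
  shows "FS_bound (\<lambda>u. d u * (\<Prod>i\<in>UNIV. z i u)) C"
proof -
  \<comment> \<open>Induction over the set \<open>I\<close> of coordinates already averaged. The
    vectors stay arbitrary in the statement, since the next coordinate to be averaged must still
    range over its whole set \<open>V j\<close>.\<close>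
  have L: "FS_bound (\<lambda>u. d u * (\<Prod>i\<in>-I. D (v i) u) * (\<Prod>i\<in>I. z i u)) C"
    if "\<And>i. v i \<in> V i" for I v
    using finite[of I] that
  proof (induction I arbitrary: v rule: finite_induct)
    case empty
    then show ?case using D by simp
  next
    case (insert j I)
    have "FS_bound (\<lambda>u. (d u * (\<Prod>i\<in>-insert j I. D (v i) u) * (\<Prod>i\<in>I. z i u)) * z j u) C"
    proof (rule av)
      fix w assume w: "w \<in> V j"
      have eq: "- I = insert j (- insert j I)" using insert by auto
      have "FS_bound (\<lambda>u. d u * (\<Prod>i\<in>-I. D ((v(j := w)) i) u) * (\<Prod>i\<in>I. z i u)) C"
        using insert.prems w by (intro insert.IH) auto
      moreover have "(\<Prod>i\<in>-I. D ((v(j := w)) i) u) = D w u * (\<Prod>i\<in>-insert j I. D (v i) u)" for u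
        unfolding eq by (subst prod.insert) (auto intro!: prod.cong)
      ultimately show "FS_bound (\<lambda>u. d u * (\<Prod>i\<in>-insert j I. D (v i) u) * (\<Prod>i\<in>I. z i u) * D w u) C"
        by (simp add: mult_ac)
    qed
    moreover have "(\<Prod>i\<in>insert j I. z i u) = (\<Prod>i\<in>I. z i u) * z j u" for u
      using insert(1,2) by (simp add: mult.commute)
    ultimately show ?case by (simp only: mult.assoc)
  qed
  have some: "(SOME v. v \<in> V i) \<in> V i" for i
    using ne[of i] by (simp add: some_in_eq)
  have "FS_bound (\<lambda>u. d u * (\<Prod>i\<in>-UNIV. D (SOME v. v \<in> V i) u) * (\<Prod>i\<in>UNIV. z i u)) C"
    by (rule L[OF some])
  then show ?thesis by simp
qed

section \<open>The Levy measure in polar coordinates\<close>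

definition radial_measure :: "real \<Rightarrow> real measure" where
  "radial_measure \<alpha> = density lborel (\<lambda>r. ennreal (indicator {0<..} r * (1 / r powr (1 + \<alpha>))))"

lemma sets_radial_measure [simp, measurable_cong]: "sets (radial_measure \<alpha>) = sets borel"
  and space_radial_measure [simp]: "space (radial_measure \<alpha>) = UNIV"
  by (auto simp: radial_measure_def)

lemma sigma_finite_radial_measure: "sigma_finite_measure (radial_measure \<alpha>)"
  unfolding radial_measure_def
  by (subst sigma_finite_measure.sigma_finite_iff_density_finite[OF sigma_finite_lborel]) auto

context
  fixes \<alpha> :: real and \<mu> :: "'a::euclidean_space measure"
  assumes \<mu>: "symmetric_spectral_measure \<mu>"
begin

lemma spectral_sets: "sets \<mu> = sets (restrict_space borel (sphere 0 1))"
  and spectral_finite: "finite_measure \<mu>"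
  using \<mu> by (auto simp: symmetric_spectral_measure_def)

lemma spectral_space: "space \<mu> = sphere 0 1"
  using sets_eq_imp_space_eq[OF spectral_sets] by (simp add: space_restrict_space)

lemma spectral_ident [measurable]: "(\<lambda>\<xi>. \<xi>) \<in> measurable \<mu> (borel :: 'a measure)"
  using measurable_restrict_space1[OF measurable_ident, of "borel :: 'a measure" "sphere 0 1"]
  by (simp add: measurable_cong_sets[OF spectral_sets refl] id_def)

lemma spectral_sets_Int: "B \<in> sets borel \<Longrightarrow> B \<inter> sphere 0 1 \<in> sets \<mu>"
  by (auto simp: spectral_sets sets_restrict_space)

lemma polar_measurable [measurable]:
  "(\<lambda>p. snd p *\<^sub>R fst p) \<in> measurable (\<mu> \<Otimes>\<^sub>M radial_measure \<alpha>) (borel :: 'a measure)"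
  by measurable

lemma stable_levy_measure_polar:
  "stable_levy_measure \<alpha> \<mu> = distr (\<mu> \<Otimes>\<^sub>M radial_measure \<alpha>) borel (\<lambda>p. snd p *\<^sub>R fst p)"
proof (rule measure_eqI)
  fix D assume "D \<in> sets (stable_levy_measure \<alpha> \<mu>)"
  then have D[measurable]: "D \<in> sets borel" by simp
  interpret R: sigma_finite_measure "radial_measure \<alpha>" by (rule sigma_finite_radial_measure)
  let ?E = "(\<lambda>p. snd p *\<^sub>R fst p) -` D \<inter> space (\<mu> \<Otimes>\<^sub>M radial_measure \<alpha>)"
  have E: "?E \<in> sets (\<mu> \<Otimes>\<^sub>M radial_measure \<alpha>)"
    by (rule measurable_sets[OF polar_measurable D])
  have "emeasure (distr (\<mu> \<Otimes>\<^sub>M radial_measure \<alpha>) borel (\<lambda>p. snd p *\<^sub>R fst p)) D =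
      (\<integral>\<^sup>+\<xi>. emeasure (radial_measure \<alpha>) (Pair \<xi> -` ?E) \<partial>\<mu>)"
    by (subst emeasure_distr[OF polar_measurable D]) (rule R.emeasure_pair_measure_alt[OF E])
  also have "\<dots> = (\<integral>\<^sup>+\<xi>. (\<integral>\<^sup>+r\<in>{0<..}. indicator D (r *\<^sub>R \<xi>) * ennreal (1 / r powr (1 + \<alpha>)) \<partial>lborel) \<partial>\<mu>)"
  proof (rule nn_integral_cong)
    fix \<xi> assume \<xi>: "\<xi> \<in> space \<mu>"
    have "Pair \<xi> -` ?E = {r. r *\<^sub>R \<xi> \<in> D}"
      using \<xi> by (auto simp: space_pair_measure)
    moreover have "{r. r *\<^sub>R \<xi> \<in> D} \<in> sets borel" by measurable
    ultimately show "emeasure (radial_measure \<alpha>) (Pair \<xi> -` ?E) =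
        (\<integral>\<^sup>+r\<in>{0<..}. indicator D (r *\<^sub>R \<xi>) * ennreal (1 / r powr (1 + \<alpha>)) \<partial>lborel)"
      unfolding radial_measure_def
      by (subst emeasure_density) (auto intro!: nn_integral_cong simp: indicator_def split: if_splits)
  qed
  also have "\<dots> = emeasure (stable_levy_measure \<alpha> \<mu>) D"
    by (rule emeasure_stable_levy_measure[OF spectral_sets D, symmetric])
  finally show "emeasure (stable_levy_measure \<alpha> \<mu>) D =
     emeasure (distr (\<mu> \<Otimes>\<^sub>M radial_measure \<alpha>) borel (\<lambda>p. snd p *\<^sub>R fst p)) D" ..
qed simp

text \<open>Symmetry in the form of a push-forward permits a change of variables in integrals.
  Negation is an involution, so its preimages within the sphere are its images.\<close>

lemma distr_spectral_uminus: "distr \<mu> \<mu> uminus = \<mu>"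
proof (rule measure_eqI)
  have m: "uminus \<in> measurable \<mu> \<mu>"
    unfolding measurable_cong_sets[OF spectral_sets spectral_sets]
    by (rule measurable_restrict_space3) auto
  fix B assume "B \<in> sets (distr \<mu> \<mu> uminus)"
  then have B: "B \<in> sets \<mu>" by simp
  then have "B \<subseteq> sphere 0 1" using sets.sets_into_space spectral_space by blast
  then have "uminus -` B \<inter> space \<mu> = uminus ` B"
    unfolding spectral_space by (auto simp: image_iff) (metis add.inverse_inverse)
  then show "emeasure (distr \<mu> \<mu> uminus) B = emeasure \<mu> B"
    using B \<mu> m by (simp add: emeasure_distr symmetric_spectral_measure_def)
qed simp

text \<open>In polar coordinates reflection acts on the direction alone, where it preserves
  \<open>\<mu>\<close>. This removes the imaginary part of the exponent, including the
  compensator.\<close>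

lemma distr_stable_levy_measure_uminus:
  "distr (stable_levy_measure \<alpha> \<mu>) borel uminus = stable_levy_measure \<alpha> \<mu>"
proof (rule measure_eqI)
  interpret R: sigma_finite_measure "radial_measure \<alpha>" by (rule sigma_finite_radial_measure)
  have m: "uminus \<in> measurable \<mu> \<mu>"
    unfolding measurable_cong_sets[OF spectral_sets spectral_sets]
    by (rule measurable_restrict_space3) auto
  fix D assume "D \<in> sets (distr (stable_levy_measure \<alpha> \<mu>) borel uminus)"
  then have D[measurable]: "D \<in> sets borel" by simp
  have D': "uminus -` D \<in> sets borel" using measurable_sets[of uminus borel borel D] by simp
  define g where "g \<xi> = (\<integral>\<^sup>+r. indicator D (r *\<^sub>R \<xi>) \<partial>radial_measure \<alpha>)" for \<xi>
  have em: "emeasure (stable_levy_measure \<alpha> \<mu>) E = (\<integral>\<^sup>+\<xi>. (\<integral>\<^sup>+r. indicator E (r *\<^sub>R \<xi>) \<partial>radial_measure \<alpha>) \<partial>\<mu>)"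
    if [measurable]: "E \<in> sets borel" for E
  proof -
    have "emeasure (stable_levy_measure \<alpha> \<mu>) E = (\<integral>\<^sup>+y. indicator E y \<partial>stable_levy_measure \<alpha> \<mu>)"
      by simp
    also have "\<dots> = (\<integral>\<^sup>+p. indicator E (snd p *\<^sub>R fst p) \<partial>(\<mu> \<Otimes>\<^sub>M radial_measure \<alpha>))"
      unfolding stable_levy_measure_polar by (subst nn_integral_distr) auto
    also have "\<dots> = (\<integral>\<^sup>+\<xi>. (\<integral>\<^sup>+r. indicator E (r *\<^sub>R \<xi>) \<partial>radial_measure \<alpha>) \<partial>\<mu>)"
      by (subst R.nn_integral_fst[symmetric]) auto
    finally show ?thesis .
  qed
  have gm: "g \<in> borel_measurable \<mu>" unfolding g_def by measurable
  have "emeasure (distr (stable_levy_measure \<alpha> \<mu>) borel uminus) D = emeasure (stable_levy_measure \<alpha> \<mu>) (uminus -` D)"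
    using sets_eq_imp_space_eq[OF sets_stable_levy_measure[of \<alpha> \<mu>]] measurable_ident_sets[OF sets_stable_levy_measure[of \<alpha> \<mu>]]
    by (subst emeasure_distr) auto
  also have "\<dots> = (\<integral>\<^sup>+\<xi>. g (- \<xi>) \<partial>\<mu>)"
    unfolding em[OF D'] g_def by (auto intro!: nn_integral_cong simp: indicator_def)
  also have "\<dots> = (\<integral>\<^sup>+\<xi>. g \<xi> \<partial>distr \<mu> \<mu> uminus)"
    by (subst nn_integral_distr[OF m]) (auto intro: gm)
  also have "\<dots> = emeasure (stable_levy_measure \<alpha> \<mu>) D"
    unfolding distr_spectral_uminus em[OF D] g_def ..
  finally show "emeasure (distr (stable_levy_measure \<alpha> \<mu>) borel uminus) D = emeasure (stable_levy_measure \<alpha> \<mu>) D" .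
qed simp

text \<open>On the annulus the radial density is at most \<open>?K powr (1 + \<alpha>)\<close> and
  the radii fill an interval inside \<open>{0..?K}\<close>. These annuli exhaust the space without
  the origin and serve as the truncations \<open>A k\<close> in
  \<open>neg_def_integral\<close>.\<close>

lemma stable_levy_measure_annulus_finite:
  assumes "\<alpha> > 0"
  shows "emeasure (stable_levy_measure \<alpha> \<mu>) {y. 1 / real (Suc k) < norm y \<and> norm y \<le> real (Suc k)} < \<infinity>"
proof -
  interpret finite_measure \<mu> by (rule spectral_finite)
  let ?K = "real (Suc k)"
  let ?A = "{y::'a. 1 / ?K < norm y \<and> norm y \<le> ?K}"
  have A: "?A \<in> sets borel" by measurable
  have "emeasure (stable_levy_measure \<alpha> \<mu>) ?A \<le> (\<integral>\<^sup>+\<xi>. ennreal (?K * ?K powr (1 + \<alpha>)) \<partial>\<mu>)"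
    unfolding emeasure_stable_levy_measure[OF spectral_sets A]
  proof (rule nn_integral_mono)
    fix \<xi> assume "\<xi> \<in> space \<mu>"
    then have \<xi>: "norm \<xi> = 1" by (simp add: spectral_space)
    have "(\<integral>\<^sup>+r\<in>{0<..}. indicator ?A (r *\<^sub>R \<xi>) * ennreal (1 / r powr (1 + \<alpha>)) \<partial>lborel) \<le>
       (\<integral>\<^sup>+r. ennreal (?K powr (1 + \<alpha>)) * indicator {0..?K} r \<partial>lborel)"
    proof (rule nn_integral_mono)
      fix r :: real
      have "1 / r powr (1 + \<alpha>) \<le> ?K powr (1 + \<alpha>)" if "1 / ?K < r"
      proof -
        have "r > 0" using that by (smt (verit) divide_nonneg_nonneg of_nat_0_le_iff)
        have "1 / ?K powr (1 + \<alpha>) = (1 / ?K) powr (1 + \<alpha>)"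
          by (simp add: powr_divide)
        also have "\<dots> \<le> r powr (1 + \<alpha>)"
          using that assms by (intro powr_mono2) auto
        finally show ?thesis using \<open>r > 0\<close> by (simp add: field_simps)
      qed
      then show "indicator ?A (r *\<^sub>R \<xi>) * ennreal (1 / r powr (1 + \<alpha>)) * indicator {0<..} r \<le>
         ennreal (?K powr (1 + \<alpha>)) * indicator {0..?K} r"
        using \<xi> by (auto simp: indicator_def intro!: ennreal_leI)
    qed
    also have "\<dots> = ennreal (?K * ?K powr (1 + \<alpha>))"
      by (subst nn_integral_cmult_indicator) (auto simp: ennreal_mult mult.commute)
    finally show "(\<integral>\<^sup>+r\<in>{0<..}. indicator ?A (r *\<^sub>R \<xi>) * ennreal (1 / r powr (1 + \<alpha>)) \<partial>lborel) \<le> \<dots>" .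
  qed
  also have "\<dots> < \<infinity>"
    using emeasure_finite[of "space \<mu>"] by (auto simp: ennreal_mult_less_top less_top[symmetric] ennreal_mult_eq_top_iff)
  finally show ?thesis .
qed

end

section \<open>The exponent in real form\<close>

definition levy_cos_exponent :: "real \<Rightarrow> 'a::euclidean_space measure \<Rightarrow> 'a \<Rightarrow> real" where
  "levy_cos_exponent \<alpha> \<mu> u = (LINT y|stable_levy_measure \<alpha> \<mu>. 1 - cos (u \<bullet> y))"

locale nondegenerate_spectral =
  fixes \<alpha> :: real and \<mu> :: "'a::euclidean_space measure" and C0 :: real
  assumes \<alpha>: "0 < \<alpha>" and \<mu>: "symmetric_spectral_measure \<mu>"
    and C0: "C0 > 0" and nondeg: "\<And>u. Re (stable_exponent \<alpha> \<mu> u) \<ge> C0 * norm u powr \<alpha>"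
begin

abbreviation "\<nu> \<equiv> stable_levy_measure \<alpha> \<mu>"
abbreviation "\<psi> \<equiv> levy_cos_exponent \<alpha> \<mu>"

lemma space_\<nu> [simp]: "space \<nu> = UNIV"
  using sets_eq_imp_space_eq[OF sets_stable_levy_measure] by simp

text \<open>A Bochner integral of a non-integrable function is 0 by convention, and for
  \<open>u \<noteq> 0\<close> this value is excluded by the lower bound \<open>nondeg\<close>.
  Integrability is thus read off from nondegeneracy.\<close>

lemma stable_exponent_integrable:
  "complex_integrable \<nu> (\<lambda>y. iexp (u \<bullet> y) - 1 - \<i> * complex_of_real ((u \<bullet> y) * indicator {y. norm y \<le> 1} y))"
proof (cases "u = 0")
  case True then show ?thesis by simp
next
  case False
  then have "0 < C0 * norm u powr \<alpha>" using C0 by simp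
  then have "Re (stable_exponent \<alpha> \<mu> u) \<noteq> 0" using nondeg[of u] by linarith
  then show ?thesis
    unfolding stable_exponent_def using not_integrable_integral_eq by force
qed

lemma integrable_one_minus_cos: "integrable \<nu> (\<lambda>y. 1 - cos (u \<bullet> y))"
  and stable_exponent_eq: "stable_exponent \<alpha> \<mu> u = of_real (\<psi> u)"
proof -
  let ?h = "\<lambda>y. iexp (u \<bullet> y) - 1 - \<i> * complex_of_real ((u \<bullet> y) * indicator {y. norm y \<le> 1} y)"
  have Re: "Re (?h y) = cos (u \<bullet> y) - 1" and Im: "Im (?h y) = sin (u \<bullet> y) - (u \<bullet> y) * indicator {y. norm y \<le> 1} y" for y
    by (auto simp: cis_conv_exp[symmetric])
  have iRe: "integrable \<nu> (\<lambda>y. Re (?h y))"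
    by (rule integrable_Re[OF stable_exponent_integrable])
  then have "integrable \<nu> (\<lambda>y. - (cos (u \<bullet> y) - 1))"
    unfolding Re by (rule integrable_minus)
  then show "integrable \<nu> (\<lambda>y. 1 - cos (u \<bullet> y))" by simp
  have m: "uminus \<in> measurable \<nu> (borel :: 'a measure)"
    unfolding measurable_cong_sets[OF sets_stable_levy_measure refl] by simp
  \<comment> \<open>The imaginary part is odd, sine and truncated linear term alike, and
    \<open>\<nu>\<close> is invariant under reflection; the integral equals its own
    negative.\<close>
  have "(LINT y|\<nu>. Im (?h y)) = (LINT y|distr \<nu> borel uminus. Im (?h y))"
    by (simp add: distr_stable_levy_measure_uminus[OF \<mu>])
  also have "\<dots> = (LINT y|\<nu>. Im (?h (- y)))"
    by (rule integral_distr[OF m]) measurable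
  also have "\<dots> = - (LINT y|\<nu>. Im (?h y))"
    unfolding Im by (subst Bochner_Integration.integral_minus[symmetric]) (auto simp: indicator_def intro!: Bochner_Integration.integral_cong)
  finally have "(LINT y|\<nu>. Im (?h y)) = 0" by simp
  moreover have "(LINT y|\<nu>. Re (?h y)) = - \<psi> u"
    unfolding Re levy_cos_exponent_def by (subst Bochner_Integration.integral_minus[symmetric]) simp
  ultimately show "stable_exponent \<alpha> \<mu> u = of_real (\<psi> u)"
    unfolding stable_exponent_def
    using integral_Re[OF stable_exponent_integrable[of u]] integral_Im[OF stable_exponent_integrable[of u]]
    by (simp add: complex_eq_iff)
qed

lemma levy_cos_exponent_ge: "\<psi> u \<ge> C0 * norm u powr \<alpha>"
  using nondeg[of u] by (simp add: stable_exponent_eq)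

lemma integrable_one_minus_cos_weight:
  assumes [measurable]: "w \<in> borel_measurable borel" and w: "\<And>y. 0 \<le> w y" "\<And>y. w y \<le> 1"
  shows "integrable \<nu> (\<lambda>y. (1 - cos (u \<bullet> y)) * w y)"
proof (rule Bochner_Integration.integrable_bound[OF integrable_one_minus_cos[of u]])
  show "(\<lambda>y. (1 - cos (u \<bullet> y)) * w y) \<in> borel_measurable \<nu>"
    unfolding measurable_cong_sets[OF sets_stable_levy_measure refl] by measurable
qed (use w in \<open>auto simp: abs_mult intro!: mult_left_le AE_I2\<close>)

end

lemma uniform_jump_real: "uniform_jump \<rho> v u = of_real (Re (uniform_jump \<rho> v u))"
  by (simp add: uniform_jump_def)

lemma uniform_jump_measurable [measurable]:
  fixes v :: "'b \<Rightarrow> 'a::euclidean_space"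
  assumes [measurable]: "v \<in> borel_measurable M"
  shows "(\<lambda>x. Re (uniform_jump \<rho> (v x) u)) \<in> borel_measurable M"
  unfolding uniform_jump_def set_lebesgue_integral_def Re_complex_of_real by measurable

lemma uniform_jump_le: "\<bar>Re (uniform_jump \<rho> v u)\<bar> \<le> 1"
  using FS_bound_norm_le[OF FS_bound_uniform_jump, of \<rho> v u] abs_Re_le_cmod order_trans by blast

section \<open>Jumps with direction in a given set and length of a given order\<close>

locale cartesian_nondegenerate_spectral = nondegenerate_spectral \<alpha> \<mu> C0
  for \<alpha> and \<mu> :: "(real^'n) measure" and C0
begin

text \<open>The weight thins the jumps with direction in \<open>U\<close> and length in \<open>[\<rho>, 2 \<rho>]\<close> so that, in polar
  coordinates, the density \<open>r powr - (1 + \<alpha>)\<close> becomes constant.\<close>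

definition cell_weight :: "real \<Rightarrow> (real^'n) set \<Rightarrow> real^'n \<Rightarrow> real" where
  "cell_weight \<rho> U y = indicator U (y /\<^sub>R norm y) * indicator {\<rho>..2 * \<rho>} (norm y) * (norm y / (2 * \<rho>)) powr (1 + \<alpha>)"

lemma cell_weight_measurable [measurable]:
  assumes [measurable]: "U \<in> sets borel" shows "cell_weight \<rho> U \<in> borel_measurable borel"
  unfolding cell_weight_def by measurable

lemma cell_weight_bounds:
  assumes "\<rho> > 0" shows "0 \<le> cell_weight \<rho> U y" "cell_weight \<rho> U y \<le> 1"
proof -
  show "0 \<le> cell_weight \<rho> U y" by (simp add: cell_weight_def)
  have "(norm y / (2 * \<rho>)) powr (1 + \<alpha>) \<le> 1" if "norm y \<le> 2 * \<rho>"
    using that assms \<alpha> by (intro powr_le1) (auto simp: divide_le_eq)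
  then show "cell_weight \<rho> U y \<le> 1"
    by (auto simp: cell_weight_def indicator_def)
qed

lemma integrable_one_minus_cos_matrix:
  assumes "w \<in> borel_measurable borel" and w: "\<And>y. 0 \<le> w y" "\<And>y. w y \<le> 1"
  shows "integrable \<nu> (\<lambda>y. (1 - cos (u \<bullet> (F *v y))) * w y)"
  using integrable_one_minus_cos_weight[OF assms, of "u v* F"] by (simp add: dot_lmul_matrix)

text \<open>The exponent of jumps \<open>y\<close> that are thinned by \<open>w\<close> and then
  mapped by \<open>F\<close>. With \<open>w\<close> ranging over \<open>[0, 1]\<close> it covers
  both the full noise and what is left after some jumps have been extracted.\<close>

lemma neg_def_weighted:
  assumes w[measurable]: "w \<in> borel_measurable borel" and w01: "\<And>y. 0 \<le> w y" "\<And>y. w y \<le> 1"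
  shows "neg_def (\<lambda>u. LINT y|\<nu>. (1 - cos (u \<bullet> (F *v y))) * w y)"
proof (rule neg_def_integral)
  let ?A = "\<lambda>k. {y::real^'n. 1 / real (Suc k) < norm y \<and> norm y \<le> real (Suc k)}"
  show "(\<lambda>y. F *v y) \<in> borel_measurable \<nu>"
    unfolding measurable_cong_sets[OF sets_stable_levy_measure refl]
    by (intro borel_measurable_continuous_onI matrix_vector_mult_linear_continuous_on)
  show "w \<in> borel_measurable \<nu>"
    unfolding measurable_cong_sets[OF sets_stable_levy_measure refl] by simp
  show "?A k \<in> sets \<nu>" for k unfolding sets_stable_levy_measure by measurable
  then have A: "integrable \<nu> (\<lambda>y. indicator (?A k) y :: real)" for k
    using stable_levy_measure_annulus_finite[OF \<mu> \<alpha>, of k] by (intro integrable_real_indicator) auto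
  show "integrable \<nu> (\<lambda>y. indicator (?A k) y * w y)" for k
  proof (rule Bochner_Integration.integrable_bound[OF A[of k]])
    show "(\<lambda>y. indicator (?A k) y * w y) \<in> borel_measurable \<nu>"
      unfolding measurable_cong_sets[OF sets_stable_levy_measure refl] by measurable
  qed (use w01 in \<open>auto simp: indicator_def\<close>)
  show "integrable \<nu> (\<lambda>y. (1 - cos (u \<bullet> (F *v y))) * w y)" for u
    by (rule integrable_one_minus_cos_matrix[OF assms])
  fix y :: "real^'n" assume "F *v y \<noteq> 0"
  then have "norm y > 0" by auto
  have 1: "\<forall>\<^sub>F k in sequentially. norm y \<le> real (Suc k)"
    using filterlim_real_sequentially[THEN filterlim_sequentially_Suc[THEN iffD2]]
    unfolding filterlim_at_top by blast
  have "(\<lambda>k. 1 / real (Suc k)) \<longlonglongrightarrow> 0"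
    using LIMSEQ_inverse_real_of_nat by (simp add: divide_inverse)
  then have "\<forall>\<^sub>F k in sequentially. 1 / real (Suc k) < norm y"
    using \<open>norm y > 0\<close> by (rule order_tendstoD)
  with 1 show "\<forall>\<^sub>F k in sequentially. y \<in> ?A k"
    by eventually_elim simp
qed (use w01 in auto)

text \<open>The thinned radial density is the constant
  \<open>(2 * \<rho>) powr - (1 + \<alpha>)\<close> on an interval of length \<open>\<rho>\<close>,
  so the radial integral is a multiple of a uniform average over lengths. The cell is thereby a
  compound Poisson exponent with jumps of the kind \<open>uniform_jump\<close>.\<close>

lemma integral_one_minus_cos_cell:
  assumes \<rho>: "\<rho> > 0" and U[measurable]: "U \<in> sets borel"
  shows "(LINT y|\<nu>. (1 - cos (u \<bullet> (F *v y))) * cell_weight \<rho> U y) =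
    (2 * \<rho>) powr - (1 + \<alpha>) * \<rho> * (LINT \<xi>|\<mu>. indicator U \<xi> * (1 - Re (uniform_jump \<rho> (F *v \<xi>) u)))"
proof -
  interpret finite_measure \<mu> by (rule spectral_finite[OF \<mu>])
  interpret R: sigma_finite_measure "radial_measure \<alpha>" by (rule sigma_finite_radial_measure)
  interpret P: pair_sigma_finite \<mu> "radial_measure \<alpha>" ..
  note polar_measurable[OF \<mu>, of \<alpha>, measurable]
  have Fm: "(\<lambda>y. F *v y) \<in> borel_measurable borel"
    by (intro borel_measurable_continuous_onI matrix_vector_mult_linear_continuous_on)
  let ?h = "\<lambda>y. (1 - cos (u \<bullet> (F *v y))) * cell_weight \<rho> U y"
  have hm[measurable]: "?h \<in> borel_measurable borel"
    using Fm by measurable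
  have ih: "integrable \<nu> ?h"
    by (rule integrable_one_minus_cos_matrix) (use cell_weight_bounds[OF \<rho>] in auto)
  then have ip: "integrable (\<mu> \<Otimes>\<^sub>M radial_measure \<alpha>) (\<lambda>(\<xi>, r). ?h (r *\<^sub>R \<xi>))"
    unfolding stable_levy_measure_polar[OF \<mu>]
    by (subst (asm) integrable_distr_eq) (auto simp: split_beta')
  have "(LINT y|\<nu>. ?h y) = (LINT p|(\<mu> \<Otimes>\<^sub>M radial_measure \<alpha>). (\<lambda>(\<xi>, r). ?h (r *\<^sub>R \<xi>)) p)"
    unfolding stable_levy_measure_polar[OF \<mu>]
    by (subst integral_distr) (auto simp: split_beta')
  also have "\<dots> = (LINT \<xi>|\<mu>. LINT r|radial_measure \<alpha>. ?h (r *\<^sub>R \<xi>))"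
    using P.integral_fst'[OF ip] by simp
  also have "\<dots> = (LINT \<xi>|\<mu>. (2 * \<rho>) powr - (1 + \<alpha>) * \<rho> * (indicator U \<xi> * (1 - Re (uniform_jump \<rho> (F *v \<xi>) u))))"
  proof (rule Bochner_Integration.integral_cong[OF refl])
    fix \<xi> assume "\<xi> \<in> space \<mu>"
    then have \<xi>: "norm \<xi> = 1" by (simp add: spectral_space[OF \<mu>])
    define x where "x = u \<bullet> (F *v \<xi>)"
    define K where "K = (2 * \<rho>) powr - (1 + \<alpha>)"
    have "(LINT r|radial_measure \<alpha>. ?h (r *\<^sub>R \<xi>)) = (LINT r|lborel. (indicator {0<..} r * (1 / r powr (1 + \<alpha>))) *\<^sub>R ?h (r *\<^sub>R \<xi>))"
      unfolding radial_measure_def by (rule integral_density) auto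
    also have "\<dots> = (LINT r|lborel. K * indicator U \<xi> * (indicator {\<rho>..2 * \<rho>} r * (1 - cos (r * x))))"
    proof (rule Bochner_Integration.integral_cong[OF refl])
      fix r :: real
      show "(indicator {0<..} r * (1 / r powr (1 + \<alpha>))) *\<^sub>R ?h (r *\<^sub>R \<xi>) = K * indicator U \<xi> * (indicator {\<rho>..2 * \<rho>} r * (1 - cos (r * x)))"
      proof (cases "r \<in> {\<rho>..2 * \<rho>}")
        case True
        then have r: "r > 0" using \<rho> by auto
        then have "(1 / r powr (1 + \<alpha>)) * (r / (2 * \<rho>)) powr (1 + \<alpha>) = K"
          using \<rho> by (simp only: K_def powr_divide powr_minus_divide) (simp add: powr_divide)
        moreover have "cell_weight \<rho> U (r *\<^sub>R \<xi>) = indicator U \<xi> * (r / (2 * \<rho>)) powr (1 + \<alpha>)"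
          using True r \<xi> by (simp add: cell_weight_def)
        moreover have "u \<bullet> (F *v (r *\<^sub>R \<xi>)) = r * x"
          by (simp add: x_def matrix_vector_mult_scaleR)
        ultimately show ?thesis
          using True r by (simp only: indicator_simps greaterThan_iff real_scaleR_def mult_1) (simp only: mult_ac)
      next
        case False
        then show ?thesis using \<xi> by (auto simp: cell_weight_def indicator_def)
      qed
    qed
    also have "\<dots> = K * indicator U \<xi> * (LINT r|lborel. indicator {\<rho>..2 * \<rho>} r * (1 - cos (r * x)))"
      by simp
    \<comment> \<open>The substitution \<open>r = \<rho> * (1 + s)\<close> turns the interval into
      \<open>{0..1}\<close>; its Jacobian is the factor \<open>\<rho>\<close> of the result.\<close>
    also have "(LINT r|lborel. indicator {\<rho>..2 * \<rho>} r * (1 - cos (r * x))) =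
        \<bar>\<rho>\<bar> *\<^sub>R (LINT s|lborel. indicator {\<rho>..2 * \<rho>} (\<rho> + \<rho> * s) * (1 - cos ((\<rho> + \<rho> * s) * x)))"
      using \<rho> by (intro lborel_integral_real_affine) simp
    also have "(LINT s|lborel. indicator {\<rho>..2 * \<rho>} (\<rho> + \<rho> * s) * (1 - cos ((\<rho> + \<rho> * s) * x))) =
        (LINT s|lborel. indicator {0..1} s - indicator {0..1} s *\<^sub>R cos (\<rho> * (1 + s) * x))"
      using \<rho> by (intro Bochner_Integration.integral_cong[OF refl])
        (auto simp: indicator_def algebra_simps mult_le_cancel_left1 zero_le_mult_iff)
    also have "\<dots> = 1 - Re (uniform_jump \<rho> (F *v \<xi>) u)"
    proof -
      have "integrable lborel (\<lambda>s. indicator {0..1::real} s *\<^sub>R cos (\<rho> * (1 + s) * x))"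
        by (intro borel_integrable_compact[of "{0..1::real}" "\<lambda>s. cos (\<rho> * (1 + s) * x)",
              unfolded indicator_scaleR_eq_if[symmetric]] compact_Icc continuous_intros)
      then show ?thesis
        unfolding uniform_jump_def x_def set_lebesgue_integral_def
        by (subst Bochner_Integration.integral_diff) auto
    qed
    finally show "(LINT r|radial_measure \<alpha>. ?h (r *\<^sub>R \<xi>)) =
      (2 * \<rho>) powr - (1 + \<alpha>) * \<rho> * (indicator U \<xi> * (1 - Re (uniform_jump \<rho> (F *v \<xi>) u)))"
      using \<rho> by (simp add: K_def mult_ac)
  qed
  finally show ?thesis by simp
qed

text \<open>From every slot \<open>j \<in> J\<close> the thinned jumps with direction in
  \<open>U i\<close> are extracted, for all \<open>i\<close> at once. Pooled over \<open>J\<close>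
  they form for each \<open>i\<close> one compound Poisson law of rate \<open>\<kappa> i\<close> and
  jump transform \<open>z i\<close>, an average of \<open>uniform_jump\<close> over directions in
  \<open>V i\<close>; the rest of the exponent remains a Levy exponent.
  \<open>FS_bound_single_scale\<close> then applies, and the coordinates of \<open>a\<close> in a
  basis chosen from the sets \<open>V i\<close> give the factor \<open>K\<close>.\<close>

lemma FS_bound_scale_step:
  fixes F :: "nat \<Rightarrow> real^'n^'n" and U V :: "'n \<Rightarrow> (real^'n) set"
  assumes \<rho>: "\<rho> > 0" and U[measurable]: "\<And>i. U i \<in> sets borel"
    and mU: "\<And>i. measure \<mu> (U i \<inter> sphere 0 1) > 0"
    and J: "J \<subseteq> {..<N}" "J \<noteq> {}" and h: "h > 0"
    and FV: "\<And>j i \<xi>. j \<in> J \<Longrightarrow> \<xi> \<in> U i \<Longrightarrow> norm \<xi> = 1 \<Longrightarrow> F j *v \<xi> \<in> V i"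
    and V: "\<And>v a. (\<And>i. v i \<in> V i) \<Longrightarrow> \<exists>b. a = (\<Sum>i\<in>UNIV. b i *\<^sub>R v i) \<and> (\<Sum>i\<in>UNIV. \<bar>b i\<bar>) \<le> K * norm a"
    and H: "FS_bound H 1" "FS_bound (\<lambda>u. (cis (u \<bullet> a) - 1) * H u) \<beta>"
  shows "FS_bound (\<lambda>u. (cis (u \<bullet> a) - 1) * (of_real (exp (- (\<Sum>j<N. h * \<psi> (u v* F j)))) * H u))
    (2 * K * norm a / \<rho> + (\<Sum>i\<in>UNIV. exp (- (real (card J) * h / CARD('n) * (2 * \<rho>) powr - (1 + \<alpha>) * \<rho> * measure \<mu> (U i \<inter> sphere 0 1)))) * \<beta>)"
proof -
  interpret finite_measure \<mu> by (rule spectral_finite[OF \<mu>])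
  note spectral_ident[OF \<mu>, measurable]
  have finJ: "finite J" "card J > 0"
    using J finite_subset[of J] by (auto simp: card_gt_0_iff)
  define m where "m i = measure \<mu> (U i \<inter> sphere 0 1)" for i
  have m0: "m i > 0" for i using mU by (simp add: m_def)
  define q where "q = (2 * \<rho>) powr - (1 + \<alpha>) * \<rho>"
  have q: "q > 0" using \<rho> by (simp add: q_def)
  \<comment> \<open>The expected number of extracted jumps of kind \<open>i\<close>: the number of
    slots times their duration \<open>h\<close>, the share \<open>1 / CARD('n)\<close> of the
    thinning, the radial mass \<open>q\<close> and the spectral mass \<open>m i\<close>.\<close>
  define \<kappa> where "\<kappa> i = real (card J) * h / CARD('n) * q * m i" for i
  have \<kappa>0: "\<kappa> i > 0" for i using finJ h q m0 by (simp add: \<kappa>_def)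
  define I where "I i j u = (LINT \<xi>|\<mu>. indicator (U i) \<xi> * Re (uniform_jump \<rho> (F j *v \<xi>) u))" for i j u
  define z where "z i u = (\<Sum>j\<in>J. I i j u) / (card J * m i)" for i u
  have Fm[measurable]: "(\<lambda>\<xi>. F j *v \<xi>) \<in> borel_measurable \<mu>" for j
    by (rule measurable_compose[OF spectral_ident[OF \<mu>]])
       (intro borel_measurable_continuous_onI matrix_vector_mult_linear_continuous_on)
  have iU: "(LINT \<xi>|\<mu>. indicator (U i) \<xi>) = m i" for i
    by (simp add: m_def spectral_space[OF \<mu>] Int_commute)
  have intI: "integrable \<mu> (\<lambda>\<xi>. indicator (U i) \<xi> * Re (uniform_jump \<rho> (F j *v \<xi>) u))" for i j u
    by (rule integrable_const_bound[where B=1])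
       (use uniform_jump_le in \<open>auto simp: abs_mult indicator_def\<close>)
  have intU: "integrable \<mu> (\<lambda>\<xi>. indicator (U i) \<xi> :: real)" for i
    by (rule integrable_const_bound[where B=1]) (auto simp: indicator_def)
  \<comment> \<open>This is the averaging property demanded by \<open>FS_bound_prod_average\<close>:
    \<open>z i\<close> is a mean over \<open>j \<in> J\<close> and over directions in
    \<open>U i\<close>, all of which \<open>F j\<close> carries into \<open>V i\<close>.\<close>
  have av: "FS_bound (\<lambda>u. \<eta> u * of_real (z i u)) C"
    if FS: "\<And>v. v \<in> V i \<Longrightarrow> FS_bound (\<lambda>u. \<eta> u * uniform_jump \<rho> v u) C" for i \<eta> C
  proof -
    have 1: "FS_bound (\<lambda>u. \<eta> u * of_real (I i j u)) (C * m i)" if j: "j \<in> J" for j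
    proof -
      have "FS_bound (\<lambda>u. CLINT \<xi>|\<mu>. \<eta> u * of_real (indicator (U i) \<xi> * Re (uniform_jump \<rho> (F j *v \<xi>) u))) (LINT \<xi>|\<mu>. C * indicator (U i) \<xi>)"
      proof (rule FS_bound_integral)
        show "complex_integrable \<mu> (\<lambda>\<xi>. \<eta> u * of_real (indicator (U i) \<xi> * Re (uniform_jump \<rho> (F j *v \<xi>) u)))" for u
          by (intro integrable_mult_right integrable_of_real intI)
        show "integrable \<mu> (\<lambda>\<xi>. C * indicator (U i) \<xi>)"
          by (intro integrable_mult_right intU)
        fix \<xi> assume "\<xi> \<in> space \<mu>"
        then have "norm \<xi> = 1" by (simp add: spectral_space[OF \<mu>])
        then show "FS_bound (\<lambda>u. \<eta> u * of_real (indicator (U i) \<xi> * Re (uniform_jump \<rho> (F j *v \<xi>) u))) (C * indicator (U i) \<xi>)"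
          using FS[OF FV[OF j, of \<xi> i]] FS_bound_const[of 0 0]
          by (cases "\<xi> \<in> U i") (auto simp flip: uniform_jump_real)
      qed
      then show ?thesis
        unfolding integral_mult_right_zero integral_complex_of_real I_def[symmetric] iU .
    qed
    have "FS_bound (\<lambda>u. of_real (1 / (card J * m i)) * (\<Sum>j\<in>J. \<eta> u * of_real (I i j u)))
       (norm (complex_of_real (1 / (card J * m i))) * (\<Sum>j\<in>J. C * m i))"
      by (intro FS_bound_cmult FS_bound_sum 1)
    moreover have "of_real (1 / (card J * m i)) * (\<Sum>j\<in>J. \<eta> u * of_real (I i j u)) = \<eta> u * complex_of_real (z i u)" for u
      by (simp add: z_def sum_distrib_left[symmetric])
    moreover have "norm (complex_of_real (1 / (card J * m i))) * (\<Sum>j\<in>J. C * m i) = C"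
      using finJ m0[of i] J(2) by (simp del: of_real_divide add: norm_of_real abs_mult)
    ultimately show ?thesis by (simp only:)
  qed
  have z1: "FS_bound (\<lambda>u. of_real (z i u)) 1" for i
    using av[of i "\<lambda>_. 1" 1] by (simp add: FS_bound_uniform_jump)
  have Vne: "V i \<noteq> {}" for i
  proof -
    have "U i \<inter> sphere 0 1 \<noteq> {}" using mU[of i] by auto
    then show ?thesis using FV[of _ _ i] J by auto
  qed
  have "FS_bound (\<lambda>u. (cis (u \<bullet> a) - 1) * (\<Prod>i\<in>UNIV. uniform_jump \<rho> (v i) u)) (2 * K * norm a / \<rho>)"
    if v: "\<And>i. v i \<in> V i" for v
  proof -
    obtain b where b: "a = (\<Sum>i\<in>UNIV. b i *\<^sub>R v i)" "(\<Sum>i\<in>UNIV. \<bar>b i\<bar>) \<le> K * norm a"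
      using V[of v a, OF v] by auto
    have "(\<Sum>i\<in>UNIV. 2 * \<bar>b i\<bar> / \<rho>) = 2 * (\<Sum>i\<in>UNIV. \<bar>b i\<bar>) / \<rho>"
      by (simp add: sum_divide_distrib sum_distrib_left)
    also have "\<dots> \<le> 2 * K * norm a / \<rho>"
      using b(2) \<rho> by (simp add: divide_right_mono)
    finally show ?thesis
      using FS_bound_prod_uniform_jump[OF \<rho> b(1)] FS_bound_mono by blast
  qed
  then have G: "FS_bound (\<lambda>u. (cis (u \<bullet> a) - 1) * (\<Prod>i\<in>UNIV. of_real (z i u))) (2 * K * norm a / \<rho>)"
    using av Vne by (intro FS_bound_prod_average[where V=V and D="uniform_jump \<rho>" and z="\<lambda>i u. of_real (z i u)"]) auto
  \<comment> \<open>The weight that remains in slot \<open>j\<close>. Dividing by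
    \<open>CARD('n)\<close> keeps the sum of the extracted weights at most 1 even where cells
    overlap, so \<open>w j\<close> stays in \<open>[0, 1]\<close>.\<close>
  define w where "w j y = 1 - (if j \<in> J then (\<Sum>i\<in>UNIV. cell_weight \<rho> (U i) y) / CARD('n) else 0)" for j y
  have wm[measurable]: "w j \<in> borel_measurable borel" for j unfolding w_def by measurable
  have "(\<Sum>i\<in>UNIV. cell_weight \<rho> (U i) y) \<le> (\<Sum>i\<in>(UNIV::'n set). 1)" for y
    by (intro sum_mono cell_weight_bounds[OF \<rho>])
  then have w01: "0 \<le> w j y" "w j y \<le> 1" for j y
    using cell_weight_bounds(1)[OF \<rho>] by (auto simp: w_def divide_le_eq intro!: sum_nonneg divide_nonneg_nonneg)
  define R where "R u = (\<Sum>j<N. h * (LINT y|\<nu>. (1 - cos (u \<bullet> (F j *v y))) * w j y))" for u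
  have "neg_def R"
    unfolding R_def using h w01 by (intro neg_def_sum neg_def_cmult neg_def_weighted) auto
  then have R: "FS_bound (\<lambda>u. of_real (exp (- R u))) 1"
    unfolding neg_def_def by (auto dest: spec[of _ 1])
  have split: "(\<Sum>j<N. h * \<psi> (u v* F j)) = (\<Sum>i\<in>UNIV. \<kappa> i * (1 - z i u)) + R u" for u
  proof -
    have c: "(LINT y|\<nu>. (1 - cos (u \<bullet> (F j *v y))) * cell_weight \<rho> (U i) y) = q * (m i - I i j u)" for i j
      unfolding integral_one_minus_cos_cell[OF \<rho> U] q_def[symmetric] right_diff_distrib mult_1_right I_def
      by (simp only: Bochner_Integration.integral_diff[OF intU intI] iU right_diff_distrib)
    have 1: "\<psi> (u v* F j) = (if j \<in> J then (\<Sum>i\<in>UNIV. q / CARD('n) * (m i - I i j u)) else 0) + (LINT y|\<nu>. (1 - cos (u \<bullet> (F j *v y))) * w j y)" for j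
    proof -
      have "\<psi> (u v* F j) = (LINT y|\<nu>. (\<Sum>i\<in>UNIV. (if j \<in> J then 1 / CARD('n) else 0) * ((1 - cos (u \<bullet> (F j *v y))) * cell_weight \<rho> (U i) y)) + (1 - cos (u \<bullet> (F j *v y))) * w j y)"
        unfolding levy_cos_exponent_def dot_lmul_matrix
        by (intro Bochner_Integration.integral_cong[OF refl], unfold sum_distrib_left[symmetric])
           (simp add: w_def algebra_simps)
      also have "\<dots> = (\<Sum>i\<in>UNIV. (if j \<in> J then 1 / CARD('n) else 0) * (q * (m i - I i j u))) + (LINT y|\<nu>. (1 - cos (u \<bullet> (F j *v y))) * w j y)"
        unfolding c[symmetric]
        by (subst Bochner_Integration.integral_add Bochner_Integration.integral_sum, 
            (intro Bochner_Integration.integrable_sum integrable_mult_right integrable_one_minus_cos_matrix wm w01 cell_weight_bounds[OF \<rho>] cell_weight_measurable U)+)+ simp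
      finally show ?thesis by (auto simp: mult_ac)
    qed
    have "(\<Sum>j<N. h * \<psi> (u v* F j)) = (\<Sum>j<N. if j \<in> J then h * (\<Sum>i\<in>UNIV. q / CARD('n) * (m i - I i j u)) else 0) + R u"
      unfolding R_def 1 by (auto simp: sum.distrib[symmetric] algebra_simps intro!: sum.cong)
    also have "(\<Sum>j<N. if j \<in> J then h * (\<Sum>i\<in>UNIV. q / CARD('n) * (m i - I i j u)) else 0) = (\<Sum>j\<in>J. h * (\<Sum>i\<in>UNIV. q / CARD('n) * (m i - I i j u)))"
      using J(1) by (subst sum.inter_restrict[symmetric]) (auto simp: Int_absorb1)
    also have "\<dots> = (\<Sum>i\<in>UNIV. \<Sum>j\<in>J. h * (q / CARD('n) * (m i - I i j u)))"
      unfolding sum_distrib_left by (rule sum.swap)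
    also have "\<dots> = (\<Sum>i\<in>UNIV. \<kappa> i * (1 - z i u))"
    proof (rule sum.cong[OF refl])
      fix i
      have "(\<Sum>j\<in>J. h * (q / CARD('n) * (m i - I i j u))) = h * q / CARD('n) * (card J * m i - (\<Sum>j\<in>J. I i j u))"
        by (simp add: sum_distrib_left[symmetric] sum_divide_distrib[symmetric] sum_subtractf)
      also have "(\<Sum>j\<in>J. I i j u) = z i u * (card J * m i)"
        using m0[of i] finJ by (simp add: z_def)
      also have "h * q / CARD('n) * (card J * m i - z i u * (card J * m i)) = \<kappa> i * (1 - z i u)"
        by (simp add: \<kappa>_def algebra_simps diff_divide_distrib)
      finally show "(\<Sum>j\<in>J. h * (q / CARD('n) * (m i - I i j u))) = \<kappa> i * (1 - z i u)" .
    qed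
    finally show ?thesis .
  qed
  have "FS_bound (\<lambda>u. (cis (u \<bullet> a) - 1) * ((\<Prod>i\<in>UNIV. exp (- of_real (\<kappa> i) * (1 - of_real (z i u)))) * of_real (exp (- R u)) * H u))
     (2 * K * norm a / \<rho> + (\<Sum>i\<in>UNIV. exp (- \<kappa> i)) * \<beta>)"
    by (rule FS_bound_single_scale[OF z1 \<kappa>0 G R H])
  moreover have "(\<Prod>i\<in>UNIV. exp (- of_real (\<kappa> i) * (1 - of_real (z i u)))) * of_real (exp (- R u)) =
     complex_of_real (exp (- (\<Sum>j<N. h * \<psi> (u v* F j))))" for u
    unfolding split by (simp add: exp_sum[symmetric] exp_add[symmetric] sum_negf flip: exp_of_real)
  moreover have "real (card J) * h / CARD('n) * (2 * \<rho>) powr - (1 + \<alpha>) * \<rho> * measure \<mu> (U i \<inter> sphere 0 1) = \<kappa> i" for i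
    by (simp add: \<kappa>_def q_def m_def mult.assoc)
  ultimately show ?thesis by (simp only:)
qed

end

section \<open>Gradient bounds for the characteristic function\<close>

lemma linear_combination_linear:
  "linear (\<lambda>b::real^'n. \<Sum>i\<in>UNIV. (b $ i) *\<^sub>R (v i :: 'a::real_vector))"
  by (rule linearI) (simp_all add: scaleR_add_left sum.distrib scaleR_sum_right)

text \<open>The basis is indexed by \<open>'n\<close>, one direction for each kind of jump.
  Injectivity of the coordinate map is the form of independence from which a lower bound on norms,
  and with it stability, can be obtained.\<close>

lemma basis_of_spanning_set:
  fixes S :: "(real^'n) set"
  assumes "span S = UNIV"
  obtains \<xi> :: "'n \<Rightarrow> real^'n" where "\<And>i. \<xi> i \<in> S" "inj (\<lambda>b::real^'n. \<Sum>i\<in>UNIV. (b $ i) *\<^sub>R \<xi> i)"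
proof -
  obtain B where B: "B \<subseteq> S" "independent B" "S \<subseteq> span B"
    using maximal_independent_subset by blast
  then have sB: "span B = UNIV"
    using assms span_mono span_span by (metis UNIV_I subsetI subset_antisym)
  have fB: "finite B" using B(2) independent_bound by blast
  have "card B = CARD('n)"
    using dim_eq_card_independent[OF B(2)] dim_span[of B] unfolding sB by (metis DIM_cart DIM_real dim_UNIV mult.right_neutral)
  then obtain f where f: "bij_betw f (UNIV :: 'n set) B"
    using finite_same_card_bij[of "UNIV::'n set" B] fB by auto
  let ?T = "\<lambda>b::real^'n. \<Sum>i\<in>UNIV. (b $ i) *\<^sub>R f i"
  have "surj ?T"
  proof (rule surjI[of _ "\<lambda>x. \<chi> i. (SOME c. x = (\<Sum>v\<in>B. c v *\<^sub>R v)) (f i)"])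
    fix x :: "real^'n"
    have "\<exists>c. x = (\<Sum>v\<in>B. c v *\<^sub>R v)"
      using sB span_finite[OF fB] by (metis (no_types, lifting) UNIV_I imageE)
    from someI_ex[OF this]
    show "?T (\<chi> i. (SOME c. x = (\<Sum>v\<in>B. c v *\<^sub>R v)) (f i)) = x"
      by (subst (2) \<open>x = _\<close>) (simp add: sum.reindex_bij_betw[OF f, of "\<lambda>v. (SOME c. x = (\<Sum>v\<in>B. c v *\<^sub>R v)) v *\<^sub>R v"])
  qed
  then have "inj ?T"
    by (rule linear_surjective_imp_injective[OF linear_combination_linear]) simp
  moreover have "f i \<in> S" for i using f B(1) by (auto simp: bij_betw_def)
  ultimately show ?thesis using that by blast
qed

text \<open>An injective linear map is bounded below by some \<open>c > 0\<close>, and a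
  perturbation of size \<open>c / 2\<close> leaves the lower bound \<open>c / 2\<close>. One
  constant \<open>K\<close> is thus valid for all perturbed bases, as averaging over directions and
  over transport matrices requires.\<close>

lemma perturbed_basis:
  fixes \<xi> :: "'n \<Rightarrow> real^'n"
  assumes "inj (\<lambda>b::real^'n. \<Sum>i\<in>UNIV. (b $ i) *\<^sub>R \<xi> i)"
  obtains \<eta> K where "\<eta> > 0" "K > 0"
    "\<And>v a. (\<And>i. norm (v i - \<xi> i) \<le> \<eta>) \<Longrightarrow> \<exists>b. a = (\<Sum>i\<in>UNIV. b i *\<^sub>R v i) \<and> (\<Sum>i\<in>UNIV. \<bar>b i\<bar>) \<le> K * norm a"
proof -
  obtain c where c: "c > 0" "\<And>b::real^'n. c * norm b \<le> norm (\<Sum>i\<in>UNIV. (b $ i) *\<^sub>R \<xi> i)"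
    using linear_inj_bounded_below_pos[OF linear_combination_linear assms] by metis
  let ?n = "real CARD('n)"
  \<comment> \<open>Moving each of the \<open>?n\<close> vectors by at most \<open>\<eta>\<close>
    changes the combination with coefficients \<open>b\<close> by at most
    \<open>?n * \<eta> * norm b = c / 2 * norm b\<close>.\<close>
  define \<eta> where "\<eta> = c / (2 * ?n)"
  have n: "?n > 0" by simp
  show ?thesis
  proof
    show "\<eta> > 0" "2 * ?n / c > 0" using c n by (auto simp: \<eta>_def)
    fix v :: "'n \<Rightarrow> real^'n" and a assume v: "\<And>i. norm (v i - \<xi> i) \<le> \<eta>"
    let ?T = "\<lambda>b::real^'n. \<Sum>i\<in>UNIV. (b $ i) *\<^sub>R v i"
    have lower: "c / 2 * norm b \<le> norm (?T b)" for b
    proof -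
      have "norm ((\<Sum>i\<in>UNIV. (b $ i) *\<^sub>R \<xi> i) - ?T b) = norm (\<Sum>i\<in>UNIV. (b $ i) *\<^sub>R (\<xi> i - v i))"
        by (simp add: sum_subtractf scaleR_diff_right)
      also have "\<dots> \<le> (\<Sum>i\<in>(UNIV::'n set). norm b * \<eta>)"
        using v component_le_norm_cart[of b]
        by (intro sum_norm_le) (auto simp: norm_minus_commute intro!: mult_mono)
      also have "\<dots> = c / 2 * norm b" using n by (simp add: \<eta>_def)
      finally show ?thesis
        using c(2)[of b] norm_triangle_ineq2[of "\<Sum>i\<in>UNIV. (b $ i) *\<^sub>R \<xi> i" "?T b"] by simp
    qed
    have "inj ?T"
    proof (rule linear_injective_0[OF linear_combination_linear, THEN iffD2], intro allI impI)
      fix b assume "?T b = 0"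
      then have "c / 2 * norm b \<le> 0" using lower[of b] by simp
      then show "b = 0" using c(1) by (simp add: mult_le_0_iff)
    qed
    then have "surj ?T" by (rule linear_injective_imp_surjective[OF linear_combination_linear]) simp
    then obtain b where b: "a = ?T b" by (rule surjE)
    have "(\<Sum>i\<in>UNIV. \<bar>b $ i\<bar>) \<le> (\<Sum>i\<in>(UNIV::'n set). norm b)"
      by (intro sum_mono component_le_norm_cart)
    also have "\<dots> = ?n * norm b" by simp
    also have "\<dots> \<le> 2 * ?n / c * norm a"
      using lower[of b] c(1) n unfolding b by (simp add: field_simps)
    finally show "\<exists>b. a = (\<Sum>i\<in>UNIV. b i *\<^sub>R v i) \<and> (\<Sum>i\<in>UNIV. \<bar>b i\<bar>) \<le> 2 * ?n / c * norm a"
      using b by blast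
  qed
qed

context cartesian_nondegenerate_spectral
begin

definition spectral_support :: "(real^'n) set" where
  "spectral_support = {\<xi>. \<forall>e>0. measure \<mu> (ball \<xi> e \<inter> sphere 0 1) > 0}"

text \<open>The complement is covered by balls of measure zero; by the Lindelof property countably
  many of them suffice.\<close>

lemma AE_spectral_support: "AE \<xi> in \<mu>. \<xi> \<in> spectral_support"
proof -
  interpret finite_measure \<mu> by (rule spectral_finite[OF \<mu>])
  define \<F> where "\<F> = {ball \<xi> e |\<xi> e. measure \<mu> (ball \<xi> e \<inter> sphere 0 1) = 0}"
  obtain \<G> where G: "\<G> \<subseteq> \<F>" "countable \<G>" "\<Union>\<G> = \<Union>\<F>"
    using Lindelof[of \<F>] by (auto simp: \<F>_def)
  have "(\<Union>B\<in>\<G>. B \<inter> sphere 0 1) \<in> null_sets \<mu>"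
  proof (rule null_sets_UN'[OF G(2)])
    fix B assume "B \<in> \<G>"
    with G(1) obtain \<xi> e where B: "B = ball \<xi> e" "measure \<mu> (ball \<xi> e \<inter> sphere 0 1) = 0"
      by (auto simp: \<F>_def)
    then show "B \<inter> sphere 0 1 \<in> null_sets \<mu>"
      using spectral_sets_Int[OF \<mu>, of B] by (auto simp: null_sets_def emeasure_eq_measure)
  qed
  then show ?thesis
  proof (rule AE_I')
    show "{\<xi> \<in> space \<mu>. \<not> \<xi> \<in> spectral_support} \<subseteq> (\<Union>B\<in>\<G>. B \<inter> sphere 0 1)"
    proof
      fix \<xi> assume "\<xi> \<in> {\<xi> \<in> space \<mu>. \<not> \<xi> \<in> spectral_support}"
      then have "\<xi> \<in> sphere 0 1" and "\<exists>e>0. \<not> measure \<mu> (ball \<xi> e \<inter> sphere 0 1) > 0"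
        unfolding spectral_support_def spectral_space[OF \<mu>] by blast+
      then obtain e where e: "\<xi> \<in> sphere 0 1" "e > 0" "\<not> measure \<mu> (ball \<xi> e \<inter> sphere 0 1) > 0"
        by blast
      then have "measure \<mu> (ball \<xi> e \<inter> sphere 0 1) = 0"
        using measure_nonneg[of \<mu> "ball \<xi> e \<inter> sphere 0 1"] by linarith
      with e have "\<xi> \<in> \<Union>\<F>" by (auto simp: \<F>_def intro!: exI[of _ "ball \<xi> e"])
      then show "\<xi> \<in> (\<Union>B\<in>\<G>. B \<inter> sphere 0 1)"
        using e(1) unfolding G(3)[symmetric] by auto
    qed
  qed
qed

text \<open>If \<open>u \<noteq> 0\<close> were orthogonal to the support, almost all jumps would be
  orthogonal to \<open>u\<close>. Then \<open>\<psi> u = 0\<close>, against the lower bound on the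
  exponent.\<close>

lemma span_spectral_support: "span spectral_support = UNIV"
proof (rule ccontr)
  assume "span spectral_support \<noteq> UNIV"
  then obtain u where u: "u \<noteq> 0" "\<And>\<xi>. \<xi> \<in> spectral_support \<Longrightarrow> u \<bullet> \<xi> = 0"
    using span_not_UNIV_orthogonal[of spectral_support] span_base by metis
  let ?D = "{y. u \<bullet> y \<noteq> 0}"
  have D: "?D \<in> sets borel" by measurable
  have "AE \<xi> in \<mu>. (\<integral>\<^sup>+r\<in>{0<..}. indicator ?D (r *\<^sub>R \<xi>) * ennreal (1 / r powr (1 + \<alpha>)) \<partial>lborel) = 0"
    using AE_spectral_support by eventually_elim (simp add: u(2))
  then have "emeasure \<nu> ?D = (\<integral>\<^sup>+\<xi>. 0 \<partial>\<mu>)"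
    unfolding emeasure_stable_levy_measure[OF spectral_sets[OF \<mu>] D] by (rule nn_integral_cong_AE)
  then have "AE y in \<nu>. 1 - cos (u \<bullet> y) = 0"
    using D by (intro AE_I'[of ?D]) (auto simp: null_sets_def)
  then have "\<psi> u = 0"
    unfolding levy_cos_exponent_def by (rule integral_eq_zero_AE)
  then show False
    using levy_cos_exponent_ge[of u] C0 u(1) by (simp add: mult_le_0_iff not_le)
qed

lemma FS_bound_levy_exp:
  assumes "h \<ge> 0"
  shows "FS_bound (\<lambda>u. of_real (exp (- (\<Sum>j<N. h * \<psi> (u v* F j))))) 1"
proof -
  have "neg_def (\<lambda>u. \<psi> (u v* F j))" for j
    using neg_def_weighted[of "\<lambda>_. 1" "F j"] by (simp add: levy_cos_exponent_def dot_lmul_matrix)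
  then have "neg_def (\<lambda>u. \<Sum>j<N. h * \<psi> (u v* F j))"
    using assms by (intro neg_def_sum neg_def_cmult)
  then show ?thesis unfolding neg_def_def by (auto dest: spec[of _ 1])
qed

text \<open>Halving the exponent again and again, \<open>exp (- s 2^-k \<Psi>) = exp (- s 2^-(k+1) \<Psi>)\<^sup>2\<close>, one factor
  smooths at the scale \<open>\<rho> (s 2^-(k+1)) powr (1 / \<alpha>)\<close> unless it makes no jump there, which by the choice of
  \<open>\<rho>\<close> is too unlikely to destroy summability.\<close>

lemma FS_bound_gradient:
  obtains \<delta> where "\<delta> > 0"
    "\<And>T::real. T > 0 \<Longrightarrow> \<exists>B>0. \<forall>s>0. \<forall>(a::real^'n) N J. \<forall>F :: nat \<Rightarrow> real^'n^'n.
       J \<subseteq> {..<N} \<longrightarrow> J \<noteq> {} \<longrightarrow> real (card J) * T = N \<longrightarrow>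
       (\<forall>j\<in>J. \<forall>\<xi>. norm \<xi> = 1 \<longrightarrow> norm (F j *v \<xi> - \<xi>) \<le> \<delta>) \<longrightarrow>
       FS_bound (\<lambda>u. (cis (u \<bullet> a) - 1) * of_real (exp (- (\<Sum>j<N. s / N * \<psi> (u v* F j)))))
         (B * norm a / s powr (1 / \<alpha>))"
proof -
  obtain \<xi> :: "'n \<Rightarrow> real^'n" where \<xi>: "\<And>i. \<xi> i \<in> spectral_support" "inj (\<lambda>b::real^'n. \<Sum>i\<in>UNIV. (b $ i) *\<^sub>R \<xi> i)"
    using basis_of_spanning_set[OF span_spectral_support] by blast
  obtain \<eta> K where \<eta>: "\<eta> > 0" "K > 0"
    "\<And>v a. (\<And>i. norm (v i - \<xi> i) \<le> \<eta>) \<Longrightarrow> \<exists>b. a = (\<Sum>i\<in>UNIV. b i *\<^sub>R v i) \<and> (\<Sum>i\<in>UNIV. \<bar>b i\<bar>) \<le> K * norm a"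
    using perturbed_basis[OF \<xi>(2)] by metis
  \<comment> \<open>Half of the admissible perturbation \<open>\<eta>\<close> is spent on the radius
    of these balls, the other half, which becomes \<open>\<delta>\<close>, on the deviation of
    \<open>F j\<close> from the identity.\<close>
  define U where "U i = ball (\<xi> i) (\<eta> / 2)" for i
  define m where "m i = measure \<mu> (U i \<inter> sphere 0 1)" for i
  have m0: "m i > 0" for i using \<xi>(1)[of i] \<eta>(1) by (simp add: m_def U_def spectral_support_def)
  define D where "D = 2 powr (1 / \<alpha>)"
  have D: "D \<ge> 1" using \<alpha> by (simp add: D_def ge_one_powr_ge_zero)
  define n where "n = real CARD('n)"
  have n: "n \<ge> 1" unfolding n_def by (simp add: Suc_leI)
  define mm where "mm = Min (range m)"
  have mm: "mm > 0" "\<And>i. mm \<le> m i" using m0 by (auto simp: mm_def)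
  show ?thesis
  proof
    show "\<eta> / 2 > 0" using \<eta> by simp
    \<comment> \<open>\<open>1 / T\<close> is the share of slots whose matrix is close to the
      identity. The order of choice matters: \<open>\<delta>\<close> depends on the spectral measure
      alone, \<open>T\<close> will be chosen from \<open>\<delta>\<close> and the matrix
      exponential, and \<open>B\<close> may depend on both but not on \<open>s\<close>,
      \<open>N\<close> or \<open>J\<close>.\<close>
    fix T :: real assume T: "T > 0"
    define c where "c = 2 powr - (1 + \<alpha>) / (n * T)"
    have c: "c > 0" using T n by (simp add: c_def)
    \<comment> \<open>Solves \<open>exp (- c * X * mm) = 1 / (2 * D * n)\<close>. The
      \<open>n\<close> probabilities of missing a direction then add up to at most
      \<open>1 / (2 * D)\<close>, the contraction factor expected by
      \<open>FS_bound_iterate\<close>; \<open>\<rho>\<close> is determined from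
      \<open>\<rho> powr (- \<alpha>) = X\<close>.\<close>
    define X where "X = ln (2 * D * n) / (mm * c)"
    have "2 * D * n > 1"
    proof -
      have "D * n \<ge> 1 * 1" using D n by (intro mult_mono) auto
      then show ?thesis by linarith
    qed
    then have X: "X > 0" using mm c by (simp add: X_def)
    define \<rho> where "\<rho> = X powr (- (1 / \<alpha>))"
    have \<rho>: "\<rho> > 0" using X by (simp add: \<rho>_def)
    have \<rho>X: "\<rho> powr (- \<alpha>) = X" using X \<alpha> by (simp add: \<rho>_def powr_powr)
    have small: "(\<Sum>i\<in>UNIV. exp (- (c * \<rho> powr (- \<alpha>) * m i))) \<le> 1 / (2 * D)"
    proof -
      have "(\<Sum>i\<in>UNIV. exp (- (c * \<rho> powr (- \<alpha>) * m i))) \<le> (\<Sum>i\<in>(UNIV::'n set). exp (- ln (2 * D * n)))"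
      proof (rule sum_mono)
        fix i
        have "ln (2 * D * n) = c * X * mm" using mm c by (simp add: X_def)
        also have "\<dots> \<le> c * X * m i" using c X mm by (intro mult_left_mono) auto
        finally show "exp (- (c * \<rho> powr (- \<alpha>) * m i)) \<le> exp (- ln (2 * D * n))"
          unfolding \<rho>X by simp
      qed
      also have "\<dots> = 1 / (2 * D)"
        using D n by (simp add: exp_minus n_def[symmetric] divide_simps)
      finally show ?thesis .
    qed
    show "\<exists>B>0. \<forall>s>0. \<forall>(a::real^'n) N J. \<forall>F :: nat \<Rightarrow> real^'n^'n.
       J \<subseteq> {..<N} \<longrightarrow> J \<noteq> {} \<longrightarrow> real (card J) * T = N \<longrightarrow>
       (\<forall>j\<in>J. \<forall>\<xi>. norm \<xi> = 1 \<longrightarrow> norm (F j *v \<xi> - \<xi>) \<le> \<eta> / 2) \<longrightarrow>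
       FS_bound (\<lambda>u. (cis (u \<bullet> a) - 1) * of_real (exp (- (\<Sum>j<N. s / N * \<psi> (u v* F j)))))
         (B * norm a / s powr (1 / \<alpha>))"
    proof (intro exI[of _ "4 * K * D / \<rho>"] conjI allI impI)
      show "0 < 4 * K * D / \<rho>" using \<eta> D \<rho> by simp
      fix s :: real and a :: "real^'n" and N J and F :: "nat \<Rightarrow> real^'n^'n"
      assume s: "s > 0" and J: "J \<subseteq> {..<N}" "J \<noteq> {}" and cJ: "real (card J) * T = N"
        and F: "\<forall>j\<in>J. \<forall>\<xi>. norm \<xi> = 1 \<longrightarrow> norm (F j *v \<xi> - \<xi>) \<le> \<eta> / 2"
      have N: "N > 0" using J by (auto intro: gr0I)
      define H where "H k u = complex_of_real (exp (- (\<Sum>j<N. s / 2 ^ k / N * \<psi> (u v* F j))))" for k :: nat and u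
      \<comment> \<open>The value of \<open>2 * K * norm a / r\<close> at \<open>k = 0\<close>,
        where \<open>r = \<rho> * (s / 2) powr (1 / \<alpha>)\<close>; the division by 2 inside the
        power is what brings in the factor \<open>D\<close>.\<close>
      define A where "A = 2 * K * D * norm a / (\<rho> * s powr (1 / \<alpha>))"
      have H1: "FS_bound (H k) 1" for k
        unfolding H_def using s by (intro FS_bound_levy_exp) simp
      have "FS_bound (\<lambda>u. (cis (u \<bullet> a) - 1) * H 0 u) (2 * A)"
      proof (rule FS_bound_iterate[OF D])
        show "A \<ge> 0" using \<eta> D \<rho> s by (simp add: A_def)
        show "FS_bound (\<lambda>u. (cis (u \<bullet> a) - 1) * H k u) 2" for k
          using FS_bound_mult[OF FS_bound_cis_minus_one[of a] H1[of k]] by simp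
        fix k \<beta> assume \<beta>: "FS_bound (\<lambda>u. (cis (u \<bullet> a) - 1) * H (Suc k) u) \<beta>"
        define s' where "s' = s / 2 ^ Suc k"
        have s': "s' > 0" using s by (simp add: s'_def)
        define r where "r = \<rho> * s' powr (1 / \<alpha>)"
        have r: "r > 0" using \<rho> s' by (simp add: r_def)
        have "FS_bound (\<lambda>u. (cis (u \<bullet> a) - 1) * (of_real (exp (- (\<Sum>j<N. s' / N * \<psi> (u v* F j)))) * H (Suc k) u))
          (2 * K * norm a / r + (\<Sum>i\<in>UNIV. exp (- (real (card J) * (s' / N) / CARD('n) * (2 * r) powr - (1 + \<alpha>) * r * measure \<mu> (U i \<inter> sphere 0 1)))) * \<beta>)"
        proof (rule FS_bound_scale_step[OF r _ _ J _ _ _ H1 \<beta>, where V="\<lambda>i. {v. norm (v - \<xi> i) \<le> \<eta>}"])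
          show "U i \<in> sets borel" for i by (simp add: U_def)
          show "measure \<mu> (U i \<inter> sphere 0 1) > 0" for i using m0[of i] by (simp add: m_def)
          show "s' / N > 0" using s' N by simp
          show "F j *v x \<in> {v. norm (v - \<xi> i) \<le> \<eta>}" if "j \<in> J" "x \<in> U i" "norm x = 1" for j i x
          proof -
            have "norm (F j *v x - x) \<le> \<eta> / 2" using F that by blast
            moreover have "norm (x - \<xi> i) < \<eta> / 2" using that(2) by (simp add: U_def dist_norm norm_minus_commute)
            ultimately show ?thesis using norm_triangle_ineq[of "F j *v x - x" "x - \<xi> i"] by simp
          qed
          show "\<exists>b. a = (\<Sum>i\<in>UNIV. b i *\<^sub>R v i) \<and> (\<Sum>i\<in>UNIV. \<bar>b i\<bar>) \<le> K * norm a"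
            if "\<And>i. v i \<in> {v. norm (v - \<xi> i) \<le> \<eta>}" for v a
            using \<eta>(3) that by simp
        qed
        \<comment> \<open>Stable scaling: \<open>r powr - \<alpha>\<close> contributes
          \<open>1 / s'\<close>, which cancels the duration \<open>s'\<close>. The jump rate is
          hence the same at every level \<open>k\<close>, and one choice of \<open>\<rho>\<close>
          serves all levels.\<close>
        moreover have "real (card J) * (s' / N) / CARD('n) * (2 * r) powr - (1 + \<alpha>) * r = c * \<rho> powr (- \<alpha>)"
        proof -
          have "(2 * r) powr - (1 + \<alpha>) * r = 2 powr - (1 + \<alpha>) * (r powr - (1 + \<alpha>) * r powr 1)"
            using r by (simp add: powr_mult)
          also have "r powr - (1 + \<alpha>) * r powr 1 = r powr (- \<alpha>)"
            using r by (simp only: powr_add[symmetric]) simp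
          also have "\<dots> = \<rho> powr (- \<alpha>) / s'"
            using \<rho> s' \<alpha> by (simp add: r_def powr_mult powr_powr powr_minus_divide)
          finally have "(2 * r) powr - (1 + \<alpha>) * r = 2 powr - (1 + \<alpha>) * (\<rho> powr (- \<alpha>) / s')" .
          moreover have "real (card J) * (s' / N) / n = s' / (n * T)"
            using cJ[symmetric] N T by (auto simp: field_simps)
          ultimately show ?thesis
            using s' by (simp add: c_def n_def mult.assoc)
        qed
        ultimately have *: "FS_bound (\<lambda>u. (cis (u \<bullet> a) - 1) * (of_real (exp (- (\<Sum>j<N. s' / N * \<psi> (u v* F j)))) * H (Suc k) u))
          (2 * K * norm a / r + (\<Sum>i\<in>UNIV. exp (- (c * \<rho> powr (- \<alpha>) * m i))) * \<beta>)"
          unfolding m_def by (simp only:)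
        have "r = \<rho> * s powr (1 / \<alpha>) / (D * D ^ k)"
          using s by (simp add: r_def s'_def D_def powr_divide powr_mult powr_power powr_realpow[symmetric] powr_powr mult.commute)
        then have "2 * K * norm a / r = A * D ^ k"
          using \<rho> D s by (simp add: A_def)
        moreover have "(\<Sum>i\<in>UNIV. exp (- (c * \<rho> powr (- \<alpha>) * m i))) * \<beta> \<le> 1 / (2 * D) * \<beta>"
          by (rule mult_right_mono[OF small]) (rule FS_bound_nonneg[OF \<beta>])
        ultimately have "FS_bound (\<lambda>u. (cis (u \<bullet> a) - 1) * (of_real (exp (- (\<Sum>j<N. s' / N * \<psi> (u v* F j)))) * H (Suc k) u))
          (A * D ^ k + \<beta> / (2 * D))"
          using * by (elim FS_bound_mono) simp
        moreover have "of_real (exp (- (\<Sum>j<N. s' / N * \<psi> (u v* F j)))) * H (Suc k) u = H k u" for u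
        proof -
          have "(\<Sum>j<N. s / 2 ^ k / N * \<psi> (u v* F j)) = (\<Sum>j<N. s' / N * \<psi> (u v* F j)) + (\<Sum>j<N. s' / N * \<psi> (u v* F j))"
            unfolding sum.distrib[symmetric] s'_def by (intro sum.cong) (auto simp: field_simps)
          then show ?thesis
            unfolding H_def s'_def[symmetric] by (simp add: exp_add[symmetric] flip: of_real_mult)
        qed
        ultimately show "FS_bound (\<lambda>u. (cis (u \<bullet> a) - 1) * H k u) (A * D ^ k + \<beta> / (2 * D))"
          by simp
      qed
      then show "FS_bound (\<lambda>u. (cis (u \<bullet> a) - 1) * of_real (exp (- (\<Sum>j<N. s / N * \<psi> (u v* F j)))))
         (4 * K * D / \<rho> * norm a / s powr (1 / \<alpha>))"
        unfolding H_def A_def using \<rho> by (simp add: mult_ac)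
    qed
  qed
qed

end

section \<open>From trigonometric polynomials to bounded Borel functions\<close>

definition trig_poly :: "('a::euclidean_space \<Rightarrow> complex) \<Rightarrow> bool" where
  "trig_poly p \<longleftrightarrow> (\<exists>S c. finite S \<and> (\<forall>x. p x = (\<Sum>u\<in>S. c u * cis (u \<bullet> x))))"

lemma trig_poly_cis: "trig_poly (\<lambda>x. k * cis (u \<bullet> x))"
  unfolding trig_poly_def by (intro exI[of _ "{u}"] exI[of _ "\<lambda>_. k"]) simp

lemma trig_poly_const: "trig_poly (\<lambda>x. k)"
  using trig_poly_cis[of k 0] by simp

lemma trig_poly_add:
  assumes "trig_poly p" "trig_poly q" shows "trig_poly (\<lambda>x. p x + q x)"
proof -
  obtain S c where p: "finite S" "\<And>x. p x = (\<Sum>u\<in>S. c u * cis (u \<bullet> x))"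
    using assms(1) unfolding trig_poly_def by blast
  obtain T d where q: "finite T" "\<And>x. q x = (\<Sum>u\<in>T. d u * cis (u \<bullet> x))"
    using assms(2) unfolding trig_poly_def by blast
  let ?e = "\<lambda>u. (if u \<in> S then c u else 0) + (if u \<in> T then d u else 0)"
  have "p x + q x = (\<Sum>u\<in>S \<union> T. ?e u * cis (u \<bullet> x))" for x
  proof -
    have "(\<Sum>u\<in>S \<union> T. (if u \<in> S then c u else 0) * cis (u \<bullet> x)) = p x"
      unfolding p(2) by (rule sum.mono_neutral_cong_right) (use p q in auto)
    moreover have "(\<Sum>u\<in>S \<union> T. (if u \<in> T then d u else 0) * cis (u \<bullet> x)) = q x"
      unfolding q(2) by (rule sum.mono_neutral_cong_right) (use p q in auto)
    ultimately show ?thesis by (simp add: distrib_right sum.distrib)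
  qed
  then show ?thesis unfolding trig_poly_def using p(1) q(1) by (intro exI[of _ "S \<union> T"] exI[of _ ?e]) auto
qed

lemma trig_poly_sum: "(\<And>i. i \<in> I \<Longrightarrow> trig_poly (p i)) \<Longrightarrow> trig_poly (\<lambda>x. \<Sum>i\<in>I. p i x)"
  by (induction I rule: infinite_finite_induct) (auto intro: trig_poly_add trig_poly_const)

lemma trig_poly_mult:
  assumes "trig_poly p" "trig_poly q" shows "trig_poly (\<lambda>x. p x * q x)"
proof -
  obtain S c where p: "finite S" "\<And>x. p x = (\<Sum>u\<in>S. c u * cis (u \<bullet> x))"
    using assms(1) unfolding trig_poly_def by blast
  obtain T d where q: "finite T" "\<And>x. q x = (\<Sum>u\<in>T. d u * cis (u \<bullet> x))"
    using assms(2) unfolding trig_poly_def by blast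
  have "p x * q x = (\<Sum>u\<in>S. \<Sum>v\<in>T. (c u * d v) * cis ((u + v) \<bullet> x))" for x
    unfolding p q sum_product by (simp add: inner_add_left cis_mult[symmetric] mult_ac)
  then show ?thesis by (simp add: trig_poly_sum trig_poly_cis)
qed

lemma trig_poly_cos_sin:
  "trig_poly (\<lambda>x. of_real (cos (u \<bullet> x)))" "trig_poly (\<lambda>x. of_real (sin (u \<bullet> x)))"
proof -
  have "trig_poly (\<lambda>x. (1/2) * cis (u \<bullet> x) + (1/2) * cis ((- u) \<bullet> x))"
    by (intro trig_poly_add trig_poly_cis)
  moreover have "(1/2) * cis (u \<bullet> x) + (1/2) * cis ((- u) \<bullet> x) = of_real (cos (u \<bullet> x))" for x
    by (simp add: complex_eq_iff)
  ultimately show "trig_poly (\<lambda>x. of_real (cos (u \<bullet> x)))" by simp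
  have "trig_poly (\<lambda>x. (-\<i>/2) * cis (u \<bullet> x) + (\<i>/2) * cis ((- u) \<bullet> x))"
    by (intro trig_poly_add trig_poly_cis)
  moreover have "(-\<i>/2) * cis (u \<bullet> x) + (\<i>/2) * cis ((- u) \<bullet> x) = of_real (sin (u \<bullet> x))" for x
    by (simp add: complex_eq_iff)
  ultimately show "trig_poly (\<lambda>x. of_real (sin (u \<bullet> x)))" by simp
qed

definition torus_map :: "real \<Rightarrow> real^'n \<Rightarrow> complex^'n" where
  "torus_map L x = (\<chi> i. cis (x $ i / L))"

text \<open>A linear functional of the torus coordinates is a combination of cosines and sines of
  single coordinates of \<open>x\<close>, and trigonometric polynomials form an algebra. Polynomial
  approximants on the torus therefore pull back to admissible test functions.\<close>

lemma trig_poly_torus_map: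
  assumes "real_polynomial_function G"
  shows "trig_poly (\<lambda>x::real^'n. of_real (G (torus_map L x :: complex^'n)))"
  using assms
proof induction
  case (linear f)
  then interpret bounded_linear f .
  have "f (torus_map L x) = (\<Sum>i\<in>UNIV. cos ((axis i (1 / L)) \<bullet> x) * f (axis i 1) + sin ((axis i (1 / L)) \<bullet> x) * f (axis i \<i>))"
    for x :: "real^'n"
  proof -
    have "torus_map L x = (\<Sum>i\<in>UNIV. cos ((axis i (1 / L)) \<bullet> x) *\<^sub>R axis i 1 + sin ((axis i (1 / L)) \<bullet> x) *\<^sub>R axis i \<i>)"
    proof (rule vec_eq_iff[THEN iffD2], rule allI)
      fix j
      have ax: "axis i (1 / L) \<bullet> x = x $ i / L" for i by (simp add: inner_axis')
      have "(\<Sum>i\<in>UNIV. cos ((axis i (1 / L)) \<bullet> x) *\<^sub>R axis i 1 + sin ((axis i (1 / L)) \<bullet> x) *\<^sub>R axis i \<i>) $ j =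
          (\<Sum>i\<in>UNIV. if i = j then cis (x $ i / L) else 0)"
        unfolding sum_component ax by (intro sum.cong) (auto simp: axis_def complex_eq_iff)
      then show "torus_map L x $ j = (\<Sum>i\<in>UNIV. cos ((axis i (1 / L)) \<bullet> x) *\<^sub>R axis i 1 + sin ((axis i (1 / L)) \<bullet> x) *\<^sub>R axis i \<i>) $ j"
        by (simp add: torus_map_def)
    qed
    then show ?thesis by (simp add: sum add scaleR)
  qed
  then show ?case
    by (simp only: of_real_sum of_real_add of_real_mult)
       (intro trig_poly_sum trig_poly_add trig_poly_mult trig_poly_cos_sin trig_poly_const)
qed (auto intro: trig_poly_const trig_poly_add trig_poly_mult)

text \<open>A function supported in the box \<open>|x_i| < R\<close> lives on the torus of period \<open>2 \<pi> L\<close>,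
  where it is approximated by Stone--Weierstrass; periodicity controls the approximant everywhere.\<close>

lemma trig_poly_approximation:
  fixes g :: "real^'n \<Rightarrow> real"
  assumes g: "continuous_on UNIV g" "\<And>x. \<bar>g x\<bar> \<le> B" "\<And>x i. \<bar>x $ i\<bar> > R \<Longrightarrow> g x = 0"
    and R: "0 < R" and L: "R < pi * L" and e: "e > 0"
  obtains p :: "real^'n \<Rightarrow> real" where "trig_poly (\<lambda>x. of_real (p x))" "\<And>x. \<bar>p x\<bar> \<le> B + e"
    "\<And>x. (\<And>i. \<bar>x $ i\<bar> < pi * L) \<Longrightarrow> \<bar>p x - g x\<bar> < e"
proof -
  have L0: "L > 0" using R L pi_gt_zero by (smt (verit) mult_nonneg_nonpos)
  define K where "K = {z::complex^'n. \<forall>i. norm (z $ i) = 1}"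
  \<comment> \<open>\<open>F\<close> is \<open>g\<close> read on the torus through the angles.
    \<open>Arg\<close> jumps across the negative axis; on \<open>U1\<close> all angles are
    continuous, and on \<open>U2\<close> some angle exceeds \<open>R / L\<close> in modulus, so that
    \<open>F\<close> vanishes. As \<open>R / L < pi\<close>, these two open sets cover the torus
    \<open>K\<close>, and \<open>F\<close> is continuous there.\<close>
  define F where "F z = g (\<chi> i. L * Arg (z $ i))" for z :: "complex^'n"
  define U1 where "U1 = {z::complex^'n. \<forall>i. z $ i \<notin> \<real>\<^sub>\<le>\<^sub>0}"
  define U2 where "U2 = {z::complex^'n. \<exists>i. Re (z $ i) < cos (R / L) * norm (z $ i)}"
  have "compact K"
  proof (rule compact_eq_bounded_closed[THEN iffD2], intro conjI)
    show "closed K" unfolding K_def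
      by (intro closed_Collect_all closed_Collect_eq continuous_intros)
    show "bounded K" unfolding bounded_iff K_def
      by (rule exI[of _ "real CARD('n)"]) (auto simp: norm_vec_def intro!: order_trans[OF L2_set_le_sum])
  qed
  have "open U1"
  proof -
    have "U1 = (\<Inter>i. (\<lambda>z. z $ i) -` (- \<real>\<^sub>\<le>\<^sub>0))" by (auto simp: U1_def)
    also have "open \<dots>"
      by (intro open_INT ballI open_vimage[OF open_Compl[OF closed_nonpos_Reals_complex]])
         (auto intro!: continuous_intros)
    finally show ?thesis .
  qed
  moreover have "continuous_on U1 F"
    unfolding F_def
    by (rule continuous_on_compose2[OF g(1)]) (auto simp: U1_def intro!: continuous_intros)
  moreover have "open U2"
    unfolding U2_def by (intro open_Collect_ex open_Collect_less continuous_intros)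
  moreover have F0: "F z = 0" if "z \<in> U2" for z
  proof -
    obtain i where i: "Re (z $ i) < cos (R / L) * norm (z $ i)" using \<open>z \<in> U2\<close> by (auto simp: U2_def)
    then have zi: "norm (z $ i) > 0" by auto
    have "Re (z $ i) = norm (z $ i) * cos (Arg (z $ i))"
      by (subst Arg_eq[of "z $ i"]) (use zi in \<open>auto simp: cis_conv_exp[symmetric]\<close>)
    then have "cos \<bar>Arg (z $ i)\<bar> < cos (R / L)"
      using i zi by (simp add: mult.commute)
    moreover have "\<bar>Arg (z $ i)\<bar> \<le> pi" using Arg_bounded[of "z $ i"] by auto
    moreover have "0 \<le> R / L" "R / L \<le> pi" using R L L0 by (auto simp: divide_le_eq)
    ultimately have "R / L < \<bar>Arg (z $ i)\<bar>"
      using cos_mono_less_eq[of "\<bar>Arg (z $ i)\<bar>" "R / L"] by simp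
    then have "R < \<bar>L * Arg (z $ i)\<bar>"
      using L0 by (simp add: abs_mult divide_less_eq mult.commute)
    then show ?thesis unfolding F_def by (intro g(3)[of _ i]) simp
  qed
  then have "continuous_on U2 F"
    by (subst continuous_on_cong[OF refl F0]) auto
  ultimately have "continuous_on (U1 \<union> U2) F"
    by (intro continuous_on_open_Un)
  moreover have "K \<subseteq> U1 \<union> U2"
  proof
    fix z assume z: "z \<in> K"
    show "z \<in> U1 \<union> U2"
    proof (cases "z \<in> U1")
      case False
      then obtain i where "z $ i \<in> \<real>\<^sub>\<le>\<^sub>0" by (auto simp: U1_def)
      moreover have "norm (z $ i) = 1" using z by (simp add: K_def)
      ultimately have "Re (z $ i) = -1"
        by (auto simp: complex_nonpos_Reals_iff cmod_eq_Re)
      moreover have "cos (R / L) > cos pi"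
        using R L L0 by (intro cos_monotone_0_pi) (auto simp: divide_less_eq)
      ultimately show ?thesis using \<open>norm (z $ i) = 1\<close> by (auto simp: U2_def intro!: exI[of _ i])
    qed simp
  qed
  ultimately have "continuous_on K F" by (rule continuous_on_subset)
  then obtain G where G: "real_polynomial_function G" "\<And>z. z \<in> K \<Longrightarrow> \<bar>F z - G z\<bar> < e"
    using Stone_Weierstrass_real_polynomial_function[OF \<open>compact K\<close> _ e] by metis
  have tK: "torus_map L x \<in> K" for x by (simp add: K_def torus_map_def)
  show ?thesis
  proof
    show "trig_poly (\<lambda>x::real^'n. of_real (G (torus_map L x)))"
      by (rule trig_poly_torus_map[OF G(1)])
    show "\<bar>G (torus_map L x)\<bar> \<le> B + e" for x
      using G(2)[OF tK[of x]] g(2)[of "\<chi> i. L * Arg (torus_map L x $ i)"] by (simp add: F_def)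
    fix x :: "real^'n" assume x: "\<And>i. \<bar>x $ i\<bar> < pi * L"
    have "Arg (cis (x $ i / L)) = x $ i / L" for i
      using x[of i] L0 by (intro Arg_cis) (auto simp: field_simps abs_less_iff)
    then have "F (torus_map L x) = g x"
      using L0 by (simp add: F_def torus_map_def)
    then show "\<bar>G (torus_map L x) - g x\<bar> < e"
      using G(2)[OF tK[of x]] by (simp add: abs_minus_commute)
  qed
qed

text \<open>By induction over integrable functions the claim reduces to indicators, which regularity
  encloses between a compact and an open set; a Urysohn function interpolates. Sums and dominated
  limits are absorbed by splitting \<open>e\<close>.\<close>

lemma compactly_supported_dense:
  fixes f :: "'a::euclidean_space \<Rightarrow> real"
  assumes "finite_measure M" and sets_M: "sets M = sets borel" and f: "integrable M f" and e: "e > 0"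
  shows "\<exists>g R. continuous_on UNIV g \<and> (\<forall>x. norm x > R \<longrightarrow> g x = 0) \<and> integrable M g \<and> (LINT x|M. \<bar>f x - g x\<bar>) < e"
  using f e
proof (induction arbitrary: e)
  interpret finite_measure M by fact
  case (base A c)
  have sp: "space M = UNIV" using sets_eq_imp_space_eq[OF sets_M] by simp
  have A: "A \<in> sets borel" using base sets_M by simp
  \<comment> \<open>The open set and the compact set each differ from \<open>A\<close> by less than
    \<open>d\<close> in measure, so the error is at most \<open>2 * d * \<bar>c\<bar> < e\<close>;
    the summand 1 covers \<open>c = 0\<close>.\<close>
  define d where "d = e / (4 * (\<bar>c\<bar> + 1))"
  have d: "d > 0" using base by (simp add: d_def)
  have fin: "emeasure M (space M) \<noteq> \<infinity>" by simp
  have "\<exists>K. K \<subseteq> A \<and> compact K \<and> measure M A - d < measure M K"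
  proof (cases "measure M A - d < 0")
    case True then show ?thesis by (intro exI[of _ "{}"]) auto
  next
    case False
    then have "ennreal (measure M A - d) < emeasure M A"
      using d by (simp add: emeasure_eq_measure ennreal_less_iff)
    then obtain K where "K \<subseteq> A" "compact K" "ennreal (measure M A - d) < emeasure M K"
      unfolding inner_regular[OF sets_M fin A] less_SUP_iff by auto
    then show ?thesis using False by (auto simp: emeasure_eq_measure ennreal_less_iff)
  qed
  then obtain K where K: "K \<subseteq> A" "compact K" "measure M A - d < measure M K" by blast
  have "emeasure M A < ennreal (measure M A + d)"
    using d by (simp add: emeasure_eq_measure ennreal_less_iff)
  then obtain U where U: "A \<subseteq> U" "open U" "emeasure M U < ennreal (measure M A + d)"
    unfolding outer_regular[OF sets_M fin A] INF_less_iff by auto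
  then have mU: "measure M U < measure M A + d"
    by (simp add: emeasure_eq_measure ennreal_less_iff)
  obtain r where r: "K \<subseteq> ball 0 r" using compact_imp_bounded[OF K(2)] bounded_subset_ballD by blast
  \<comment> \<open>Intersecting with a ball that contains \<open>K\<close> gives \<open>h\<close>
    bounded support without enlarging the region where it may differ from the indicator.\<close>
  obtain h :: "'a \<Rightarrow> real" where h: "continuous_on UNIV h" "\<And>x. h x \<in> closed_segment 1 0"
    "\<And>x. x \<in> K \<Longrightarrow> h x = 1" "\<And>x. x \<in> - (U \<inter> ball 0 r) \<Longrightarrow> h x = 0"
    by (rule Urysohn[of K "- (U \<inter> ball 0 r)" 1 0]) (use K U r in \<open>auto simp: compact_imp_closed\<close>)
  have h01: "0 \<le> h x" "h x \<le> 1" for x using h(2)[of x] by (auto simp: closed_segment_eq_real_ivl)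
  have hm: "h \<in> borel_measurable M"
    using borel_measurable_continuous_onI[OF h(1)] by (simp add: measurable_cong_sets[OF sets_M refl])
  have ih: "integrable M h"
    by (rule integrable_const_bound[where B=1]) (use h01 hm in auto)
  have KU: "K \<in> sets M" "U \<in> sets M" using K U by (auto simp: sets_M compact_imp_closed)
  have le: "\<bar>indicator A x * c - h x * c\<bar> \<le> \<bar>c\<bar> * indicator (U - K) x" for x
  proof -
    have "\<bar>indicator A x - h x\<bar> \<le> indicator (U - K) x"
      using h01[of x] h(3,4)[of x] K(1) U(1) by (auto simp: indicator_def)
    then have "\<bar>c\<bar> * \<bar>indicator A x - h x\<bar> \<le> \<bar>c\<bar> * indicator (U - K) x" by (rule mult_left_mono) simp
    then show ?thesis by (simp add: abs_mult[symmetric] algebra_simps)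
  qed
  have "(LINT x|M. \<bar>indicator A x * c - h x * c\<bar>) \<le> (LINT x|M. \<bar>c\<bar> * indicator (U - K) x)"
    using base KU ih le by (intro integral_mono integrable_abs Bochner_Integration.integrable_diff integrable_mult_right integrable_mult_left integrable_real_indicator) (auto simp: less_top[symmetric])
  also have "\<dots> = \<bar>c\<bar> * measure M (U - K)" using KU by (simp add: sp)
  also have "measure M (U - K) = measure M U - measure M K"
    using KU K U by (intro finite_measure_Diff) auto
  also have "\<bar>c\<bar> * (measure M U - measure M K) \<le> \<bar>c\<bar> * (2 * d)"
    using K mU by (intro mult_left_mono) auto
  also have "\<dots> < e"
  proof -
    have *: "2 * (e / (4 * x)) * x = e / 2" if "x \<noteq> 0" for x by (simp add: that)
    have "2 * d * (\<bar>c\<bar> + 1) = e / 2" unfolding d_def by (rule *) linarith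
    moreover have "\<bar>c\<bar> * (2 * d) \<le> 2 * d * (\<bar>c\<bar> + 1)" using d by (simp add: algebra_simps)
    ultimately show ?thesis using base(3) by linarith
  qed
  finally have "(LINT x|M. \<bar>indicator A x *\<^sub>R c - h x * c\<bar>) < e" by simp
  then show ?case
    using h(1,4) ih by (intro exI[of _ "\<lambda>x. h x * c"] exI[of _ r]) (auto intro!: continuous_intros)
next
  case (add f1 f2)
  obtain g1 R1 where 1: "continuous_on UNIV g1" "\<forall>x. norm x > R1 \<longrightarrow> g1 x = 0" "integrable M g1" "(LINT x|M. \<bar>f1 x - g1 x\<bar>) < e / 2"
    using add.IH(1)[of "e / 2"] add.prems by auto
  obtain g2 R2 where 2: "continuous_on UNIV g2" "\<forall>x. norm x > R2 \<longrightarrow> g2 x = 0" "integrable M g2" "(LINT x|M. \<bar>f2 x - g2 x\<bar>) < e / 2"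
    using add.IH(2)[of "e / 2"] add.prems by auto
  have "(LINT x|M. \<bar>f1 x + f2 x - (g1 x + g2 x)\<bar>) \<le> (LINT x|M. \<bar>f1 x - g1 x\<bar> + \<bar>f2 x - g2 x\<bar>)"
    using add.hyps 1(3) 2(3) by (intro integral_mono) auto
  also have "\<dots> < e" using add.hyps 1(3,4) 2(3,4) by simp
  finally show ?case
    using 1 2 by (intro exI[of _ "\<lambda>x. g1 x + g2 x"] exI[of _ "max R1 R2"]) (auto intro!: continuous_intros)
next
  case (lim f s)
  have "(\<lambda>i. LINT x|M. \<bar>f x - s i x\<bar>) \<longlonglongrightarrow> (LINT x|M. \<bar>f x - f x\<bar>)"
  proof (rule integral_dominated_convergence[where w="\<lambda>x. 3 * \<bar>f x\<bar>"])
    show "AE x in M. (\<lambda>i. \<bar>f x - s i x\<bar>) \<longlonglongrightarrow> \<bar>f x - f x\<bar>"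
      using lim.hyps(2) by (intro AE_I2 tendsto_intros)
    show "AE x in M. norm \<bar>f x - s i x\<bar> \<le> 3 * \<bar>f x\<bar>" for i
    proof (rule AE_I2)
      fix x assume "x \<in> space M"
      then show "norm \<bar>f x - s i x\<bar> \<le> 3 * \<bar>f x\<bar>" using lim.hyps(3)[of x i] by auto
    qed
  qed (use lim in auto)
  then have "\<forall>\<^sub>F i in sequentially. (LINT x|M. \<bar>f x - s i x\<bar>) < e / 2"
    using lim.prems by (intro order_tendstoD) auto
  then obtain i where i: "(LINT x|M. \<bar>f x - s i x\<bar>) < e / 2"
    using eventually_happens by fastforce
  obtain g R where g: "continuous_on UNIV g" "\<forall>x. norm x > R \<longrightarrow> g x = 0" "integrable M g" "(LINT x|M. \<bar>s i x - g x\<bar>) < e / 2"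
    using lim.IH[of "e / 2" i] lim.prems by auto
  have "(LINT x|M. \<bar>f x - g x\<bar>) \<le> (LINT x|M. \<bar>f x - s i x\<bar> + \<bar>s i x - g x\<bar>)"
    using lim.hyps g(3) by (intro integral_mono) auto
  also have "\<dots> < e" using lim.hyps g(3,4) i by simp
  finally show ?case using g by blast
qed


text \<open>The definition of \<open>FS_bound\<close> with \<open>p\<close> itself as test
  polynomial: integrating its exponentials termwise turns the signed sum of expectations into a
  pairing of its coefficients with the transform.\<close>

lemma FS_bound_trig_poly_expectation:
  fixes X :: "'k \<Rightarrow> 'w \<Rightarrow> 'a::euclidean_space"
  assumes M: "finite_measure M" and X[measurable]: "\<And>k. k \<in> K \<Longrightarrow> X k \<in> borel_measurable M"
    and FS: "FS_bound (\<lambda>u. \<Sum>k\<in>K. of_real (\<epsilon> k) * (CLINT \<omega>|M. cis (u \<bullet> X k \<omega>))) C"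
    and p: "trig_poly (\<lambda>x. of_real (p x))" "\<And>x. \<bar>p x\<bar> \<le> B"
  shows "\<bar>\<Sum>k\<in>K. \<epsilon> k * (LINT \<omega>|M. p (X k \<omega>))\<bar> \<le> C * B"
proof -
  interpret finite_measure M by fact
  obtain S c where S: "finite S" "\<And>x. of_real (p x) = (\<Sum>u\<in>S. c u * cis (u \<bullet> x))"
    using p(1) unfolding trig_poly_def by blast
  have int: "complex_integrable M (\<lambda>\<omega>. cis (u \<bullet> X k \<omega>))" if "k \<in> K" for u k
    using X[OF that] by (intro integrable_const_bound[where B=1]) (auto simp: cis_conv_exp)
  have "complex_of_real (\<Sum>k\<in>K. \<epsilon> k * (LINT \<omega>|M. p (X k \<omega>))) =
      (\<Sum>k\<in>K. of_real (\<epsilon> k) * (CLINT \<omega>|M. of_real (p (X k \<omega>))))"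
    by (simp only: of_real_sum of_real_mult integral_complex_of_real)
  also have "\<dots> = (\<Sum>k\<in>K. of_real (\<epsilon> k) * (\<Sum>u\<in>S. c u * (CLINT \<omega>|M. cis (u \<bullet> X k \<omega>))))"
    unfolding S(2) by (intro sum.cong refl) (simp add: Bochner_Integration.integral_sum int)
  also have "\<dots> = (\<Sum>u\<in>S. c u * (\<Sum>k\<in>K. of_real (\<epsilon> k) * (CLINT \<omega>|M. cis (u \<bullet> X k \<omega>))))"
    unfolding sum_distrib_left by (subst sum.swap) (simp add: mult_ac)
  also have "norm \<dots> \<le> C * B"
    by (rule FS_boundD[OF FS S(1)]) (use p(2) in \<open>simp flip: S(2)\<close>)
  finally show ?thesis by (simp only: norm_of_real)
qed

text \<open>Trigonometric approximants on growing boxes converge pointwise to \<open>g\<close>. They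
  are bounded by \<open>B + 1 / Suc m\<close> on the whole space, so bounded convergence applies and
  the sharp constant \<open>C * B\<close> survives in the limit.\<close>

lemma FS_bound_compactly_supported_expectation:
  fixes X :: "'k \<Rightarrow> 'w \<Rightarrow> real^'n"
  assumes M: "finite_measure M" and X[measurable]: "\<And>k. k \<in> K \<Longrightarrow> X k \<in> borel_measurable M"
    and FS: "FS_bound (\<lambda>u. \<Sum>k\<in>K. of_real (\<epsilon> k) * (CLINT \<omega>|M. cis (u \<bullet> X k \<omega>))) C"
    and g: "continuous_on UNIV g" "\<And>x. \<bar>g x\<bar> \<le> B" "\<And>x. norm x > R \<Longrightarrow> g x = 0"
  shows "\<bar>\<Sum>k\<in>K. \<epsilon> k * (LINT \<omega>|M. g (X k \<omega>))\<bar> \<le> C * B"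
proof -
  interpret finite_measure M by fact
  define R' where "R' = max R 1"
  define L where "L m = R' + real m" for m
  have ex: "\<exists>p. trig_poly (\<lambda>x. of_real (p x)) \<and> (\<forall>x. \<bar>p x\<bar> \<le> B + 1 / Suc m) \<and>
     (\<forall>x. (\<forall>i. \<bar>x $ i\<bar> < pi * L m) \<longrightarrow> \<bar>p x - g x\<bar> < 1 / Suc m)" for m
  proof -
    have z: "g x = 0" if "\<bar>x $ i\<bar> > R'" for x i
      using that component_le_norm_cart[of x i] by (intro g(3)) (simp add: R'_def)
    have L: "R' \<le> L m" "0 < L m" by (auto simp: L_def R'_def)
    have "1 < pi" using pi_gt3 by linarith
    from mult_strict_right_mono[OF this L(2)] have RL: "R' < pi * L m" using L(1) by linarith
    have R0: "0 < R'" and e0: "0 < 1 / real (Suc m)" by (auto simp: R'_def)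
    show ?thesis
      by (rule trig_poly_approximation[OF g(1) g(2) _ R0 RL e0]) (erule z, blast)
  qed
  obtain p where p: "\<And>m. trig_poly (\<lambda>x. of_real (p m x))" "\<And>m x. \<bar>p m x\<bar> \<le> B + 1 / Suc m"
     "\<And>m x. (\<And>i. \<bar>x $ i\<bar> < pi * L m) \<Longrightarrow> \<bar>p m x - g x\<bar> < 1 / Suc m"
    using ex by metis
  have inv0: "(\<lambda>m. 1 / real (Suc m)) \<longlonglongrightarrow> 0"
    using LIMSEQ_inverse_real_of_nat by (simp add: divide_inverse)
  have lim: "(\<lambda>m. p m x) \<longlonglongrightarrow> g x" for x
  proof -
    have "\<forall>\<^sub>F m in sequentially. norm (p m x - g x) \<le> 1 / real (Suc m)"
    proof -
      have "\<forall>\<^sub>F m in sequentially. real m > norm x"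
        using filterlim_real_sequentially unfolding filterlim_at_top_dense by blast
      then show ?thesis
      proof eventually_elim
        case (elim m)
        have "\<bar>x $ i\<bar> < pi * L m" for i
        proof -
          have "\<bar>x $ i\<bar> < L m" using component_le_norm_cart[of x i] elim by (simp add: L_def R'_def)
          moreover have "1 * L m \<le> pi * L m"
            using pi_gt3 by (intro mult_right_mono) (auto simp: L_def R'_def)
          ultimately show ?thesis by linarith
        qed
        then show ?case using p(3)[of x m] by simp
      qed
    qed
    then have "(\<lambda>m. p m x - g x) \<longlonglongrightarrow> 0"
      by (rule Lim_null_comparison) (rule inv0)
    then show ?thesis by (simp add: LIM_zero_iff)
  qed
  have pm[measurable]: "p m \<in> borel_measurable borel" for m
  proof -
    obtain S c where "finite S" "\<And>x. complex_of_real (p m x) = (\<Sum>u\<in>S. c u * cis (u \<bullet> x))"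
      using p(1)[of m] unfolding trig_poly_def by blast
    then have "p m = (\<lambda>x. Re (\<Sum>u\<in>S. c u * cis (u \<bullet> x)))"
      by (metis Re_complex_of_real)
    also have "\<dots> \<in> borel_measurable borel"
      unfolding cis_conv_exp by measurable
    finally show ?thesis .
  qed
  have gm[measurable]: "g \<in> borel_measurable borel" by (rule borel_measurable_continuous_onI[OF g(1)])
  have "(\<lambda>m. LINT \<omega>|M. p m (X k \<omega>)) \<longlonglongrightarrow> (LINT \<omega>|M. g (X k \<omega>))" if [measurable]: "k \<in> K" for k
  proof (rule integral_dominated_convergence[where w="\<lambda>_. B + 1"])
    note X[OF that, measurable]
    show "(\<lambda>\<omega>. g (X k \<omega>)) \<in> borel_measurable M" "(\<lambda>\<omega>. p m (X k \<omega>)) \<in> borel_measurable M" for m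
      by measurable
    show "AE \<omega> in M. norm (p m (X k \<omega>)) \<le> B + 1" for m
    proof (rule AE_I2)
      fix \<omega>
      have "1 / real (Suc m) \<le> 1" by simp
      then show "norm (p m (X k \<omega>)) \<le> B + 1" using p(2)[of m "X k \<omega>"] unfolding real_norm_def by linarith
    qed
  qed (use lim in auto)
  then have "(\<lambda>m. \<bar>\<Sum>k\<in>K. \<epsilon> k * (LINT \<omega>|M. p m (X k \<omega>))\<bar>) \<longlonglongrightarrow> \<bar>\<Sum>k\<in>K. \<epsilon> k * (LINT \<omega>|M. g (X k \<omega>))\<bar>"
    by (intro tendsto_intros)
  moreover have "(\<lambda>m. C * (B + 1 / real (Suc m))) \<longlonglongrightarrow> C * (B + 0)"
    by (intro tendsto_intros inv0)
  ultimately show ?thesis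
    using FS_bound_trig_poly_expectation[OF M X FS p(1) p(2)] by (auto intro: LIMSEQ_le)
qed

text \<open>Uniform approximation is impossible for Borel \<open>f\<close>, but the conclusion
  involves only finitely many laws. Their sum \<open>\<Lambda>\<close> dominates each of them, and
  approximation in \<open>L^1\<close> of \<open>\<Lambda>\<close> controls all the expectations
  simultaneously.\<close>

theorem FS_bound_bounded_borel_expectation:
  fixes X :: "'k \<Rightarrow> 'w \<Rightarrow> real^'n"
  assumes M: "finite_measure M" and K: "finite K"
    and X: "\<And>k. k \<in> K \<Longrightarrow> X k \<in> borel_measurable M"
    and FS: "FS_bound (\<lambda>u. \<Sum>k\<in>K. of_real (\<epsilon> k) * (CLINT \<omega>|M. cis (u \<bullet> X k \<omega>))) C"
    and f: "f \<in> borel_measurable borel" "\<And>x. \<bar>f x\<bar> \<le> B"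
  shows "\<bar>\<Sum>k\<in>K. \<epsilon> k * (LINT \<omega>|M. f (X k \<omega>))\<bar> \<le> C * B"
proof (rule field_le_epsilon)
  fix e :: real assume e: "e > 0"
  interpret finite_measure M by fact
  let ?Q = "count_space K \<Otimes>\<^sub>M M"
  interpret CK: finite_measure "count_space K" by (rule finite_measure_count_space[OF K])
  interpret P: pair_sigma_finite "count_space K" M ..
  have FQ: "finite_measure ?Q" by (rule finite_measure_pair_measure) unfold_locales
  define X' where "X' = (\<lambda>(k, \<omega>). X k \<omega>)"
  have X'[measurable]: "X' \<in> borel_measurable ?Q"
    unfolding X'_def by (rule measurable_pair_measure_countable1) (use X K in \<open>auto intro: countable_finite\<close>)
  define \<Lambda> where "\<Lambda> = distr ?Q borel X'"
  have FL: "finite_measure \<Lambda>" unfolding \<Lambda>_def by (rule finite_measure.finite_measure_distr[OF FQ X'])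
  interpret L: finite_measure \<Lambda> by fact
  \<comment> \<open>The summand 1 makes \<open>A\<close> positive, so that \<open>e / A\<close> is
    legitimate; the signed errors then add up to at most
    \<open>(A - 1) * (e / A) \<le> e\<close>.\<close>
  define A where "A = (\<Sum>k\<in>K. \<bar>\<epsilon> k\<bar>) + 1"
  have A: "A > 0" unfolding A_def by (intro add_nonneg_pos sum_nonneg) auto
  have B: "B \<ge> 0" using f(2)[of 0] by linarith
  have "integrable \<Lambda> f"
    by (rule L.integrable_const_bound[where B=B]) (use f in \<open>auto simp: \<Lambda>_def\<close>)
  then obtain g0 R where g0: "continuous_on UNIV g0" "\<And>x. norm x > R \<Longrightarrow> g0 x = 0" "integrable \<Lambda> g0" "(LINT x|\<Lambda>. \<bar>f x - g0 x\<bar>) < e / A"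
    using compactly_supported_dense[OF FL _ _ divide_pos_pos[OF e A], of f] by (auto simp: \<Lambda>_def)
  \<comment> \<open>Clipping to \<open>[- B, B]\<close> restores the bound of \<open>f\<close> and,
    since \<open>f\<close> has values in this interval, does not increase the distance to
    \<open>f\<close>.\<close>
  define g where "g x = max (- B) (min B (g0 x))" for x
  have g: "continuous_on UNIV g" "\<And>x. \<bar>g x\<bar> \<le> B" "\<And>x. norm x > R \<Longrightarrow> g x = 0"
    using g0(1,2) B by (auto simp: g_def intro!: continuous_intros)
  have gm[measurable]: "g \<in> borel_measurable borel" by (rule borel_measurable_continuous_onI[OF g(1)])
  note f(1)[measurable]
  have "(LINT x|\<Lambda>. \<bar>f x - g x\<bar>) \<le> (LINT x|\<Lambda>. \<bar>f x - g0 x\<bar>)"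
  proof (rule integral_mono)
    show "integrable \<Lambda> (\<lambda>x. \<bar>f x - g0 x\<bar>)" using \<open>integrable \<Lambda> f\<close> g0(3) by simp
    have "integrable \<Lambda> g"
      by (rule L.integrable_const_bound[where B=B]) (use g in \<open>auto simp: \<Lambda>_def\<close>)
    then show "integrable \<Lambda> (\<lambda>x. \<bar>f x - g x\<bar>)" using \<open>integrable \<Lambda> f\<close> by simp
    show "\<bar>f x - g x\<bar> \<le> \<bar>f x - g0 x\<bar>" for x
      using f(2)[of x] by (auto simp: g_def)
  qed
  with g0(4) have fg: "(LINT x|\<Lambda>. \<bar>f x - g x\<bar>) < e / A" by linarith
  have bnd: "integrable M (\<lambda>\<omega>. h (X k \<omega>))" if "k \<in> K" "h \<in> borel_measurable borel" "\<And>x. \<bar>h x\<bar> \<le> 2 * B" for h :: "real^'n \<Rightarrow> real" and k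
    by (rule integrable_const_bound[where B="2 * B"]) (use that X[OF that(1)] in \<open>auto intro: measurable_compose\<close>)
  have fB: "\<bar>f x\<bar> \<le> 2 * B" and gB: "\<bar>g x\<bar> \<le> 2 * B" for x
    using f(2)[of x] g(2)[of x] B by linarith+
  have fgB: "\<bar>\<bar>f x - g x\<bar>\<bar> \<le> 2 * B" for x using f(2)[of x] g(2)[of x] by auto
  have "(LINT x|\<Lambda>. \<bar>f x - g x\<bar>) = (LINT q|?Q. \<bar>f (X' q) - g (X' q)\<bar>)"
    unfolding \<Lambda>_def by (rule integral_distr) auto
  also have "\<dots> = (LINT k|count_space K. LINT \<omega>|M. \<bar>f (X k \<omega>) - g (X k \<omega>)\<bar>)"
  proof -
    have "integrable ?Q (\<lambda>q. \<bar>f (X' q) - g (X' q)\<bar>)"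
      by (rule finite_measure.integrable_const_bound[OF FQ, where B="2 * B"]) (use fgB in auto)
    from P.integral_fst'[OF this] show ?thesis by (simp add: X'_def)
  qed
  also have "\<dots> = (\<Sum>k\<in>K. LINT \<omega>|M. \<bar>f (X k \<omega>) - g (X k \<omega>)\<bar>)"
    by (rule lebesgue_integral_count_space_finite[OF K])
  finally have sum: "(\<Sum>k\<in>K. LINT \<omega>|M. \<bar>f (X k \<omega>) - g (X k \<omega>)\<bar>) < e / A" using fg by simp
  have diff: "\<bar>(LINT \<omega>|M. f (X k \<omega>)) - (LINT \<omega>|M. g (X k \<omega>))\<bar> \<le> e / A" if k: "k \<in> K" for k
  proof -
    have "(LINT \<omega>|M. f (X k \<omega>)) - (LINT \<omega>|M. g (X k \<omega>)) = (LINT \<omega>|M. f (X k \<omega>) - g (X k \<omega>))"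
      by (intro Bochner_Integration.integral_diff[symmetric] bnd[OF k] f(1) gm fB gB)
    also have "\<bar>\<dots>\<bar> \<le> (LINT \<omega>|M. \<bar>f (X k \<omega>) - g (X k \<omega>)\<bar>)"
      using integral_norm_bound[of M "\<lambda>\<omega>. f (X k \<omega>) - g (X k \<omega>)"] by simp
    also have "\<dots> \<le> (\<Sum>k\<in>K. LINT \<omega>|M. \<bar>f (X k \<omega>) - g (X k \<omega>)\<bar>)"
      by (rule member_le_sum[OF k _ K]) simp
    finally show ?thesis using sum by linarith
  qed
  have "\<bar>\<Sum>k\<in>K. \<epsilon> k * (LINT \<omega>|M. f (X k \<omega>))\<bar> \<le>
     \<bar>\<Sum>k\<in>K. \<epsilon> k * (LINT \<omega>|M. g (X k \<omega>))\<bar> + \<bar>\<Sum>k\<in>K. \<epsilon> k * ((LINT \<omega>|M. f (X k \<omega>)) - (LINT \<omega>|M. g (X k \<omega>)))\<bar>"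
    by (simp add: right_diff_distrib sum_subtractf)
  also have "\<dots> \<le> C * B + (\<Sum>k\<in>K. \<bar>\<epsilon> k\<bar> * (e / A))"
  proof (rule add_mono)
    show "\<bar>\<Sum>k\<in>K. \<epsilon> k * (LINT \<omega>|M. g (X k \<omega>))\<bar> \<le> C * B"
      by (rule FS_bound_compactly_supported_expectation[OF M X FS g])
    show "\<bar>\<Sum>k\<in>K. \<epsilon> k * ((LINT \<omega>|M. f (X k \<omega>)) - (LINT \<omega>|M. g (X k \<omega>)))\<bar> \<le> (\<Sum>k\<in>K. \<bar>\<epsilon> k\<bar> * (e / A))"
      by (rule order_trans[OF sum_abs], intro sum_mono, unfold abs_mult, intro mult_left_mono diff) auto
  qed
  also have "(\<Sum>k\<in>K. \<bar>\<epsilon> k\<bar> * (e / A)) = (A - 1) * (e / A)" by (simp only: sum_distrib_right[symmetric]) (simp add: A_def)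
  also have "\<dots> \<le> e" using A e by (simp add: field_simps)
  finally show "\<bar>\<Sum>k\<in>K. \<epsilon> k * (LINT \<omega>|M. f (X k \<omega>))\<bar> \<le> C * B + e" by simp
qed

section \<open>Differentiability from second differences\<close>

text \<open>Cauchy's functional equation: additivity yields homogeneity over the rationals, and the
  bound yields the continuity that extends it to the reals.\<close>

lemma additive_lipschitz_imp_linear:
  fixes f :: "'a::real_normed_vector \<Rightarrow> real"
  assumes add: "\<And>x y. f (x + y) = f x + f y" and bd: "\<And>x. \<bar>f x\<bar> \<le> L * norm x"
  shows "bounded_linear f"
proof -
  have 0: "f 0 = 0" using add[of 0 0] by simp
  have minus: "f (- x) = - f x" for x using add[of x "- x"] 0 by simp
  have diff: "f (x - y) = f x - f y" for x y using add[of x "- y"] minus by simp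
  have nat: "f (of_nat n *\<^sub>R x) = of_nat n * f x" for n x
    by (induction n) (auto simp: 0 scaleR_add_left add algebra_simps)
  have int: "f (of_int n *\<^sub>R x) = of_int n * f x" for n x
    by (cases n rule: int_cases2) (auto simp: nat minus)
  have scale: "f (r *\<^sub>R x) = r * f x" for r x
  proof (rule LIMSEQ_unique)
    define q where "q n = of_int \<lfloor>r * real (Suc n)\<rfloor> / real (Suc n)" for n
    have q: "f (q n *\<^sub>R x) = q n * f x" for n
    proof -
      have "real (Suc n) * f (q n *\<^sub>R x) = f (of_nat (Suc n) *\<^sub>R (q n *\<^sub>R x))" by (simp only: nat)
      also have "of_nat (Suc n) *\<^sub>R (q n *\<^sub>R x) = of_int \<lfloor>r * real (Suc n)\<rfloor> *\<^sub>R x"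
        by (simp add: q_def del: of_nat_Suc)
      also have "f \<dots> = of_int \<lfloor>r * real (Suc n)\<rfloor> * f x" by (rule int)
      finally show ?thesis by (simp add: q_def field_simps del: of_nat_Suc)
    qed
    have dq: "\<bar>q n - r\<bar> \<le> 1 / real (Suc n)" for n
    proof -
      have "\<bar>of_int \<lfloor>r * real (Suc n)\<rfloor> - r * real (Suc n)\<bar> \<le> 1" by linarith
      then have "\<bar>of_int \<lfloor>r * real (Suc n)\<rfloor> - r * real (Suc n)\<bar> / real (Suc n) \<le> 1 / real (Suc n)"
        by (rule divide_right_mono) simp
      also have "\<bar>of_int \<lfloor>r * real (Suc n)\<rfloor> - r * real (Suc n)\<bar> / real (Suc n) = \<bar>q n - r\<bar>"
        unfolding q_def by (subst abs_divide[of _ "real (Suc n)", simplified abs_of_nat, symmetric]) (simp add: diff_divide_distrib del: of_nat_Suc)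
      finally show ?thesis .
    qed
    have inv0: "(\<lambda>m. 1 / real (Suc m)) \<longlonglongrightarrow> 0"
      using LIMSEQ_inverse_real_of_nat by (simp add: divide_inverse)
    have "(\<lambda>n. q n - r) \<longlonglongrightarrow> 0"
      by (rule Lim_null_comparison[OF _ inv0]) (use dq in auto)
    then have qr: "q \<longlonglongrightarrow> r" by (simp add: LIM_zero_iff)
    then show "(\<lambda>n. q n * f x) \<longlonglongrightarrow> r * f x" by (intro tendsto_intros)
    have "(\<lambda>n. f (q n *\<^sub>R x) - f (r *\<^sub>R x)) \<longlonglongrightarrow> 0"
    proof (rule Lim_null_comparison)
      show "\<forall>\<^sub>F n in sequentially. norm (f (q n *\<^sub>R x) - f (r *\<^sub>R x)) \<le> L * (\<bar>q n - r\<bar> * norm x)"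
      proof (rule always_eventually, rule allI)
        fix n
        have "f (q n *\<^sub>R x) - f (r *\<^sub>R x) = f ((q n - r) *\<^sub>R x)"
          by (simp add: scaleR_diff_left diff)
        then show "norm (f (q n *\<^sub>R x) - f (r *\<^sub>R x)) \<le> L * (\<bar>q n - r\<bar> * norm x)"
          using bd[of "(q n - r) *\<^sub>R x"] by simp
      qed
      have "(\<lambda>n. L * (\<bar>q n - r\<bar> * norm x)) \<longlonglongrightarrow> L * (\<bar>r - r\<bar> * norm x)"
        by (intro tendsto_intros qr)
      then show "(\<lambda>n. L * (\<bar>q n - r\<bar> * norm x)) \<longlonglongrightarrow> 0" by simp
    qed
    then show "(\<lambda>n. q n * f x) \<longlonglongrightarrow> f (r *\<^sub>R x)" by (simp add: LIM_zero_iff q)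
  qed
  show ?thesis
    by (rule bounded_linear_intro[of f L]) (auto simp: add scale intro: order_trans[OF bd] simp: mult.commute)
qed

text \<open>The dyadic difference quotients converge by the bound on second differences, uniformly enough
  to make the limit a derivative.\<close>

lemma second_difference_imp_derivative:
  fixes g :: "'a::real_normed_vector \<Rightarrow> real"
  assumes 1: "\<And>x a. \<bar>g (x + a) - g x\<bar> \<le> L * norm a"
    and 2: "\<And>x a b. \<bar>g (x + a + b) - g (x + a) - g (x + b) + g x\<bar> \<le> K * norm a * norm b"
  obtains D where "(g has_derivative D) (at x)" "\<And>a. \<bar>D a\<bar> \<le> L * norm a"
proof -
  define d where "d k v = 2 ^ k * (g (x + (1 / 2 ^ k) *\<^sub>R v) - g x)" for k :: nat and v
  have step: "\<bar>d k v - d (Suc k) v\<bar> \<le> K * (norm v)\<^sup>2 / 4 * (1 / 2) ^ k" for k v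
  proof -
    define w where "w = (1 / 2 ^ Suc k) *\<^sub>R v"
    have w2: "(1 / 2 ^ k) *\<^sub>R v = w + w" by (simp add: w_def scaleR_add_left[symmetric])
    \<comment> \<open>Comparing one step \<open>w + w\<close> with twice the step \<open>w\<close>
      leaves the second difference with both increments \<open>w\<close>. As \<open>norm w\<close>
      is \<open>norm v / 2 ^ Suc k\<close>, the factor \<open>2 ^ k\<close> still leaves a geometric
      decay.\<close>
    have "d k v - d (Suc k) v = 2 ^ k * (g (x + w + w) - g (x + w) - g (x + w) + g x)"
      unfolding d_def w2 w_def[symmetric] by (simp add: algebra_simps)
    then have "\<bar>d k v - d (Suc k) v\<bar> = 2 ^ k * \<bar>g (x + w + w) - g (x + w) - g (x + w) + g x\<bar>"
      by (simp add: abs_mult)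
    also have "\<dots> \<le> 2 ^ k * (K * norm w * norm w)"
      by (intro mult_left_mono 2) simp
    also have "\<dots> = K * (norm v)\<^sup>2 / 4 * (1 / 2) ^ k"
      by (simp add: w_def power2_eq_square power_one_over divide_simps)
    finally show ?thesis .
  qed
  define D where "D v = lim (\<lambda>k. d k v)" for v
  have sm: "summable (\<lambda>k. d (Suc k) v - d k v)" for v
  proof (rule summable_comparison_test)
    show "summable (\<lambda>k. K * (norm v)\<^sup>2 / 4 * (1 / 2) ^ k)"
      by (intro summable_mult summable_geometric) simp
    show "\<exists>N. \<forall>k\<ge>N. norm (d (Suc k) v - d k v) \<le> K * (norm v)\<^sup>2 / 4 * (1 / 2) ^ k"
      using step[of _ v] by (auto simp: abs_minus_commute)
  qed
  have tel: "(\<Sum>i<k. d (Suc i) v - d i v) = d k v - d 0 v" for k v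
    by (rule sum_lessThan_telescope)
  have conv: "(\<lambda>k. d k v) \<longlonglongrightarrow> D v" for v
  proof -
    have "(\<lambda>k. d k v - d 0 v) \<longlonglongrightarrow> (\<Sum>k. d (Suc k) v - d k v)"
      using summable_LIMSEQ[OF sm[of v]] unfolding tel .
    then have "(\<lambda>k. d k v - d 0 v + d 0 v) \<longlonglongrightarrow> (\<Sum>k. d (Suc k) v - d k v) + d 0 v"
      by (intro tendsto_intros)
    then have "convergent (\<lambda>k. d k v)" by (auto simp: convergent_def)
    then show ?thesis unfolding D_def by (simp add: convergent_LIMSEQ_iff)
  qed
  \<comment> \<open>\<open>d 0 v\<close> is \<open>g (x + v) - g x\<close>, so this is the Taylor
    remainder. It is quadratic in \<open>norm v\<close>, hence uniform over directions, and gives a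
    Frechet derivative rather than directional ones.\<close>
  have err: "\<bar>d 0 v - D v\<bar> \<le> K * (norm v)\<^sup>2" for v
  proof -
    have K0: "0 \<le> K * (norm v)\<^sup>2" using 2[of x v v] by (simp add: power2_eq_square mult.assoc)
    have "\<bar>d k v - d 0 v\<bar> \<le> K * (norm v)\<^sup>2" for k
    proof -
      have "\<bar>d k v - d 0 v\<bar> \<le> (\<Sum>i<k. K * (norm v)\<^sup>2 / 4 * (1 / 2) ^ i)"
        unfolding tel[symmetric] using step[of _ v]
        by (intro order_trans[OF sum_abs] sum_mono) (simp add: abs_minus_commute)
      also have "\<dots> = K * (norm v)\<^sup>2 / 4 * (\<Sum>i<k. (1 / 2) ^ i)" by (simp add: sum_distrib_left)
      also have "\<dots> \<le> K * (norm v)\<^sup>2 / 4 * 2"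
      proof (rule mult_left_mono)
        show "(\<Sum>i<k. (1 / 2 :: real) ^ i) \<le> 2"
          by (subst geometric_sum) (auto simp: field_simps)
      qed (use K0 in simp)
      finally show ?thesis using K0 by simp
    qed
    moreover have "(\<lambda>k. \<bar>d k v - d 0 v\<bar>) \<longlonglongrightarrow> \<bar>D v - d 0 v\<bar>"
      by (intro tendsto_intros conv)
    ultimately have "\<bar>D v - d 0 v\<bar> \<le> K * (norm v)\<^sup>2"
      by (intro LIMSEQ_le_const2) auto
    then show ?thesis by (simp add: abs_minus_commute)
  qed
  have DL: "\<bar>D v\<bar> \<le> L * norm v" for v
  proof (rule LIMSEQ_le_const2)
    show "(\<lambda>k. \<bar>d k v\<bar>) \<longlonglongrightarrow> \<bar>D v\<bar>" by (intro tendsto_intros conv)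
    have "\<bar>d k v\<bar> \<le> L * norm v" for k
    proof -
      have "\<bar>d k v\<bar> = 2 ^ k * \<bar>g (x + (1 / 2 ^ k) *\<^sub>R v) - g x\<bar>" by (simp add: d_def abs_mult)
      also have "\<dots> \<le> 2 ^ k * (L * norm ((1 / 2 ^ k) *\<^sub>R v))" by (intro mult_left_mono 1) simp
      also have "\<dots> = L * norm v" by simp
      finally show ?thesis .
    qed
    then show "\<exists>N. \<forall>k\<ge>N. \<bar>d k v\<bar> \<le> L * norm v" by auto
  qed
  have Dadd: "D (v + w) = D v + D w" for v w
  proof -
    \<comment> \<open>The defect of additivity is \<open>2 ^ k\<close> times a mixed second
      difference of order \<open>(1 / 4) ^ k\<close>.\<close>
    have "(\<lambda>k. d k (v + w) - d k v - d k w) \<longlonglongrightarrow> 0"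
    proof (rule Lim_null_comparison)
      have "norm (d k (v + w) - d k v - d k w) \<le> K * norm v * norm w * (1 / 2) ^ k" for k
      proof -
        let ?v = "(1 / 2 ^ k) *\<^sub>R v" and ?w = "(1 / 2 ^ k) *\<^sub>R w"
        have "d k (v + w) - d k v - d k w = 2 ^ k * (g (x + ?v + ?w) - g (x + ?v) - g (x + ?w) + g x)"
          unfolding d_def by (simp add: algebra_simps)
        then have "norm (d k (v + w) - d k v - d k w) = 2 ^ k * \<bar>g (x + ?v + ?w) - g (x + ?v) - g (x + ?w) + g x\<bar>"
          by (simp add: abs_mult)
        also have "\<dots> \<le> 2 ^ k * (K * norm ?v * norm ?w)" by (intro mult_left_mono 2) simp
        also have "\<dots> = K * norm v * norm w * (1 / 2) ^ k" by (simp add: power_one_over divide_simps)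
        finally show ?thesis .
      qed
      then show "\<forall>\<^sub>F k in sequentially. norm (d k (v + w) - d k v - d k w) \<le> K * norm v * norm w * (1 / 2) ^ k"
        by simp
      have "(\<lambda>k. (1 / 2 :: real) ^ k) \<longlonglongrightarrow> 0" by (intro LIMSEQ_realpow_zero) auto
      from tendsto_mult[OF tendsto_const[of "K * norm v * norm w"] this]
      show "(\<lambda>k. K * norm v * norm w * (1 / 2) ^ k) \<longlonglongrightarrow> 0" by simp
    qed
    moreover have "(\<lambda>k. d k (v + w) - d k v - d k w) \<longlonglongrightarrow> D (v + w) - D v - D w"
      by (intro tendsto_intros conv)
    ultimately have "D (v + w) - D v - D w = 0" using LIMSEQ_unique by blast
    then show ?thesis by simp
  qed
  have bl: "bounded_linear D" by (rule additive_lipschitz_imp_linear[OF Dadd DL])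
  have "(g has_derivative D) (at x)"
    unfolding has_derivative_at
  proof (intro conjI bl)
    show "(\<lambda>h. norm (g (x + h) - g x - D h) / norm h) \<midarrow>0\<rightarrow> 0"
    proof (rule Lim_null_comparison)
      show "\<forall>\<^sub>F h in at 0. norm (norm (g (x + h) - g x - D h) / norm h) \<le> K * norm h"
      proof (rule always_eventually, rule allI)
        fix h
        have "\<bar>g (x + h) - g x - D h\<bar> \<le> K * (norm h)\<^sup>2" using err[of h] by (simp add: d_def)
        then show "norm (norm (g (x + h) - g x - D h) / norm h) \<le> K * norm h"
          by (cases "h = 0") (auto simp: divide_le_eq power2_eq_square mult.assoc)
      qed
      show "((\<lambda>h. K * norm h) \<longlongrightarrow> 0) (at (0::'a))"
        by (intro tendsto_mult_right_zero tendsto_norm_zero tendsto_ident_at)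
    qed
  qed
  then show ?thesis using DL that by blast
qed

lemma gradient_bound_of_has_derivative:
  fixes g :: "'a::euclidean_space \<Rightarrow> real"
  assumes D: "(g has_derivative D) (at x)" and bd: "\<And>a. \<bar>D a\<bar> \<le> L * norm a"
  shows "norm (gradient g x) \<le> L"
proof -
  interpret D: bounded_linear D by (rule has_derivative_bounded_linear[OF D])
  define v where "v = (\<Sum>b\<in>Basis. D b *\<^sub>R b)"
  have Dv: "D = (\<lambda>h. h \<bullet> v)"
  proof
    fix h
    have "D h = D (\<Sum>b\<in>Basis. (h \<bullet> b) *\<^sub>R b)" by (simp add: euclidean_representation)
    also have "\<dots> = h \<bullet> v" by (simp add: D.sum D.scaleR v_def inner_sum_right mult.commute)
    finally show "D h = h \<bullet> v" .
  qed
  have "GDERIV g x :> v" using D unfolding gderiv_def Dv by simp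
  moreover have "w = v" if "GDERIV g x :> w" for w
  proof -
    have "(\<lambda>h. h \<bullet> w) = (\<lambda>h. h \<bullet> v)"
      using has_derivative_unique that D unfolding gderiv_def Dv by blast
    then show ?thesis by (metis vector_eq_ldot)
  qed
  ultimately have "gradient g x = v" unfolding gradient_def by (rule the_equality)
  moreover have "norm v * norm v \<le> L * norm v"
    using bd[of v] unfolding Dv by (simp add: dot_square_norm power2_eq_square)
  then have "norm v \<le> L" 
  proof (cases "v = 0")
    case True
    \<comment> \<open>When \<open>v = 0\<close> the inequality cannot be divided by
      \<open>norm v\<close>; testing the bound on a unit vector gives
      \<open>0 \<le> L\<close>.\<close>
    obtain b :: 'a where b: "b \<in> Basis" using nonempty_Basis by blast
    then show ?thesis using True bd[of b] by (simp add: Dv)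
  qed simp
  ultimately show ?thesis by simp
qed

section \<open>Wiener integrals of deterministic integrands\<close>

lemma norm_cis_diff_le: "norm (cis a - cis b) \<le> \<bar>a - b\<bar>"
proof -
  have "cis a - cis b = cis b * (cis (a - b) - 1)"
    by (simp add: right_diff_distrib cis_mult)
  then have "norm (cis a - cis b) = norm (cis (a - b) - 1)"
    by (simp add: norm_mult)
  also have "\<dots> \<le> \<bar>a - b\<bar>" using iexp_approx1[of "a - b" 0] by (simp add: cis_conv_exp del: of_real_diff)
  finally show ?thesis .
qed

text \<open>Averaging \<open>1 - cos (u * y)\<close> over \<open>u \<in> {0..1}\<close> gives
  \<open>1 - sin y / y\<close>, which is nonnegative and at least 1/2 once
  \<open>\<bar>y\<bar> \<ge> 2\<close>. With \<open>y = R * X \<omega>\<close> and Fubini this is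
  the classical tail estimate by the characteristic function near 0.\<close>

lemma (in prob_space) tail_le_cos:
  fixes X :: "'a \<Rightarrow> real"
  assumes X[measurable]: "X \<in> borel_measurable M" and R: "R > 0"
    and c: "\<And>u. 0 \<le> u \<Longrightarrow> u \<le> R \<Longrightarrow> 1 - (LINT \<omega>|M. cos (u * X \<omega>)) \<le> \<delta>"
  shows "prob {\<omega> \<in> space M. \<bar>X \<omega>\<bar> \<ge> 2 / R} \<le> 2 * \<delta>"
proof -
  define U where "U = restrict_space lborel {0..1::real}"
  have U: "finite_measure U"
    by (rule finite_measureI) (simp add: U_def space_restrict_space emeasure_restrict_space)
  interpret U: finite_measure U by fact
  interpret P: pair_sigma_finite M U ..
  have [measurable]: "(\<lambda>u. u) \<in> borel_measurable U"
    unfolding U_def by (intro measurable_restrict_space1) simp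
  have FQ: "finite_measure (M \<Otimes>\<^sub>M U)" by (rule finite_measure_pair_measure) unfold_locales
  have int: "integrable (M \<Otimes>\<^sub>M U) (\<lambda>(\<omega>, u). 1 - cos (u * R * X \<omega>))"
  proof (rule finite_measure.integrable_const_bound[OF FQ, where B=2])
    show "AE x in M \<Otimes>\<^sub>M U. norm (case x of (\<omega>, u) \<Rightarrow> 1 - cos (u * R * X \<omega>)) \<le> 2"
    proof (rule AE_I2)
      fix x :: "'a \<times> real"
      show "norm (case x of (\<omega>, u) \<Rightarrow> 1 - cos (u * R * X \<omega>)) \<le> 2"
        using cos_ge_minus_one[of "snd x * R * X (fst x)"] by (simp add: split_beta')
    qed
  qed measurable
  have spU: "space U = {0..1}" by (simp add: U_def space_restrict_space)
  have inner: "(LINT u|U. 1 - cos (u * y)) \<ge> 1 / 2" if "\<bar>y\<bar> \<ge> 2" for y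
  proof -
    have "(LINT u|lborel. indicator {0..1} u *\<^sub>R cos (u * y)) = sin (1 * y) / y - sin (0 * y) / y"
      by (rule integral_FTC_Icc)
         (use that in \<open>auto simp flip: has_real_derivative_iff_has_vector_derivative intro!: derivative_eq_intros continuous_intros\<close>)
    then have "(LINT u|U. cos (u * y)) = sin y / y"
      unfolding U_def by (subst integral_restrict_space) auto
    moreover have "sin y / y \<le> 1 / 2"
    proof -
      have "\<bar>sin y / y\<bar> \<le> 1 / 2"
      proof -
        have "\<bar>sin y\<bar> * 2 \<le> \<bar>y\<bar>" using abs_sin_le_one[of y] that by linarith
        then show ?thesis using that by (simp add: abs_divide divide_le_eq)
      qed
      then show ?thesis by linarith
    qed
    moreover have "integrable U (\<lambda>u. cos (u * y))"
      by (rule U.integrable_const_bound[where B=1]) auto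
    moreover have "measure U (space U) = 1"
      by (simp add: spU) (simp add: U_def measure_restrict_space)
    ultimately show ?thesis by (subst Bochner_Integration.integral_diff) auto
  qed
  have inner0: "(LINT u|U. 1 - cos (u * y)) \<ge> 0" for y by (rule Bochner_Integration.integral_nonneg) simp
  have "prob {\<omega> \<in> space M. \<bar>X \<omega>\<bar> \<ge> 2 / R} = (LINT \<omega>|M. indicator {\<omega> \<in> space M. \<bar>X \<omega>\<bar> \<ge> 2 / R} \<omega>)"
    by simp
  also have "\<dots> \<le> (LINT \<omega>|M. 2 * (LINT u|U. 1 - cos (u * R * X \<omega>)))"
  proof (rule integral_mono)
    show "integrable M (indicator {\<omega> \<in> space M. \<bar>X \<omega>\<bar> \<ge> 2 / R} :: 'a \<Rightarrow> real)"
      by (intro integrable_real_indicator) (auto simp: less_top[symmetric])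
    show "integrable M (\<lambda>\<omega>. 2 * (LINT u|U. 1 - cos (u * R * X \<omega>)))"
      using P.integrable_fst'[OF int] by simp
    fix \<omega> assume "\<omega> \<in> space M"
    show "indicator {\<omega> \<in> space M. \<bar>X \<omega>\<bar> \<ge> 2 / R} \<omega> \<le> 2 * (LINT u|U. 1 - cos (u * R * X \<omega>))"
    proof -
      have "2 \<le> \<bar>R * X \<omega>\<bar>" if "2 / R \<le> \<bar>X \<omega>\<bar>"
        using that R by (simp add: abs_mult divide_le_eq mult.commute)
      then show ?thesis
        using inner[of "R * X \<omega>"] inner0[of "R * X \<omega>"] by (auto simp: indicator_def mult.assoc)
    qed
  qed
  also have "\<dots> = 2 * (LINT \<omega>|M. LINT u|U. 1 - cos (u * R * X \<omega>))" by simp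
  also have "(LINT \<omega>|M. LINT u|U. 1 - cos (u * R * X \<omega>)) = (LINT u|U. LINT \<omega>|M. 1 - cos (u * R * X \<omega>))"
    by (rule P.Fubini_integral[symmetric, OF int])
  also have "\<dots> \<le> (LINT u|U. \<delta>)"
  proof (rule integral_mono)
    show "integrable U (\<lambda>u. LINT \<omega>|M. 1 - cos (u * R * X \<omega>))"
      using P.integrable_snd[OF int] .
    fix u assume "u \<in> space U"
    then have u: "0 \<le> u * R" "u * R \<le> R" using R by (auto simp: spU mult_le_cancel_right1)
    have "integrable M (\<lambda>\<omega>. cos (u * R * X \<omega>))"
      by (rule integrable_const_bound[where B=1]) auto
    then show "(LINT \<omega>|M. 1 - cos (u * R * X \<omega>)) \<le> \<delta>"
      using c[OF u] by (subst Bochner_Integration.integral_diff) (auto simp: prob_space)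
  qed auto
  also have "\<dots> = \<delta>" by (simp add: spU) (simp add: U_def measure_restrict_space)
  finally show ?thesis by simp
qed

lemma (in prob_space) tail_le_cos_vec:
  fixes X :: "'a \<Rightarrow> real^'n" and \<delta> :: real
  assumes X[measurable]: "X \<in> borel_measurable M" and e: "e > 0"
    and c: "\<And>u. norm u \<le> 2 * CARD('n) / e \<Longrightarrow> 1 - (LINT \<omega>|M. cos (u \<bullet> X \<omega>)) \<le> \<delta>"
  shows "prob {\<omega> \<in> space M. norm (X \<omega>) > e} \<le> 2 * CARD('n) * \<delta>"
proof -
  let ?n = "real CARD('n)"
  \<comment> \<open>Makes \<open>2 / R = e / ?n\<close>: if every coordinate stays below this value,
    the l1 norm and hence the norm is at most \<open>e\<close>.\<close>
  define R where "R = 2 * ?n / e"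
  have R: "R > 0" using e by (simp add: R_def)
  have Xi[measurable]: "(\<lambda>\<omega>. X \<omega> $ i) \<in> borel_measurable M" for i
    using measurable_compose[OF X, of "\<lambda>x. x $ i" borel] by (auto intro!: borel_measurable_continuous_onI continuous_intros)
  let ?A = "\<lambda>i. {\<omega> \<in> space M. \<bar>X \<omega> $ i\<bar> \<ge> 2 / R}"
  have "{\<omega> \<in> space M. norm (X \<omega>) > e} \<subseteq> (\<Union>i. ?A i)"
  proof (rule subsetI, rule ccontr)
    fix \<omega> assume "\<omega> \<in> {\<omega> \<in> space M. norm (X \<omega>) > e}" "\<omega> \<notin> (\<Union>i. ?A i)"
    then have \<omega>: "norm (X \<omega>) > e" "\<And>i. \<bar>X \<omega> $ i\<bar> < 2 / R" by (auto simp: not_le)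
    have "norm (X \<omega>) \<le> (\<Sum>i\<in>UNIV. \<bar>X \<omega> $ i\<bar>)" by (rule norm_le_l1_cart)
    also have "\<dots> \<le> (\<Sum>i\<in>(UNIV::'n set). 2 / R)" using \<omega>(2) by (intro sum_mono less_imp_le)
    also have "\<dots> = e" using e by (simp add: R_def)
    finally show False using \<omega>(1) by simp
  qed
  then have "prob {\<omega> \<in> space M. norm (X \<omega>) > e} \<le> prob (\<Union>i. ?A i)"
    by (intro finite_measure_mono) auto
  also have "\<dots> \<le> (\<Sum>i\<in>UNIV. prob (?A i))"
    by (intro finite_measure_subadditive_finite) auto
  also have "\<dots> \<le> (\<Sum>i\<in>(UNIV::'n set). 2 * \<delta>)"
  proof (rule sum_mono)
    fix i
    show "prob (?A i) \<le> 2 * \<delta>"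
    proof (rule tail_le_cos[OF Xi R])
      fix u :: real assume u: "0 \<le> u" "u \<le> R"
      have "axis i u \<bullet> X \<omega> = u * X \<omega> $ i" for \<omega> by (simp add: inner_axis')
      moreover have "norm (axis i u) \<le> 2 * CARD('n) / e"
        using u by (simp add: R_def norm_eq_sqrt_inner inner_axis_axis)
      ultimately show "1 - (LINT \<omega>|M. cos (u * X \<omega> $ i)) \<le> \<delta>"
        using c[of "axis i u"] by simp
    qed
  qed
  finally show ?thesis by (simp add: mult_ac)
qed

section \<open>Riemann sums over partitions and their refinements\<close>

definition step_sum :: "nat \<Rightarrow> (nat \<Rightarrow> real) \<Rightarrow> (nat \<Rightarrow> real^'n^'n) \<Rightarrow> (real \<Rightarrow> real^'n) \<Rightarrow> real^'n" where
  "step_sum N s G z = (\<Sum>i<N. G i *v (z (s (Suc i)) - z (s i)))"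

text \<open>Here \<open>k i\<close> is the position of \<open>s i\<close> in the finer grid
  \<open>r\<close>, and \<open>\<sigma> j\<close> is the left endpoint of the coarse cell that
  contains the fine cell \<open>j\<close>. With the integrand frozen at these points the increments
  inside a coarse cell telescope. Equal consecutive \<open>k i\<close> are allowed, since partition
  points may repeat.\<close>

lemma step_sum_refine:
  fixes F :: "real \<Rightarrow> real^'n^'n"
  assumes "k 0 = 0" "\<And>i. i < N \<Longrightarrow> k i \<le> k (Suc i)" "\<And>i. i \<le> N \<Longrightarrow> s i = r (k i)"
    and "\<And>i j. i \<le> j \<Longrightarrow> j \<le> k N \<Longrightarrow> r i \<le> (r j :: real)"
  shows "\<exists>\<sigma>. (\<forall>j<k N. \<exists>i<N. \<sigma> j = s i \<and> s i \<le> r j \<and> r (Suc j) \<le> s (Suc i)) \<and>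
    (\<forall>z. step_sum N s (\<lambda>i. F (s i)) z = step_sum (k N) r (\<lambda>j. F (\<sigma> j)) z)"
  using assms
proof (induction N)
  case 0
  then show ?case by (simp add: step_sum_def)
next
  case (Suc N)
  have kN: "k N \<le> k (Suc N)" using Suc.prems(2)[of N] by simp
  have rm: "r i \<le> r j" if "i \<le> j" "j \<le> k N" for i j
    using Suc.prems(4)[of i j] that kN by simp
  have "\<exists>\<sigma>. (\<forall>j<k N. \<exists>i<N. \<sigma> j = s i \<and> s i \<le> r j \<and> r (Suc j) \<le> s (Suc i)) \<and>
    (\<forall>z. step_sum N s (\<lambda>i. F (s i)) z = step_sum (k N) r (\<lambda>j. F (\<sigma> j)) z)"
    using Suc.prems rm by (intro Suc.IH) auto
  then obtain \<sigma> where \<sigma>: "\<And>j. j < k N \<Longrightarrow> \<exists>i<N. \<sigma> j = s i \<and> s i \<le> r j \<and> r (Suc j) \<le> s (Suc i)"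
    "\<And>z. step_sum N s (\<lambda>i. F (s i)) z = step_sum (k N) r (\<lambda>j. F (\<sigma> j)) z" by blast
  define \<sigma>' where "\<sigma>' j = (if j < k N then \<sigma> j else s N)" for j
  have "\<exists>i<Suc N. \<sigma>' j = s i \<and> s i \<le> r j \<and> r (Suc j) \<le> s (Suc i)" if j: "j < k (Suc N)" for j
  proof (cases "j < k N")
    case True
    then show ?thesis using \<sigma>(1)[OF True] by (auto simp: \<sigma>'_def less_Suc_eq)
  next
    case False
    then show ?thesis using j Suc.prems(3)[of N] Suc.prems(3)[of "Suc N"] Suc.prems(4)
      by (intro exI[of _ N]) (auto simp: \<sigma>'_def)
  qed
  moreover have "step_sum (Suc N) s (\<lambda>i. F (s i)) z = step_sum (k (Suc N)) r (\<lambda>j. F (\<sigma>' j)) z" for z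
  proof -
    have "step_sum (k (Suc N)) r (\<lambda>j. F (\<sigma>' j)) z =
       (\<Sum>j\<in>{..<k N} \<union> {k N..<k (Suc N)}. F (\<sigma>' j) *v (z (r (Suc j)) - z (r j)))"
      unfolding step_sum_def using kN by (intro sum.cong) auto
    also have "\<dots> = (\<Sum>j<k N. F (\<sigma>' j) *v (z (r (Suc j)) - z (r j))) +
        (\<Sum>j\<in>{k N..<k (Suc N)}. F (\<sigma>' j) *v (z (r (Suc j)) - z (r j)))"
      by (rule sum.union_disjoint) auto
    also have "(\<Sum>j<k N. F (\<sigma>' j) *v (z (r (Suc j)) - z (r j))) = step_sum (k N) r (\<lambda>j. F (\<sigma> j)) z"
      unfolding step_sum_def by (intro sum.cong) (auto simp: \<sigma>'_def)
    also have "(\<Sum>j\<in>{k N..<k (Suc N)}. F (\<sigma>' j) *v (z (r (Suc j)) - z (r j))) =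
        (\<Sum>j\<in>{k N..<k (Suc N)}. F (s N) *v (z (r (Suc j)) - z (r j)))"
      by (intro sum.cong) (auto simp: \<sigma>'_def)
    also have "\<dots> = F (s N) *v (\<Sum>j\<in>{k N..<k (Suc N)}. z (r (Suc j)) - z (r j))"
      by (simp add: linear_sum[OF matrix_vector_mul_linear])
    also have "(\<Sum>j\<in>{k N..<k (Suc N)}. z (r (Suc j)) - z (r j)) = z (r (k (Suc N))) - z (r (k N))"
      by (rule sum_Suc_diff'[OF kN])
    also have "\<dots> = z (s (Suc N)) - z (s N)" using Suc.prems(3) by simp
    finally show ?thesis unfolding \<sigma>(2)[symmetric] by (simp add: step_sum_def)
  qed
  ultimately show ?case by blast
qed

definition partition_of :: "real \<Rightarrow> real \<Rightarrow> nat \<Rightarrow> (nat \<Rightarrow> real) \<Rightarrow> bool" where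
  "partition_of t d N s \<longleftrightarrow> s 0 = 0 \<and> s N = t \<and> (\<forall>i<N. s i \<le> s (Suc i) \<and> s (Suc i) - s i < d)"

lemma partition_of_mono:
  assumes "partition_of t d N s" "i \<le> j" "j \<le> N" shows "s i \<le> s j"
  using assms(2,3)
proof (induction rule: dec_induct)
  case (step m)
  then show ?case using assms(1) unfolding partition_of_def by (meson Suc_le_eq Suc_leD order_trans)
qed simp

text \<open>On one grid, the difference of two Riemann sums is again a step sum over independent
  increments, with integrand \<open>F (\<sigma> j) - F (\<sigma>' j)\<close> evaluated at nearby
  points. The grid is the sorted union of both point sets without repetitions.\<close>

lemma common_refinement:
  fixes F :: "real \<Rightarrow> real^'n^'n"
  assumes s: "partition_of t d N s" and s': "partition_of t d' N' s'"
  obtains m r \<sigma> \<sigma>' where "r 0 = 0" "r m = t" "\<And>j. j < m \<Longrightarrow> r j \<le> r (Suc j)"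
    "\<And>j. j < m \<Longrightarrow> \<sigma> j \<le> r j \<and> r (Suc j) < \<sigma> j + d \<and> \<sigma>' j \<le> r j \<and> r (Suc j) < \<sigma>' j + d'"
    "\<And>j. j < m \<Longrightarrow> \<sigma> j \<in> {0..t} \<and> \<sigma>' j \<in> {0..t}"
    "\<And>z. step_sum N s (\<lambda>i. F (s i)) z = step_sum m r (\<lambda>j. F (\<sigma> j)) z"
    "\<And>z. step_sum N' s' (\<lambda>i. F (s' i)) z = step_sum m r (\<lambda>j. F (\<sigma>' j)) z"
proof -
  define P where "P = s ` {..N} \<union> s' ` {..N'}"
  define l where "l = sorted_list_of_set P"
  define m where "m = card P - 1"
  define r where "r j = l ! j" for j
  have P: "finite P" "P \<noteq> {}" by (auto simp: P_def)
  have len: "length l = Suc m" using P by (simp add: l_def m_def card_gt_0_iff)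
  have setl: "set l = P" using P by (simp add: l_def)
  have strict: "r i < r j" if "i < j" "j \<le> m" for i j
    using strict_sorted_list_of_set[of P] that len unfolding r_def l_def[symmetric]
    by (simp add: sorted_wrt_iff_nth_less)
  have mono: "r i \<le> r j" if "i \<le> j" "j \<le> m" for i j
    using strict[of i j] that by (cases "i = j") auto
  have rP: "r j \<in> P" if "j \<le> m" for j using that len setl by (auto simp: r_def)
  have pt: "q i \<in> {0..t}" if q: "partition_of t e K q" and "i \<le> K" for q e K i
    using partition_of_mono[OF q, of 0 i] partition_of_mono[OF q, of i K] that by (simp add: partition_of_def)
  have Pt: "p \<in> {0..t}" if "p \<in> P" for p
    using that pt[OF s] pt[OF s'] unfolding P_def by blast
  have ref: "\<exists>k. k 0 = 0 \<and> k K = m \<and> (\<forall>i<K. k i \<le> k (Suc i)) \<and> (\<forall>i\<le>K. q i = r (k i))"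
    if q: "partition_of t e K q" and sub: "q ` {..K} \<subseteq> P" for K q e
  proof -
    have "\<forall>i\<in>{..K}. \<exists>j\<le>m. q i = r j"
    proof
      fix i assume "i \<in> {..K}"
      then have "q i \<in> set l" using sub setl by auto
      then show "\<exists>j\<le>m. q i = r j" unfolding in_set_conv_nth r_def len by (auto simp: less_Suc_eq_le)
    qed
    then obtain k where k: "\<And>i. i \<le> K \<Longrightarrow> k i \<le> m" "\<And>i. i \<le> K \<Longrightarrow> q i = r (k i)" by (metis atMost_iff)
    have "k i \<le> k (Suc i)" if "i < K" for i
    proof (rule ccontr)
      assume "\<not> k i \<le> k (Suc i)"
      then have "q (Suc i) < q i" using strict[of "k (Suc i)" "k i"] k(1)[of i] k(2)[of i] k(2)[of "Suc i"] that by simp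
      then show False using partition_of_mono[OF q, of i "Suc i"] that by simp
    qed
    moreover have "k 0 = 0"
    proof (rule ccontr)
      assume "k 0 \<noteq> 0"
      then have "r 0 < r (k 0)" using strict[of 0 "k 0"] k(1)[of 0] by simp
      also have "r (k 0) = 0" using k(2)[of 0] q unfolding partition_of_def by simp
      finally show False using Pt[OF rP[of 0]] by simp
    qed
    moreover have "k K = m"
    proof (rule ccontr)
      assume "k K \<noteq> m"
      then have "r (k K) < r m" using strict[of "k K" m] k(1)[of K] by simp
      moreover have "r (k K) = t" using k(2)[of K] q unfolding partition_of_def by simp
      ultimately show False using Pt[OF rP[of m]] by simp
    qed
    ultimately show ?thesis using k by (intro exI[of _ k]) auto
  qed
  have main: "\<exists>\<sigma>. (\<forall>j<m. \<sigma> j \<le> r j \<and> r (Suc j) < \<sigma> j + e \<and> \<sigma> j \<in> {0..t}) \<and>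
     (\<forall>z. step_sum K q (\<lambda>i. F (q i)) z = step_sum m r (\<lambda>j. F (\<sigma> j)) z)"
    if q: "partition_of t e K q" and sub: "q ` {..K} \<subseteq> P" for K q e
  proof -
    obtain k where k: "k 0 = 0" "k K = m" "\<And>i. i < K \<Longrightarrow> k i \<le> k (Suc i)" "\<And>i. i \<le> K \<Longrightarrow> q i = r (k i)"
      using ref[OF q sub] by blast
    obtain \<sigma> where \<sigma>: "\<And>j. j < m \<Longrightarrow> \<exists>i<K. \<sigma> j = q i \<and> q i \<le> r j \<and> r (Suc j) \<le> q (Suc i)"
      "\<And>z. step_sum K q (\<lambda>i. F (q i)) z = step_sum m r (\<lambda>j. F (\<sigma> j)) z"
      using step_sum_refine[of k K q r F] k mono by auto
    have "\<sigma> j \<le> r j \<and> r (Suc j) < \<sigma> j + e \<and> \<sigma> j \<in> {0..t}" if j: "j < m" for j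
    proof -
      obtain i where i: "i < K" "\<sigma> j = q i" "q i \<le> r j" "r (Suc j) \<le> q (Suc i)" using \<sigma>(1)[OF j] by blast
      moreover have "q (Suc i) - q i < e" using q i(1) unfolding partition_of_def by blast
      moreover have "q i \<in> {0..t}" using sub i(1) by (intro Pt) auto
      ultimately show ?thesis by auto
    qed
    then show ?thesis using \<sigma>(2) by blast
  qed
  obtain \<sigma> where \<sigma>: "\<forall>j<m. \<sigma> j \<le> r j \<and> r (Suc j) < \<sigma> j + d \<and> \<sigma> j \<in> {0..t}"
     "\<forall>z. step_sum N s (\<lambda>i. F (s i)) z = step_sum m r (\<lambda>j. F (\<sigma> j)) z"
    using main[OF s] by (auto simp: P_def)
  obtain \<sigma>' where \<sigma>': "\<forall>j<m. \<sigma>' j \<le> r j \<and> r (Suc j) < \<sigma>' j + d' \<and> \<sigma>' j \<in> {0..t}"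
     "\<forall>z. step_sum N' s' (\<lambda>i. F (s' i)) z = step_sum m r (\<lambda>j. F (\<sigma>' j)) z"
    using main[OF s'] by (auto simp: P_def)
  obtain k where "k 0 = 0" "k N = m" "\<forall>i\<le>N. s i = r (k i)" using ref[OF s] by (auto simp: P_def)
  then have "r 0 = 0" "r m = t" using s unfolding partition_of_def by (metis le0, metis order_refl)
  then show ?thesis using that[of r m \<sigma> \<sigma>'] \<sigma> \<sigma>' mono by auto
qed

lemma vector_matrix_mult_bound:
  obtains K where "K > 0" "\<And>(u::real^'n) (G::real^'n^'n). norm (u v* G) \<le> K * norm u * norm G"
proof -
  have "bilinear (\<lambda>(u::real^'n) (G::real^'n^'n). u v* G)"
    unfolding bilinear_def
    by (auto intro!: linearI simp: vector_matrix_mult_def vec_eq_iff sum.distrib sum_distrib_left algebra_simps)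
  then interpret bounded_bilinear "\<lambda>(u::real^'n) (G::real^'n^'n). u v* G"
    by (simp add: bilinear_conv_bounded_bilinear)
  obtain K where "K > 0" "\<And>(u::real^'n) (G::real^'n^'n). norm (u v* G) \<le> norm u * norm G * K"
    using pos_bounded by blast
  then show ?thesis by (intro that[of K]) (auto simp: mult_ac)
qed

section \<open>Riemann sums of the Levy process and their Cauchy property in probability\<close>

locale stable_levy = cartesian_nondegenerate_spectral \<alpha> \<mu> C0
  for \<alpha> and \<mu> :: "(real^'n) measure" and C0 +
  fixes M :: "'w measure" and Z :: "real \<Rightarrow> 'w \<Rightarrow> real^'n"
  assumes levy: "levy_process M Z"
    and char_Z: "\<And>t u. t \<ge> 0 \<Longrightarrow> (LINT \<omega>|M. iexp (Z t \<omega> \<bullet> u)) = exp (- complex_of_real t * stable_exponent \<alpha> \<mu> u)"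
begin

sublocale prob_space M
  using levy by (simp add: levy_process_def)

lemma Z_measurable: "t \<ge> 0 \<Longrightarrow> Z t \<in> borel_measurable M"
  using levy by (simp add: levy_process_def)

lemma char_increment:
  assumes "0 \<le> s" "s \<le> t"
  shows "(CLINT \<omega>|M. cis (u \<bullet> (Z t \<omega> - Z s \<omega>))) = of_real (exp (- (t - s) * \<psi> u))"
proof -
  have d: "distr M borel (\<lambda>\<omega>. Z (s + (t - s)) \<omega> - Z s \<omega>) = distr M borel (Z (t - s))"
    using levy assms unfolding levy_process_def by (metis diff_ge_0_iff_ge)
  have m: "(\<lambda>\<omega>. Z t \<omega> - Z s \<omega>) \<in> borel_measurable M" "Z (t - s) \<in> borel_measurable M"
    using assms Z_measurable[of t] Z_measurable[of s] Z_measurable[of "t - s"] by auto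
  have c: "(\<lambda>x. cis (u \<bullet> x)) \<in> borel_measurable borel" unfolding cis_conv_exp by measurable
  have "(CLINT \<omega>|M. cis (u \<bullet> (Z t \<omega> - Z s \<omega>))) = (CLINT x|distr M borel (\<lambda>\<omega>. Z t \<omega> - Z s \<omega>). cis (u \<bullet> x))"
    by (rule integral_distr[OF m(1) c, symmetric])
  also have "\<dots> = (CLINT x|distr M borel (Z (t - s)). cis (u \<bullet> x))" using d by simp
  also have "\<dots> = (CLINT \<omega>|M. cis (u \<bullet> Z (t - s) \<omega>))" by (rule integral_distr[OF m(2) c])
  also have "\<dots> = of_real (exp (- (t - s) * \<psi> u))"
    using char_Z[of "t - s" u] assms
    by (simp add: cis_conv_exp inner_commute stable_exponent_eq flip: exp_of_real)
  finally show ?thesis .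
qed

lemma step_sum_measurable:
  assumes "0 \<le> s 0" "\<And>i. i < N \<Longrightarrow> s i \<le> s (Suc i)"
  shows "(\<lambda>\<omega>. step_sum N s G (\<lambda>t. Z t \<omega>)) \<in> borel_measurable M"
proof -
  have s0: "0 \<le> s i" if "i \<le> N" for i
    using that
  proof (induction i)
    case (Suc i)
    then show ?case using assms(2)[of i] by simp
  qed (rule assms(1))
  show ?thesis
    unfolding step_sum_def
  proof (rule borel_measurable_sum)
    fix i assume "i \<in> {..<N}"
    then have "(\<lambda>\<omega>. Z (s (Suc i)) \<omega> - Z (s i) \<omega>) \<in> borel_measurable M"
      using s0[of i] s0[of "Suc i"] Z_measurable by auto
    then show "(\<lambda>\<omega>. G i *v (Z (s (Suc i)) \<omega> - Z (s i) \<omega>)) \<in> borel_measurable M"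
      by (rule measurable_compose) (intro borel_measurable_continuous_onI matrix_vector_mult_linear_continuous_on)
  qed
qed

lemma char_step_sum:
  assumes s: "0 \<le> s 0" "\<And>i. i < N \<Longrightarrow> s i \<le> s (Suc i)"
  shows "(CLINT \<omega>|M. cis (u \<bullet> step_sum N s G (\<lambda>t. Z t \<omega>))) =
     of_real (exp (- (\<Sum>i<N. (s (Suc i) - s i) * \<psi> (u v* G i))))"
proof -
  have s0: "0 \<le> s i" if "i \<le> N" for i
    using that
  proof (induction i)
    case (Suc i)
    then show ?case using s(2)[of i] by simp
  qed (rule s(1))
  have "indep_vars (\<lambda>_. borel) (\<lambda>i \<omega>. Z (s (Suc i)) \<omega> - Z (s i) \<omega>) {..<N}"
    using levy s unfolding levy_process_def by blast
  then have iv: "indep_vars (\<lambda>_. borel) (\<lambda>i \<omega>. cis ((u v* G i) \<bullet> (Z (s (Suc i)) \<omega> - Z (s i) \<omega>))) {..<N}"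
    by (rule indep_vars_compose2) (auto simp: cis_conv_exp)
  have m: "(\<lambda>\<omega>. Z (s (Suc i)) \<omega> - Z (s i) \<omega>) \<in> borel_measurable M" if "i < N" for i
    using that s0[of i] s0[of "Suc i"] Z_measurable by auto
  have "cis (u \<bullet> step_sum N s G (\<lambda>t. Z t \<omega>)) = (\<Prod>i<N. cis ((u v* G i) \<bullet> (Z (s (Suc i)) \<omega> - Z (s i) \<omega>)))" for \<omega>
    by (simp add: step_sum_def inner_sum_right cis_sum dot_lmul_matrix)
  then have "(CLINT \<omega>|M. cis (u \<bullet> step_sum N s G (\<lambda>t. Z t \<omega>))) =
      (CLINT \<omega>|M. (\<Prod>i<N. cis ((u v* G i) \<bullet> (Z (s (Suc i)) \<omega> - Z (s i) \<omega>))))" by simp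
  also have "\<dots> = (\<Prod>i<N. CLINT \<omega>|M. cis ((u v* G i) \<bullet> (Z (s (Suc i)) \<omega> - Z (s i) \<omega>)))"
  proof (rule indep_vars_lebesgue_integral[OF _ iv])
    fix i assume "i \<in> {..<N}"
    then show "complex_integrable M (\<lambda>\<omega>. cis ((u v* G i) \<bullet> (Z (s (Suc i)) \<omega> - Z (s i) \<omega>)))"
      using m[of i] by (intro integrable_const_bound[where B=1]) (auto simp: cis_conv_exp)
  qed simp
  also have "\<dots> = (\<Prod>i<N. of_real (exp (- (s (Suc i) - s i) * \<psi> (u v* G i))))"
    using s s0 by (intro prod.cong refl char_increment) auto
  also have "\<dots> = of_real (exp (- (\<Sum>i<N. (s (Suc i) - s i) * \<psi> (u v* G i))))"
    by (simp only: of_real_prod[symmetric] exp_sum[symmetric] finite_lessThan mult_minus_left sum_negf)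
  finally show ?thesis .
qed

text \<open>Continuity at 0 is inherited from the characteristic function of \<open>Z 1\<close>,
  which is \<open>exp (- \<psi> u)\<close> and continuous by dominated convergence.\<close>

lemma levy_cos_exponent_tendsto_0:
  assumes "\<epsilon> > 0" obtains \<delta> where "\<delta> > 0" "\<And>u. norm u < \<delta> \<Longrightarrow> \<psi> u < \<epsilon>"
proof -
  have eq: "(LINT \<omega>|M. cos (u \<bullet> Z 1 \<omega>)) = exp (- \<psi> u)" for u
  proof -
    have Z1: "Z 1 \<in> borel_measurable M" using Z_measurable by simp
    have "complex_integrable M (\<lambda>\<omega>. cis (u \<bullet> Z 1 \<omega>))"
      using Z1 by (intro integrable_const_bound[where B=1]) (auto simp: cis_conv_exp)
    then have "(LINT \<omega>|M. cos (u \<bullet> Z 1 \<omega>)) = Re (CLINT \<omega>|M. cis (u \<bullet> Z 1 \<omega>))"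
      using integral_Re[of M "\<lambda>\<omega>. cis (u \<bullet> Z 1 \<omega>)"] by simp
    also have "(CLINT \<omega>|M. cis (u \<bullet> Z 1 \<omega>)) = of_real (exp (- \<psi> u))"
      using char_Z[of 1 u] by (simp add: cis_conv_exp inner_commute stable_exponent_eq flip: exp_of_real)
    finally show ?thesis by simp
  qed
  have "isCont (\<lambda>u. LINT \<omega>|M. cos (u \<bullet> Z 1 \<omega>)) 0"
    unfolding continuous_at_sequentially comp_def
  proof (intro allI impI)
    fix x :: "nat \<Rightarrow> real^'n" assume x: "x \<longlonglongrightarrow> 0"
    have Z1: "Z 1 \<in> borel_measurable M" using Z_measurable by simp
    show "(\<lambda>n. LINT \<omega>|M. cos (x n \<bullet> Z 1 \<omega>)) \<longlonglongrightarrow> (LINT \<omega>|M. cos (0 \<bullet> Z 1 \<omega>))"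
    proof (rule integral_dominated_convergence[where w="\<lambda>_. 1"])
      show "AE \<omega> in M. (\<lambda>n. cos (x n \<bullet> Z 1 \<omega>)) \<longlonglongrightarrow> cos (0 \<bullet> Z 1 \<omega>)"
        by (intro AE_I2 tendsto_intros x)
    qed (use Z1 in auto)
  qed
  then have "isCont (\<lambda>u. exp (- \<psi> u)) 0" unfolding eq .
  then have "(\<lambda>u. - ln (exp (- \<psi> u))) \<midarrow>0\<rightarrow> - ln (exp (- \<psi> 0))"
    unfolding isCont_def by (intro tendsto_minus tendsto_ln) auto
  then have "\<psi> \<midarrow>0\<rightarrow> \<psi> 0" by simp
  moreover have "\<psi> 0 = 0" by (simp add: levy_cos_exponent_def)
  ultimately have "\<psi> \<midarrow>0\<rightarrow> 0" by simp
  then obtain \<delta> where \<delta>: "\<delta> > 0" "\<And>u. u \<noteq> 0 \<Longrightarrow> norm u < \<delta> \<Longrightarrow> \<bar>\<psi> u\<bar> < \<epsilon>"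
    using assms unfolding LIM_def by (auto simp: dist_norm)
  show ?thesis
  proof
    show "\<psi> u < \<epsilon>" if "norm u < \<delta>" for u
      using \<delta>(2)[of u] that assms \<open>\<psi> 0 = 0\<close> by (cases "u = 0") auto
  qed fact
qed

text \<open>On a common refinement the difference has an explicit characteristic function. Uniform
  continuity of \<open>F\<close> makes the arguments \<open>u v* G i\<close> small for bounded
  \<open>u\<close>, there \<open>\<psi>\<close> is small, and the tail estimate by cosines gives
  smallness in probability. No moments of \<open>Z\<close> are involved.\<close>

lemma step_sum_cauchy:
  fixes F :: "real \<Rightarrow> real^'n^'n"
  assumes t: "t \<ge> 0" and F: "continuous_on {0..t} F" and e: "e > 0" and p: "p > 0"
  obtains d where "d > 0"
    "\<And>N s N' s'. partition_of t d N s \<Longrightarrow> partition_of t d N' s' \<Longrightarrow>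
      prob {\<omega> \<in> space M. norm (step_sum N s (\<lambda>i. F (s i)) (\<lambda>t. Z t \<omega>) - step_sum N' s' (\<lambda>i. F (s' i)) (\<lambda>t. Z t \<omega>)) > e} < p"
proof -
  define R where "R = 2 * CARD('n) / e"
  have R: "R > 0" using e by (simp add: R_def)
  obtain K where K: "K > 0" "\<And>(u::real^'n) (G::real^'n^'n). norm (u v* G) \<le> K * norm u * norm G"
    using vector_matrix_mult_bound by blast
  \<comment> \<open>The tail estimate will yield
    \<open>2 * CARD('n) * (t * \<epsilon>) = p / 2 * (t / (t + 1)) < p\<close>; \<open>t + 1\<close>
    in the denominator keeps \<open>t = 0\<close> admissible.\<close>
  define \<epsilon> where "\<epsilon> = p / (4 * CARD('n) * (t + 1))"
  have \<epsilon>: "\<epsilon> > 0" using p t by (simp add: \<epsilon>_def)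
  obtain \<delta> where \<delta>: "\<delta> > 0" "\<And>u. norm u < \<delta> \<Longrightarrow> \<psi> u < \<epsilon>"
    using levy_cos_exponent_tendsto_0[OF \<epsilon>] by blast
  have "uniformly_continuous_on {0..t} F"
    by (rule compact_uniformly_continuous[OF F]) simp
  then obtain d where d: "d > 0" "\<And>x y. x \<in> {0..t} \<Longrightarrow> y \<in> {0..t} \<Longrightarrow> \<bar>x - y\<bar> < d \<Longrightarrow> norm (F x - F y) < \<delta> / (K * R + 1)"
  proof -
    have "\<delta> / (K * R + 1) > 0" using \<delta>(1) K R by (intro divide_pos_pos add_pos_pos mult_pos_pos) auto
    with \<open>uniformly_continuous_on {0..t} F\<close> obtain d where "d > 0"
      "\<forall>x\<in>{0..t}. \<forall>x'\<in>{0..t}. norm (x' - x) < d \<longrightarrow> norm (F x' - F x) < \<delta> / (K * R + 1)"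
      unfolding uniformly_continuous_on_def dist_norm by blast
    then show ?thesis by (intro that[of d]) auto
  qed
  show ?thesis
  proof
    show "d > 0" by fact
    fix N s N' s' assume s: "partition_of t d N s" and s': "partition_of t d N' s'"
    show "prob {\<omega> \<in> space M. norm (step_sum N s (\<lambda>i. F (s i)) (\<lambda>t. Z t \<omega>) - step_sum N' s' (\<lambda>i. F (s' i)) (\<lambda>t. Z t \<omega>)) > e} < p"
    proof (rule common_refinement[OF s s', where F=F])
      fix m r \<sigma> \<sigma>' assume r: "r 0 = 0" "r m = t" "\<And>j. j < m \<Longrightarrow> r j \<le> r (Suc j)"
      and \<sigma>: "\<And>j. j < m \<Longrightarrow> \<sigma> j \<le> r j \<and> r (Suc j) < \<sigma> j + d \<and> \<sigma>' j \<le> r j \<and> r (Suc j) < \<sigma>' j + d"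
        "\<And>j. j < m \<Longrightarrow> \<sigma> j \<in> {0..t} \<and> \<sigma>' j \<in> {0..t}"
      and eq: "\<And>z. step_sum N s (\<lambda>i. F (s i)) z = step_sum m r (\<lambda>j. F (\<sigma> j)) z"
        "\<And>z. step_sum N' s' (\<lambda>i. F (s' i)) z = step_sum m r (\<lambda>j. F (\<sigma>' j)) z"
    define G where "G j = F (\<sigma> j) - F (\<sigma>' j)" for j
    have diff: "step_sum N s (\<lambda>i. F (s i)) z - step_sum N' s' (\<lambda>i. F (s' i)) z = step_sum m r G z" for z
      unfolding eq unfolding step_sum_def G_def sum_subtractf[symmetric] by (simp only: matrix_vector_mult_diff_rdistrib)
    have r0: "0 \<le> r 0" using r by simp
    have "prob {\<omega> \<in> space M. norm (step_sum m r G (\<lambda>t. Z t \<omega>)) > e} \<le> 2 * CARD('n) * (t * \<epsilon>)"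
    proof (rule tail_le_cos_vec[OF step_sum_measurable[OF r0 r(3)] e])
      fix u :: "real^'n" assume u: "norm u \<le> 2 * CARD('n) / e"
      let ?E = "\<Sum>i<m. (r (Suc i) - r i) * \<psi> (u v* G i)"
      have "complex_integrable M (\<lambda>\<omega>. cis (u \<bullet> step_sum m r G (\<lambda>t. Z t \<omega>)))"
        using step_sum_measurable[OF r0 r(3)]
        by (intro integrable_const_bound[where B=1]) (auto simp: cis_conv_exp)
      then have "(LINT \<omega>|M. cos (u \<bullet> step_sum m r G (\<lambda>t. Z t \<omega>))) = Re (CLINT \<omega>|M. cis (u \<bullet> step_sum m r G (\<lambda>t. Z t \<omega>)))"
        using integral_Re[of M "\<lambda>\<omega>. cis (u \<bullet> step_sum m r G (\<lambda>t. Z t \<omega>))"] by simp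
      also have "\<dots> = exp (- ?E)" using char_step_sum[OF r0 r(3)] by simp
      also have "\<dots> \<ge> 1 - ?E" using exp_ge_add_one_self[of "- ?E"] by simp
      finally have "1 - (LINT \<omega>|M. cos (u \<bullet> step_sum m r G (\<lambda>t. Z t \<omega>))) \<le> ?E" by simp
      also have "?E \<le> (\<Sum>i<m. (r (Suc i) - r i) * \<epsilon>)"
      proof (intro sum_mono mult_left_mono)
        fix i assume "i \<in> {..<m}"
        then have i: "i < m" by simp
        have "\<bar>\<sigma> i - \<sigma>' i\<bar> < d" using \<sigma>(1)[OF i] r(3)[OF i] by linarith
        then have "norm (G i) < \<delta> / (K * R + 1)" unfolding G_def using \<sigma>(2)[OF i] by (intro d(2)) auto
        then have "(K * R + 1) * norm (G i) < \<delta>" using K R by (simp add: pos_less_divide_eq add_pos_pos mult.commute)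
        moreover have "norm (u v* G i) \<le> K * R * norm (G i)"
          using K(2)[of u "G i"] u K(1) unfolding R_def[symmetric]
          by (meson dual_order.trans mult_left_mono mult_right_mono norm_ge_zero less_imp_le)
        ultimately have "norm (u v* G i) < \<delta>"
          using norm_ge_zero[of "G i"] unfolding distrib_right mult_1 by linarith
        then show "\<psi> (u v* G i) \<le> \<epsilon>" using \<delta>(2) by (simp add: less_imp_le)
        show "0 \<le> r (Suc i) - r i" using r(3)[OF i] by simp
      qed
      also have "\<dots> = (r m - r 0) * \<epsilon>" by (simp add: sum_distrib_right[symmetric] sum_lessThan_telescope)
      finally show "1 - (LINT \<omega>|M. cos (u \<bullet> step_sum m r G (\<lambda>t. Z t \<omega>))) \<le> t * \<epsilon>" using r by simp
    qed
    also have "\<dots> < p"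
    proof -
      have "2 * CARD('n) * (t * \<epsilon>) = p / 2 * (t / (t + 1))" using t by (simp add: \<epsilon>_def divide_simps)
      also have "\<dots> \<le> p / 2 * 1" using p t by (intro mult_left_mono) (auto simp: divide_le_eq)
      finally show ?thesis using p by simp
    qed
    finally show "prob {\<omega> \<in> space M. norm (step_sum N s (\<lambda>i. F (s i)) (\<lambda>t. Z t \<omega>) - step_sum N' s' (\<lambda>i. F (s' i)) (\<lambda>t. Z t \<omega>)) > e} < p"
      unfolding diff .
    qed
  qed
qed

end

section \<open>Existence and characteristic function of the Wiener integral\<close>

definition uniform_partition :: "real \<Rightarrow> nat \<Rightarrow> nat \<Rightarrow> real" where
  "uniform_partition t N i = real i * t / real N"

lemma partition_of_uniform:
  assumes "t > 0" "d > 0" "N > 0" "t / real N < d"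
  shows "partition_of t d N (uniform_partition t N)"
  using assms by (auto simp: partition_of_def uniform_partition_def field_simps)

context stable_levy
begin

definition integral_sum :: "(real \<Rightarrow> real^'n^'n) \<Rightarrow> nat \<Rightarrow> (nat \<Rightarrow> real) \<Rightarrow> 'w \<Rightarrow> real^'n" where
  "integral_sum F N s \<omega> = step_sum N s (\<lambda>i. F (s i)) (\<lambda>t. Z t \<omega>)"

lemma has_stochastic_integral_iff:
  "has_stochastic_integral M Z t F Y \<longleftrightarrow> Y \<in> borel_measurable M \<and>
    (\<forall>e>0. \<forall>p>0. \<exists>d>0. \<forall>N s. partition_of t d N s \<longrightarrow>
       prob {\<omega> \<in> space M. norm (integral_sum F N s \<omega> - Y \<omega>) > e} < p)"
  unfolding has_stochastic_integral_def integral_sum_def step_sum_def partition_of_def ..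

lemma integral_sum_measurable: "partition_of t d N s \<Longrightarrow> integral_sum F N s \<in> borel_measurable M"
  unfolding integral_sum_def by (rule step_sum_measurable) (auto simp: partition_of_def)

lemma prob_norm_diff_triangle:
  fixes X Y W :: "'w \<Rightarrow> real^'n"
  assumes [measurable]: "X \<in> borel_measurable M" "Y \<in> borel_measurable M" "W \<in> borel_measurable M"
  shows "prob {\<omega> \<in> space M. norm (X \<omega> - W \<omega>) > e} \<le>
    prob {\<omega> \<in> space M. norm (X \<omega> - Y \<omega>) > e / 2} + prob {\<omega> \<in> space M. norm (Y \<omega> - W \<omega>) > e / 2}"
proof -
  have "prob {\<omega> \<in> space M. norm (X \<omega> - W \<omega>) > e} \<le>
    prob ({\<omega> \<in> space M. norm (X \<omega> - Y \<omega>) > e / 2} \<union> {\<omega> \<in> space M. norm (Y \<omega> - W \<omega>) > e / 2})"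
  proof (rule finite_measure_mono)
    show "{\<omega> \<in> space M. norm (X \<omega> - W \<omega>) > e} \<subseteq>
      {\<omega> \<in> space M. norm (X \<omega> - Y \<omega>) > e / 2} \<union> {\<omega> \<in> space M. norm (Y \<omega> - W \<omega>) > e / 2}"
    proof
      fix \<omega> assume "\<omega> \<in> {\<omega> \<in> space M. norm (X \<omega> - W \<omega>) > e}"
      moreover have "norm (X \<omega> - W \<omega>) \<le> norm (X \<omega> - Y \<omega>) + norm (Y \<omega> - W \<omega>)"
        using norm_triangle_ineq[of "X \<omega> - Y \<omega>" "Y \<omega> - W \<omega>"] by simp
      ultimately show "\<omega> \<in> {\<omega> \<in> space M. norm (X \<omega> - Y \<omega>) > e / 2} \<union> {\<omega> \<in> space M. norm (Y \<omega> - W \<omega>) > e / 2}"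
        by auto
    qed
  qed measurable
  also have "\<dots> \<le> prob {\<omega> \<in> space M. norm (X \<omega> - Y \<omega>) > e / 2} + prob {\<omega> \<in> space M. norm (Y \<omega> - W \<omega>) > e / 2}"
    by (rule measure_Un_le) measurable
  finally show ?thesis .
qed

lemma AE_tendsto_imp_prob_tendsto:
  fixes X :: "nat \<Rightarrow> 'w \<Rightarrow> real^'n"
  assumes [measurable]: "\<And>k. X k \<in> borel_measurable M" "Y \<in> borel_measurable M"
    and lim: "AE \<omega> in M. (\<lambda>k. X k \<omega>) \<longlonglongrightarrow> Y \<omega>" and e: "e > 0"
  shows "(\<lambda>k. prob {\<omega> \<in> space M. norm (X k \<omega> - Y \<omega>) > e}) \<longlonglongrightarrow> 0"
proof -
  have "(\<lambda>k. LINT \<omega>|M. indicator {\<omega> \<in> space M. norm (X k \<omega> - Y \<omega>) > e} \<omega> :: real) \<longlonglongrightarrow> (LINT \<omega>|M. 0)"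
  proof (rule integral_dominated_convergence[where w="\<lambda>_. 1"])
    show "AE \<omega> in M. (\<lambda>k. indicator {\<omega> \<in> space M. norm (X k \<omega> - Y \<omega>) > e} \<omega> :: real) \<longlonglongrightarrow> 0"
      using lim
    proof eventually_elim
      case (elim \<omega>)
      have "\<forall>\<^sub>F k in sequentially. dist (X k \<omega>) (Y \<omega>) < e" using elim e by (rule tendstoD)
      then show ?case
        by (intro tendsto_eventually) (auto elim!: eventually_mono simp: indicator_def dist_norm)
    qed
  qed (auto simp: indicator_def)
  then show ?thesis by simp
qed

text \<open>Completeness of convergence in probability, by hand: partitions are chosen whose
  successive sums differ by more than \<open>(1 / 2) ^ k\<close> with probability below
  \<open>(1 / 2) ^ k\<close>. Borel-Cantelli gives an almost sure limit, and the Cauchy property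
  extends the convergence to all fine partitions.\<close>

lemma stochastic_integral_exists:
  assumes t: "t > 0" and F: "continuous_on {0..t} F"
  shows "\<exists>Y. has_stochastic_integral M Z t F Y"
proof -
  have "\<forall>k. \<exists>d>0. \<forall>N s N' s'. partition_of t d N s \<longrightarrow> partition_of t d N' s' \<longrightarrow>
      prob {\<omega> \<in> space M. norm (integral_sum F N s \<omega> - integral_sum F N' s' \<omega>) > (1 / 2) ^ k} < (1 / 2) ^ k"
  proof
    fix k :: nat
    have zp: "(0::real) < (1 / 2) ^ k" by simp
    obtain d where "d > 0" "\<And>N s N' s'. partition_of t d N s \<Longrightarrow> partition_of t d N' s' \<Longrightarrow>
      prob {\<omega> \<in> space M. norm (step_sum N s (\<lambda>i. F (s i)) (\<lambda>t. Z t \<omega>) - step_sum N' s' (\<lambda>i. F (s' i)) (\<lambda>t. Z t \<omega>)) > (1 / 2) ^ k} < (1 / 2) ^ k"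
      using step_sum_cauchy[OF less_imp_le[OF t] F zp zp] by blast
    then show "\<exists>d>0. \<forall>N s N' s'. partition_of t d N s \<longrightarrow> partition_of t d N' s' \<longrightarrow>
      prob {\<omega> \<in> space M. norm (integral_sum F N s \<omega> - integral_sum F N' s' \<omega>) > (1 / 2) ^ k} < (1 / 2) ^ k"
      unfolding integral_sum_def by blast
  qed
  from choice[OF this] obtain d where "\<forall>k. d k > 0 \<and> (\<forall>N s N' s'. partition_of t (d k) N s \<longrightarrow> partition_of t (d k) N' s' \<longrightarrow>
      prob {\<omega> \<in> space M. norm (integral_sum F N s \<omega> - integral_sum F N' s' \<omega>) > (1 / 2) ^ k} < (1 / 2) ^ k)" ..
  then have d: "\<And>k. d k > 0" "\<And>k N s N' s'. partition_of t (d k) N s \<Longrightarrow> partition_of t (d k) N' s' \<Longrightarrow>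
      prob {\<omega> \<in> space M. norm (integral_sum F N s \<omega> - integral_sum F N' s' \<omega>) > (1 / 2) ^ k} < (1 / 2) ^ k"
    by blast+
  \<comment> \<open>The minimum over all indices up to \<open>k\<close> makes mesh
    \<open>D (Suc k)\<close> admissible for \<open>d k\<close> too, so that consecutive sums can be
    compared; the term \<open>1 / real (Suc k)\<close> forces the mesh to 0.\<close>
  define D where "D k = min (1 / real (Suc k)) (Min (d ` {..k}))" for k
  have D: "D k > 0" "D k \<le> d k" "D (Suc k) \<le> d k" "D k \<le> 1 / real (Suc k)" for k
    using d(1) by (auto simp: D_def min_le_iff_disj intro!: Min_le)
  have "\<exists>N>0. t / real N < D k" for k
  proof -
    obtain N where "real N > t / D k" using reals_Archimedean2 by blast
    moreover have "t / D k > 0" using t D(1) by simp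
    ultimately have "N > 0" by (metis less_asym of_nat_0 gr0I)
    then show ?thesis using \<open>real N > t / D k\<close> D(1)[of k] by (intro exI[of _ N]) (simp add: field_simps)
  qed
  then obtain n where n: "\<And>k. n k > 0" "\<And>k. t / real (n k) < D k" by metis
  have part: "partition_of t e (n k) (uniform_partition t (n k))" if "D k \<le> e" for k e
    using n[of k] D(1)[of k] t that by (intro partition_of_uniform) auto
  define X where "X k = integral_sum F (n k) (uniform_partition t (n k))" for k
  have Xm[measurable]: "X k \<in> borel_measurable M" for k
    unfolding X_def by (rule integral_sum_measurable[OF part[OF order_refl]])
  let ?A = "\<lambda>k. {\<omega> \<in> space M. norm (X k \<omega> - X (Suc k) \<omega>) > (1 / 2) ^ k}"
  have "AE \<omega> in M. \<forall>\<^sub>F k in sequentially. \<omega> \<in> space M - ?A k"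
  proof (rule borel_cantelli_AE1)
    show "?A k \<in> sets M" for k by measurable
    show "emeasure M (?A k) < \<infinity>" for k by (simp add: less_top[symmetric])
    show "summable (\<lambda>k. measure M (?A k))"
    proof (rule summable_comparison_test)
      show "summable (\<lambda>k. (1 / 2 :: real) ^ k)" by (rule summable_geometric) simp
      have "prob (?A k) < (1 / 2) ^ k" for k
        unfolding X_def by (rule d(2)[OF part part]) (use D in auto)
      then show "\<exists>N. \<forall>k\<ge>N. norm (measure M (?A k)) \<le> (1 / 2) ^ k" by (auto intro: less_imp_le)
    qed
  qed
  then have conv: "AE \<omega> in M. convergent (\<lambda>k. X k \<omega>)"
  proof eventually_elim
    case (elim \<omega>)
    then have ev: "\<forall>\<^sub>F k in sequentially. norm (X (Suc k) \<omega> - X k \<omega>) \<le> (1 / 2) ^ k"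
      by (rule eventually_mono) (auto simp: norm_minus_commute)
    have "summable (\<lambda>k. X (Suc k) \<omega> - X k \<omega>)"
      by (rule summable_comparison_test_ev[OF ev]) (simp add: summable_geometric)
    then have "(\<lambda>k. (\<Sum>i<k. X (Suc i) \<omega> - X i \<omega>) + X 0 \<omega>) \<longlonglongrightarrow> (\<Sum>k. X (Suc k) \<omega> - X k \<omega>) + X 0 \<omega>"
      by (intro tendsto_intros summable_LIMSEQ)
    moreover have "(\<Sum>i<k. X (Suc i) \<omega> - X i \<omega>) = X k \<omega> - X 0 \<omega>" for k
      by (rule sum_lessThan_telescope)
    ultimately show ?case by (auto simp: convergent_def)
  qed
  define Y where "Y \<omega> = lim (\<lambda>k. X k \<omega>)" for \<omega>
  have Ym[measurable]: "Y \<in> borel_measurable M" unfolding Y_def by (rule borel_measurable_lim_metric) measurable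
  have lim: "AE \<omega> in M. (\<lambda>k. X k \<omega>) \<longlonglongrightarrow> Y \<omega>"
    using conv by eventually_elim (simp add: Y_def convergent_LIMSEQ_iff)
  have "has_stochastic_integral M Z t F Y"
    unfolding has_stochastic_integral_iff
  proof (intro conjI allI impI)
    fix e p :: real assume e: "e > 0" and p: "p > 0"
    obtain \<delta> where \<delta>: "\<delta> > 0" "\<And>N s N' s'. partition_of t \<delta> N s \<Longrightarrow> partition_of t \<delta> N' s' \<Longrightarrow>
      prob {\<omega> \<in> space M. norm (step_sum N s (\<lambda>i. F (s i)) (\<lambda>t. Z t \<omega>) - step_sum N' s' (\<lambda>i. F (s' i)) (\<lambda>t. Z t \<omega>)) > e / 2} < p / 2"
      using step_sum_cauchy[OF less_imp_le[OF t] F half_gt_zero[OF e] half_gt_zero[OF p]] by blast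
    have "\<forall>\<^sub>F k in sequentially. prob {\<omega> \<in> space M. norm (X k \<omega> - Y \<omega>) > e / 2} < p / 2"
      by (rule order_tendstoD[OF AE_tendsto_imp_prob_tendsto[OF Xm Ym lim]]) (use e p in auto)
    moreover have "\<forall>\<^sub>F k in sequentially. D k < \<delta>"
    proof -
      have "(\<lambda>k. 1 / real (Suc k)) \<longlonglongrightarrow> 0"
        using LIMSEQ_inverse_real_of_nat by (simp add: divide_inverse)
      then have "\<forall>\<^sub>F k in sequentially. 1 / real (Suc k) < \<delta>" using \<delta>(1) by (rule order_tendstoD)
      then show ?thesis by (rule eventually_mono) (use D(4) in \<open>auto intro: le_less_trans\<close>)
    qed
    ultimately have "\<forall>\<^sub>F k in sequentially. prob {\<omega> \<in> space M. norm (X k \<omega> - Y \<omega>) > e / 2} < p / 2 \<and> D k < \<delta>"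
      by eventually_elim simp
    then obtain k where k: "prob {\<omega> \<in> space M. norm (X k \<omega> - Y \<omega>) > e / 2} < p / 2" "D k < \<delta>"
      using eventually_happens by fastforce
    show "\<exists>d>0. \<forall>N s. partition_of t d N s \<longrightarrow> prob {\<omega> \<in> space M. norm (integral_sum F N s \<omega> - Y \<omega>) > e} < p"
    proof (intro exI[of _ \<delta>] conjI allI impI \<delta>(1))
      fix N s assume s: "partition_of t \<delta> N s"
      have "prob {\<omega> \<in> space M. norm (integral_sum F N s \<omega> - X k \<omega>) > e / 2} < p / 2"
        unfolding X_def integral_sum_def by (rule \<delta>(2)[OF s part]) (use k in simp)
      then show "prob {\<omega> \<in> space M. norm (integral_sum F N s \<omega> - Y \<omega>) > e} < p"
        using prob_norm_diff_triangle[OF integral_sum_measurable[OF s, of F] Xm[of k] Ym, of e] k(1) by simp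
    qed
  qed (rule Ym)
  then show ?thesis by blast
qed

text \<open>Off an event of small probability the two exponentials differ by at most
  \<open>norm u * e\<close>, on it by at most 2. The sequence \<open>n\<close> of partition sizes is
  left free because the noise is later studied along multiples of a fixed number.\<close>

lemma char_stochastic_integral:
  assumes t: "t > 0" and Y: "has_stochastic_integral M Z t F Y"
    and n: "filterlim n at_top sequentially"
  shows "(\<lambda>k. complex_of_real (exp (- (\<Sum>i<n k. t / n k * \<psi> (u v* F (uniform_partition t (n k) i))))))
    \<longlonglongrightarrow> (CLINT \<omega>|M. cis (u \<bullet> Y \<omega>))"
proof -
  have Ym[measurable]: "Y \<in> borel_measurable M" using Y by (simp add: has_stochastic_integral_iff)
  let ?c = "\<lambda>k. complex_of_real (exp (- (\<Sum>i<n k. t / n k * \<psi> (u v* F (uniform_partition t (n k) i)))))"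
  let ?L = "CLINT \<omega>|M. cis (u \<bullet> Y \<omega>)"
  show ?thesis
  proof (rule tendstoI)
    fix \<epsilon> :: real assume \<epsilon>: "\<epsilon> > 0"
    \<comment> \<open>Gives \<open>norm u * e \<le> \<epsilon> / 2\<close>, also for
      \<open>u = 0\<close>; the exceptional event of probability below \<open>\<epsilon> / 4\<close>
      contributes the other half.\<close>
    define e where "e = \<epsilon> / (2 * (norm u + 1))"
    have nu: "norm u + 1 > 0" by (simp add: add_nonneg_pos)
    have e: "e > 0" using \<epsilon> nu by (simp add: e_def)
    have "\<exists>d>0. \<forall>N s. partition_of t d N s \<longrightarrow>
      prob {\<omega> \<in> space M. norm (integral_sum F N s \<omega> - Y \<omega>) > e} < \<epsilon> / 4"
    proof -
      have "\<forall>e>0. \<forall>p>0. \<exists>d>0. \<forall>N s. partition_of t d N s \<longrightarrow>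
         prob {\<omega> \<in> space M. norm (integral_sum F N s \<omega> - Y \<omega>) > e} < p"
        using Y by (simp add: has_stochastic_integral_iff)
      from this[rule_format, OF e, of "\<epsilon> / 4"] show ?thesis using \<epsilon> by simp
    qed
    then obtain d where d: "d > 0" "\<And>N s. partition_of t d N s \<Longrightarrow>
      prob {\<omega> \<in> space M. norm (integral_sum F N s \<omega> - Y \<omega>) > e} < \<epsilon> / 4"
      by blast
    have "\<forall>\<^sub>F k in sequentially. n k \<ge> Suc (nat \<lceil>t / d\<rceil>)"
      using n unfolding filterlim_at_top by blast
    then show "\<forall>\<^sub>F k in sequentially. dist (?c k) ?L < \<epsilon>"
    proof eventually_elim
      case (elim k)
      have nk: "n k > 0" "t / real (n k) < d"
      proof -
        show "n k > 0" using elim by simp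
        have "t / d < real (n k)" using elim by linarith
        then show "t / real (n k) < d" using \<open>n k > 0\<close> d(1) by (simp add: field_simps)
      qed
      let ?s = "uniform_partition t (n k)"
      have s: "partition_of t d (n k) ?s" by (rule partition_of_uniform[OF t d(1) nk])
      define X where "X = integral_sum F (n k) ?s"
      have Xm[measurable]: "X \<in> borel_measurable M" unfolding X_def by (rule integral_sum_measurable[OF s])
      have "(CLINT \<omega>|M. cis (u \<bullet> X \<omega>)) = of_real (exp (- (\<Sum>i<n k. (?s (Suc i) - ?s i) * \<psi> (u v* F (?s i)))))"
        unfolding X_def integral_sum_def
        by (rule char_step_sum) (use t in \<open>auto simp: uniform_partition_def divide_right_mono\<close>)
      also have "\<dots> = ?c k"
      proof -
        have "?s (Suc i) - ?s i = t / n k" for i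
          by (simp add: uniform_partition_def add_divide_distrib distrib_right)
        then show ?thesis by simp
      qed
      finally have ck: "?c k = (CLINT \<omega>|M. cis (u \<bullet> X \<omega>))" by simp
      have int: "complex_integrable M (\<lambda>\<omega>. cis (u \<bullet> W \<omega>))" if "W \<in> borel_measurable M" for W
        using that by (intro integrable_const_bound[where B=1]) (auto simp: cis_conv_exp)
      let ?A = "{\<omega> \<in> space M. norm (X \<omega> - Y \<omega>) > e}"
      have "dist (?c k) ?L = norm (CLINT \<omega>|M. cis (u \<bullet> X \<omega>) - cis (u \<bullet> Y \<omega>))"
        unfolding ck dist_norm using int[OF Xm] int[OF Ym] by simp
      also have "\<dots> \<le> (LINT \<omega>|M. norm (cis (u \<bullet> X \<omega>) - cis (u \<bullet> Y \<omega>)))" by (rule integral_norm_bound)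
      also have "\<dots> \<le> (LINT \<omega>|M. norm u * e + 2 * indicator ?A \<omega>)"
      proof (rule integral_mono)
        show "integrable M (\<lambda>\<omega>. norm (cis (u \<bullet> X \<omega>) - cis (u \<bullet> Y \<omega>)))"
          using int[OF Xm] int[OF Ym] by simp
        show "integrable M (\<lambda>\<omega>. norm u * e + 2 * indicator ?A \<omega>)"
          by (intro Bochner_Integration.integrable_add integrable_mult_right integrable_real_indicator) (auto simp: less_top[symmetric])
        fix \<omega> assume \<omega>: "\<omega> \<in> space M"
        show "norm (cis (u \<bullet> X \<omega>) - cis (u \<bullet> Y \<omega>)) \<le> norm u * e + 2 * indicator ?A \<omega>"
        proof (cases "\<omega> \<in> ?A")
          case True
          have "norm (cis (u \<bullet> X \<omega>) - cis (u \<bullet> Y \<omega>)) \<le> 2"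
            using norm_triangle_ineq4[of "cis (u \<bullet> X \<omega>)" "cis (u \<bullet> Y \<omega>)"] by simp
          moreover have "norm u * e \<ge> 0" using e by simp
          ultimately show ?thesis using True by simp
        next
          case False
          have "norm (cis (u \<bullet> X \<omega>) - cis (u \<bullet> Y \<omega>)) \<le> \<bar>u \<bullet> (X \<omega> - Y \<omega>)\<bar>"
            using norm_cis_diff_le[of "u \<bullet> X \<omega>" "u \<bullet> Y \<omega>"] by (simp add: inner_diff_right)
          also have "\<dots> \<le> norm u * norm (X \<omega> - Y \<omega>)" by (rule Cauchy_Schwarz_ineq2)
          also have "\<dots> \<le> norm u * e" using False \<omega> by (intro mult_left_mono) auto
          finally show ?thesis using False by simp
        qed
      qed
      also have "\<dots> = norm u * e + 2 * prob ?A"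
      proof -
        have "integrable M (\<lambda>\<omega>. 2 * indicator ?A \<omega> :: real)"
          by (intro integrable_mult_right integrable_real_indicator) (auto simp: less_top[symmetric])
        then show ?thesis by (subst Bochner_Integration.integral_add) (auto simp: prob_space)
      qed
      also have "\<dots> < norm u * e + \<epsilon> / 2"
        using d(2)[OF s] by (simp add: X_def)
      also have "norm u * e \<le> \<epsilon> / 2"
      proof -
        have "norm u * e \<le> (norm u + 1) * e" using e by (intro mult_right_mono) auto
        also have "\<dots> = \<epsilon> / 2"
        proof -
          have *: "x * (\<epsilon> / (2 * x)) = \<epsilon> / 2" if "x \<noteq> 0" for x using that by simp
          show ?thesis unfolding e_def by (rule *) (use nu in linarith)
        qed
        finally show ?thesis .
      qed
      finally show "dist (?c k) ?L < \<epsilon>" by simp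
    qed
  qed
qed

end

section \<open>The Ornstein--Uhlenbeck semigroup\<close>

lemma matrix_mult_bound:
  obtains K where "K > 0" "\<And>B::real^'n^'n. norm (A ** B) \<le> K * norm B"
proof -
  have "linear (\<lambda>B::real^'n^'n. A ** B)"
    by (rule linearI)
       (simp_all add: matrix_matrix_mult_def vec_eq_iff sum.distrib sum_distrib_left distrib_left mult.left_commute)
  then have "bounded_linear (\<lambda>B::real^'n^'n. A ** B)" by (simp add: linear_conv_bounded_linear)
  then show ?thesis using that bounded_linear.pos_bounded by (metis mult.commute)
qed

lemma matrix_power_scaleR:
  fixes A :: "real^'n^'n"
  shows "((**) (s *\<^sub>R A) ^^ k) (mat 1) = s ^ k *\<^sub>R (((**) A ^^ k) (mat 1 :: real^'n^'n))"
proof (induction k)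
  case (Suc k)
  have "(s *\<^sub>R A) ** (c *\<^sub>R B) = (s * c) *\<^sub>R (A ** B)" for c and B :: "real^'n^'n"
    by (simp add: matrix_matrix_mult_def vec_eq_iff sum_distrib_left mult_ac)
  then show ?case unfolding funpow.simps comp_apply Suc by simp
qed simp

text \<open>Left multiplication by \<open>A\<close> is bounded with constant \<open>K\<close>, so on
  \<open>{0..1}\<close> the series is dominated by \<open>K ^ k / fact k * norm (mat 1)\<close> and
  converges uniformly.\<close>

lemma matrix_exp_continuous: "continuous_on {0..1} (\<lambda>s. matrix_exp (s *\<^sub>R (A :: real^'n^'n)))"
proof -
  obtain K where K: "K > 0" "\<And>B::real^'n^'n. norm (A ** B) \<le> K * norm B"
    using matrix_mult_bound by blast
  let ?P = "\<lambda>k. ((**) A ^^ k) (mat 1 :: real^'n^'n)"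
  have P: "norm (?P k) \<le> K ^ k * norm (mat 1 :: real^'n^'n)" for k
  proof (induction k)
    case (Suc k)
    have "norm (?P (Suc k)) \<le> K * norm (?P k)" using K(2)[of "?P k"] by simp
    also have "\<dots> \<le> K * (K ^ k * norm (mat 1 :: real^'n^'n))" using Suc K(1) by (intro mult_left_mono) auto
    finally show ?case by simp
  qed simp
  let ?f = "\<lambda>k s. (1 / fact k) *\<^sub>R (s ^ k *\<^sub>R ?P k)"
  have "uniform_limit {0..1} (\<lambda>n s. \<Sum>k<n. ?f k s) (\<lambda>s. \<Sum>k. ?f k s) sequentially"
  proof (rule Weierstrass_m_test)
    show "summable (\<lambda>k. K ^ k / fact k * norm (mat 1 :: real^'n^'n))"
      using summable_exp[of K] by (intro summable_mult2) (simp add: divide_inverse mult.commute)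
    fix k and s :: real assume s: "s \<in> {0..1}"
    have "norm (?f k s) = (1 / fact k) * (\<bar>s\<bar> ^ k * norm (?P k))" by (simp add: power_abs)
    also have "\<dots> \<le> (1 / fact k) * (1 * (K ^ k * norm (mat 1 :: real^'n^'n)))"
      using s P[of k] by (intro mult_left_mono mult_mono) (auto simp: power_le_one)
    finally show "norm (?f k s) \<le> K ^ k / fact k * norm (mat 1 :: real^'n^'n)" by simp
  qed
  then have "continuous_on {0..1} (\<lambda>s. \<Sum>k. ?f k s)"
    by (rule uniform_limit_theorem[rotated]) (auto intro!: always_eventually continuous_intros)
  then show ?thesis by (simp add: matrix_exp_def matrix_power_scaleR)
qed

lemma matrix_exp_0: "matrix_exp (0 *\<^sub>R A) = (mat 1 :: real^'n^'n)"
proof -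
  have "(\<Sum>k. (1 / fact k) *\<^sub>R (0 ^ k *\<^sub>R (((**) A ^^ k) (mat 1 :: real^'n^'n)))) =
     (\<Sum>k\<in>{0::nat}. (1 / fact k) *\<^sub>R (0 ^ k *\<^sub>R (((**) A ^^ k) (mat 1 :: real^'n^'n))))"
    by (rule suminf_finite) auto
  then show ?thesis unfolding matrix_exp_def matrix_power_scaleR by simp
qed

lemma matrix_vector_mult_bound:
  obtains K where "K > 0" "\<And>(G::real^'n^'n) x. norm (G *v x) \<le> K * norm G * norm x"
proof -
  have "bilinear (\<lambda>(G::real^'n^'n) x. G *v x)"
    unfolding bilinear_def
    by (auto intro!: linearI simp: matrix_vector_mult_def vec_eq_iff sum.distrib sum_distrib_left algebra_simps)
  then interpret bounded_bilinear "\<lambda>(G::real^'n^'n) x. G *v x"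
    by (simp add: bilinear_conv_bounded_bilinear)
  obtain K where "K > 0" "\<And>(G::real^'n^'n) x. norm (G *v x) \<le> norm G * norm x * K"
    using pos_bounded by blast
  then show ?thesis by (intro that[of K]) (auto simp: mult_ac)
qed

section \<open>The noise of the Ornstein-Uhlenbeck process\<close>

context stable_levy
begin

definition ou_noise :: "real^'n^'n \<Rightarrow> real \<Rightarrow> 'w \<Rightarrow> real^'n" where
  "ou_noise A t = stochastic_integral M Z t (\<lambda>s. matrix_exp ((t - s) *\<^sub>R A))"

lemma ou_noise:
  assumes "0 < t" "t \<le> 1"
  shows "has_stochastic_integral M Z t (\<lambda>s. matrix_exp ((t - s) *\<^sub>R A)) (ou_noise A t)"
proof -
  have "continuous_on {0..t} (\<lambda>s. matrix_exp ((t - s) *\<^sub>R A))"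
    by (rule continuous_on_compose2[OF matrix_exp_continuous]) (use assms in \<open>auto intro!: continuous_intros\<close>)
  then show ?thesis
    unfolding ou_noise_def stochastic_integral_def
    by (rule someI_ex[OF stochastic_integral_exists[OF assms(1)]])
qed

text \<open>Uniform partitions into \<open>T * Suc k\<close> slots are used, of which the last
  \<open>Suc k\<close> have \<open>t - s\<close> so small that the matrix is within
  \<open>\<delta>\<close> of the identity. This share does not depend on \<open>t\<close> or
  \<open>k\<close>, so the bounds for Riemann sums pass to the limit with one constant.\<close>

lemma FS_bound_ou_noise:
  obtains B where "B > 0"
    "\<And>t a. 0 < t \<Longrightarrow> t \<le> 1 \<Longrightarrow>
       FS_bound (\<lambda>u. (cis (u \<bullet> a) - 1) * (CLINT \<omega>|M. cis (u \<bullet> ou_noise A t \<omega>))) (B * norm a / t powr (1 / \<alpha>))"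
    "\<And>t a b. 0 < t \<Longrightarrow> t \<le> 1 \<Longrightarrow>
       FS_bound (\<lambda>u. (cis (u \<bullet> a) - 1) * (cis (u \<bullet> b) - 1) * (CLINT \<omega>|M. cis (u \<bullet> ou_noise A t \<omega>)))
        (B * norm a / (t / 2) powr (1 / \<alpha>) * (B * norm b / (t / 2) powr (1 / \<alpha>)))"
proof -
  define E where "E s = matrix_exp (s *\<^sub>R A)" for s
  obtain \<delta> where \<delta>: "\<delta> > 0" and grad: "\<And>T::real. T > 0 \<Longrightarrow> \<exists>B>0. \<forall>s>0. \<forall>(a::real^'n) N J. \<forall>F :: nat \<Rightarrow> real^'n^'n.
       J \<subseteq> {..<N} \<longrightarrow> J \<noteq> {} \<longrightarrow> real (card J) * T = N \<longrightarrow>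
       (\<forall>j\<in>J. \<forall>\<xi>. norm \<xi> = 1 \<longrightarrow> norm (F j *v \<xi> - \<xi>) \<le> \<delta>) \<longrightarrow>
       FS_bound (\<lambda>u. (cis (u \<bullet> a) - 1) * of_real (exp (- (\<Sum>j<N. s / N * \<psi> (u v* F j)))))
         (B * norm a / s powr (1 / \<alpha>))"
    using FS_bound_gradient by blast
  obtain K where K: "K > 0" "\<And>(G::real^'n^'n) x. norm (G *v x) \<le> K * norm G * norm x"
    using matrix_vector_mult_bound by blast
  have "\<exists>\<tau>>0. \<forall>s\<in>{0..1}. dist s 0 < \<tau> \<longrightarrow> dist (E s) (E 0) < \<delta> / K"
    using matrix_exp_continuous[of A] \<delta> K(1) unfolding E_def continuous_on_iff by (metis atLeastAtMost_iff divide_pos_pos order_refl zero_le_one)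
  then obtain \<tau> where \<tau>: "\<tau> > 0" "\<And>s. s \<in> {0..1} \<Longrightarrow> s < \<tau> \<Longrightarrow> norm (E s - mat 1) < \<delta> / K"
    by (auto simp: E_def matrix_exp_0[simplified] dist_norm)
  have near: "norm (E s *v \<xi> - \<xi>) \<le> \<delta>" if "s \<in> {0..1}" "s < \<tau>" "norm \<xi> = 1" for s \<xi>
  proof -
    have "norm (E s *v \<xi> - \<xi>) = norm ((E s - mat 1) *v \<xi>)"
      by (simp add: matrix_vector_mult_diff_rdistrib)
    also have "\<dots> \<le> K * norm (E s - mat 1)" using K(2)[of "E s - mat 1" \<xi>] that by simp
    also have "\<dots> \<le> K * (\<delta> / K)" using \<tau>(2)[OF that(1,2)] K(1) by (intro mult_left_mono) auto
    finally show ?thesis using K(1) by simp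
  qed
  \<comment> \<open>A natural number, so that the share \<open>1 / T\<close> of slots is exact. The
    last share of \<open>[0, t]\<close> has length
    \<open>t / T \<le> 1 / T < \<tau>\<close>.\<close>
  obtain T :: nat where T: "T > 0" "1 / real T < \<tau>"
    using reals_Archimedean[OF \<tau>(1)] by (metis inverse_eq_divide zero_less_Suc)
  obtain B where B: "B > 0" "\<And>s (a::real^'n) (N::nat) J (F :: nat \<Rightarrow> real^'n^'n). s > 0 \<Longrightarrow> J \<subseteq> {..<N} \<Longrightarrow> J \<noteq> {} \<Longrightarrow> real (card J) * T = N \<Longrightarrow>
       (\<And>j \<xi>. j \<in> J \<Longrightarrow> norm \<xi> = 1 \<Longrightarrow> norm (F j *v \<xi> - \<xi>) \<le> \<delta>) \<Longrightarrow>
       FS_bound (\<lambda>u. (cis (u \<bullet> a) - 1) * of_real (exp (- (\<Sum>j<N. s / N * \<psi> (u v* F j)))))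
         (B * norm a / s powr (1 / \<alpha>))"
    using grad[of "real T"] T(1) by (auto simp del: times_divide_eq_left)
  \<comment> \<open>The factor \<open>s\<close> of the exponent is decoupled from the time
    \<open>t\<close> of the matrices: \<open>s = t\<close> yields the first difference,
    \<open>s = t / 2\<close> the half exponents for the second.\<close>
  have step: "FS_bound (\<lambda>u. (cis (u \<bullet> a) - 1) * of_real (exp (- (\<Sum>j<T * Suc k. s / real (T * Suc k) * \<psi> (u v* E (t - uniform_partition t (T * Suc k) j))))))
      (B * norm a / s powr (1 / \<alpha>))"
    if t: "0 < t" "t \<le> 1" and s: "s > 0" for t s k a
  proof (rule B(2)[OF s])
    let ?N = "T * Suc k"
    let ?J = "{?N - Suc k..<?N}"
    have NT: "Suc k \<le> ?N" using T(1) by (cases T) simp_all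
    show "?J \<subseteq> {..<?N}" by auto
    show "?J \<noteq> {}" using NT by auto
    show "real (card ?J) * T = ?N" using NT by (simp add: mult.commute del: mult_Suc_right)
    fix j and \<xi> :: "real^'n" assume j: "j \<in> ?J" and \<xi>: "norm \<xi> = 1"
    have N0: "real ?N > 0" using T(1) by (simp only: of_nat_0_less_iff) simp
    have "t - uniform_partition t ?N j = t * (real (?N - j) / real ?N)"
      using j N0 by (simp add: uniform_partition_def field_simps of_nat_diff)
    moreover have "real (?N - j) / real ?N \<le> 1 / real T"
    proof -
      have "?N - j \<le> Suc k" using j unfolding atLeastLessThan_iff by linarith
      then have "real (?N - j) \<le> real (Suc k)" by (simp only: of_nat_le_iff)
      then have "real (?N - j) / real ?N \<le> real (Suc k) / real ?N" using N0 by (intro divide_right_mono) auto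
      also have "\<dots> = 1 / real T" using T(1) by (simp del: of_nat_Suc mult_Suc_right)
      finally show ?thesis .
    qed
    moreover have "0 \<le> real (?N - j) / real ?N" by simp
    moreover have "1 / real T \<le> 1" using T(1) by simp
    ultimately have "0 \<le> t - uniform_partition t ?N j" "t - uniform_partition t ?N j \<le> 1 / real T" "1 / real T \<le> 1"
      using t mult_mono[of t 1 "real (?N - j) / real ?N" "1 / real T"] by auto
    then show "norm (E (t - uniform_partition t ?N j) *v \<xi> - \<xi>) \<le> \<delta>"
      using T(2) by (intro near \<xi>) auto
  qed
  have lim: "(\<lambda>k. complex_of_real (exp (- (\<Sum>j<T * Suc k. t / real (T * Suc k) * \<psi> (u v* E (t - uniform_partition t (T * Suc k) j))))))
      \<longlonglongrightarrow> (CLINT \<omega>|M. cis (u \<bullet> ou_noise A t \<omega>))" if t: "0 < t" "t \<le> 1" for t u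
  proof -
    have "filterlim (\<lambda>k. T * Suc k) at_top sequentially"
    proof (rule filterlim_at_top_mono[OF filterlim_ident])
      have "k \<le> T * Suc k" for k using T(1) by (cases T) auto
      then show "\<forall>\<^sub>F k in sequentially. k \<le> T * Suc k" by simp
    qed
    from char_stochastic_integral[OF t(1) ou_noise[OF t] this, of u A] show ?thesis
      unfolding E_def by simp
  qed
  show ?thesis
  proof
    show "B > 0" by fact
    fix t :: real assume t: "0 < t" "t \<le> 1"
    show "FS_bound (\<lambda>u. (cis (u \<bullet> a) - 1) * (CLINT \<omega>|M. cis (u \<bullet> ou_noise A t \<omega>))) (B * norm a / t powr (1 / \<alpha>))" for a
      by (rule FS_bound_lim[OF step[OF t t(1)] tendsto_mult[OF tendsto_const lim[OF t]] tendsto_const])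
    fix a b :: "real^'n"
    let ?g = "\<lambda>k u s. complex_of_real (exp (- (\<Sum>j<T * Suc k. s / real (T * Suc k) * \<psi> (u v* E (t - uniform_partition t (T * Suc k) j)))))"
    \<comment> \<open>Splitting off half of the exponent, not half of the time interval, leaves two
      factors that both contain the slots near \<open>t\<close>; each absorbs one of the two
      differences.\<close>
    have g2: "?g k u t = ?g k u (t / 2) * ?g k u (t / 2)" for k u
    proof -
      have half: "x / y * v = x / 2 / y * v + x / 2 / y * v" for x y v :: real
        by (cases "y = 0") (auto simp: field_simps)
      have "(\<Sum>j<T * Suc k. t / real (T * Suc k) * \<psi> (u v* E (t - uniform_partition t (T * Suc k) j))) =
        (\<Sum>j<T * Suc k. t / 2 / real (T * Suc k) * \<psi> (u v* E (t - uniform_partition t (T * Suc k) j))) +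
        (\<Sum>j<T * Suc k. t / 2 / real (T * Suc k) * \<psi> (u v* E (t - uniform_partition t (T * Suc k) j)))"
        unfolding sum.distrib[symmetric] by (intro sum.cong refl half)
      then show ?thesis by (simp only: minus_add_distrib exp_add of_real_mult)
    qed
    have t2: "t / 2 > 0" using t by simp
    have "FS_bound (\<lambda>u. ((cis (u \<bullet> a) - 1) * ?g k u (t / 2)) * ((cis (u \<bullet> b) - 1) * ?g k u (t / 2)))
        (B * norm a / (t / 2) powr (1 / \<alpha>) * (B * norm b / (t / 2) powr (1 / \<alpha>)))" for k
      by (rule FS_bound_mult[OF step[OF t t2] step[OF t t2]])
    then have "FS_bound (\<lambda>u. (cis (u \<bullet> a) - 1) * (cis (u \<bullet> b) - 1) * ?g k u t)
        (B * norm a / (t / 2) powr (1 / \<alpha>) * (B * norm b / (t / 2) powr (1 / \<alpha>)))" for k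
      unfolding g2 by (simp only: mult_ac)
    from FS_bound_lim[OF this tendsto_mult[OF tendsto_const lim[OF t]] tendsto_const]
    show "FS_bound (\<lambda>u. (cis (u \<bullet> a) - 1) * (cis (u \<bullet> b) - 1) * (CLINT \<omega>|M. cis (u \<bullet> ou_noise A t \<omega>)))
        (B * norm a / (t / 2) powr (1 / \<alpha>) * (B * norm b / (t / 2) powr (1 / \<alpha>)))" .
  qed
qed

text \<open>Deterministic translations of one random vector multiply its characteristic function by
  \<open>cis (u \<bullet> y k)\<close>, so finite differences of
  \<open>x \<mapsto> E f (x + Y)\<close> correspond to the products bounded above.\<close>

lemma translated_expectation_bound:
  fixes Y :: "'w \<Rightarrow> real^'n"
  assumes Y[measurable]: "Y \<in> borel_measurable M" and K: "finite K"
    and FS: "FS_bound (\<lambda>u. (\<Sum>k\<in>K. of_real (\<epsilon> k) * cis (u \<bullet> y k)) * (CLINT \<omega>|M. cis (u \<bullet> Y \<omega>))) C"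
    and f: "f \<in> borel_measurable borel" "\<And>x. \<bar>f x\<bar> \<le> B"
  shows "\<bar>\<Sum>k\<in>K. \<epsilon> k * (LINT \<omega>|M. f (y k + Y \<omega>))\<bar> \<le> C * B"
proof (rule FS_bound_bounded_borel_expectation[OF _ K _ _ f])
  show "finite_measure M" by unfold_locales
  show "(\<lambda>\<omega>. y k + Y \<omega>) \<in> borel_measurable M" for k by measurable
  show "FS_bound (\<lambda>u. \<Sum>k\<in>K. of_real (\<epsilon> k) * (CLINT \<omega>|M. cis (u \<bullet> (y k + Y \<omega>)))) C"
    using FS by (simp add: inner_add_right cis_mult[symmetric] sum_distrib_right mult.assoc)
qed

end

theorem theorem3p2:
  fixes M :: "'w measure"
    and Z :: "real \<Rightarrow> 'w \<Rightarrow> real^'n"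
    and A :: "real^'n^'n"
    and \<alpha> :: real
  assumes "0 < \<alpha>" and "\<alpha> < 2"
    and "nondegenerate_symmetric_stable_process \<alpha> M Z"
  shows "\<exists>c::real. c > 0 \<and>
    (\<forall>t\<in>{0<..1}. \<forall>f\<in>bounded_borel.
       (\<forall>x. ou_semigroup M Z A t f differentiable (at x)) \<and>
       sup_norm (gradient (ou_semigroup M Z A t f)) \<le> ennreal (c / t powr (1 / \<alpha>)) * sup_norm f)"
proof -
  obtain \<mu> C0 where \<mu>: "symmetric_spectral_measure \<mu>" "C0 > 0" "\<And>u. Re (stable_exponent \<alpha> \<mu> u) \<ge> C0 * norm u powr \<alpha>"
    and Z: "levy_process M Z"
      "\<And>t u. t \<ge> 0 \<Longrightarrow> (LINT \<omega>|M. iexp (Z t \<omega> \<bullet> u)) = exp (- complex_of_real t * stable_exponent \<alpha> \<mu> u)"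
    using assms(3) unfolding nondegenerate_symmetric_stable_process_def by blast
  interpret stable_levy \<alpha> \<mu> C0 M Z
    by unfold_locales (use assms(1) \<mu> Z in auto)
  obtain B where B: "B > 0"
    and B1: "\<And>t a. 0 < t \<Longrightarrow> t \<le> 1 \<Longrightarrow>
       FS_bound (\<lambda>u. (cis (u \<bullet> a) - 1) * (CLINT \<omega>|M. cis (u \<bullet> ou_noise A t \<omega>))) (B * norm a / t powr (1 / \<alpha>))"
    and B2: "\<And>t a b. 0 < t \<Longrightarrow> t \<le> 1 \<Longrightarrow>
       FS_bound (\<lambda>u. (cis (u \<bullet> a) - 1) * (cis (u \<bullet> b) - 1) * (CLINT \<omega>|M. cis (u \<bullet> ou_noise A t \<omega>)))
        (B * norm a / (t / 2) powr (1 / \<alpha>) * (B * norm b / (t / 2) powr (1 / \<alpha>)))"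
    using FS_bound_ou_noise[of A] by blast
  obtain K where K: "K > 0" "\<And>(G::real^'n^'n) x. norm (G *v x) \<le> K * norm G * norm x"
    using matrix_vector_mult_bound by blast
  obtain e where e: "\<And>t. t \<in> {0..1} \<Longrightarrow> norm (matrix_exp (t *\<^sub>R A)) \<le> e"
    using compact_imp_bounded[OF compact_continuous_image[OF matrix_exp_continuous[of A] compact_Icc]]
    unfolding bounded_iff by blast
  have e0: "e \<ge> 0" using e[of 0] norm_ge_zero order_trans by (metis atLeastAtMost_iff order_refl zero_le_one)
  \<comment> \<open>\<open>K * e\<close> bounds the operator norm of
    \<open>matrix_exp (t *\<^sub>R A)\<close> for \<open>t \<in> {0..1}\<close>, which enters by the
    chain rule; the summand 1 secures \<open>c > 0\<close>.\<close>
  define c where "c = B * (K * e + 1)"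
  have c: "c > 0" using B K(1) e0 by (simp add: c_def add_nonneg_pos)
  have "(\<forall>x. ou_semigroup M Z A t f differentiable (at x)) \<and>
       sup_norm (gradient (ou_semigroup M Z A t f)) \<le> ennreal (c / t powr (1 / \<alpha>)) * sup_norm f"
    if t: "t \<in> {0<..1}" and f: "f \<in> bounded_borel" for t f
  proof -
    have t': "0 < t" "t \<le> 1" using t by auto
    have fm: "f \<in> borel_measurable borel" and fb: "bounded (range f)" using f by (auto simp: bounded_borel_def)
    \<comment> \<open>The supremum norm is extended-valued. As \<open>f\<close> is bounded,
      \<open>b\<close> is its real value, and using it instead of an arbitrary bound gives the
      estimate in terms of \<open>sup_norm f\<close>.\<close>
    define b where "b = enn2real (sup_norm f)"
    obtain b0 where b0: "\<And>x. norm (f x) \<le> b0" using fb unfolding bounded_iff by auto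
    have "sup_norm f \<le> ennreal b0" unfolding sup_norm_def using b0 by (intro SUP_least ennreal_leI) auto
    then have sb: "sup_norm f = ennreal b"
      unfolding b_def by (metis ennreal_enn2real ennreal_less_top le_less_trans)
    have b_nonneg: "b \<ge> 0" by (simp add: b_def)
    have fB: "\<bar>f x\<bar> \<le> b" for x
    proof -
      have "ennreal (norm (f x)) \<le> sup_norm f" unfolding sup_norm_def by (rule SUP_upper) simp
      then show ?thesis unfolding sb using b_nonneg by (simp add: ennreal_le_iff)
    qed
    define Y where "Y = ou_noise A t"
    have Ym: "Y \<in> borel_measurable M" using ou_noise[OF t', of A] by (simp add: Y_def has_stochastic_integral_def)
    define g where "g x = (LINT \<omega>|M. f (x + Y \<omega>))" for x
    define L where "L = B / t powr (1 / \<alpha>) * b"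
    define Q where "Q = B / (t / 2) powr (1 / \<alpha>) * (B / (t / 2) powr (1 / \<alpha>)) * b"
    have g1: "\<bar>g (x + a) - g x\<bar> \<le> L * norm a" for x a
    proof -
      have "FS_bound (\<lambda>u. cis (u \<bullet> x) * ((cis (u \<bullet> a) - 1) * (CLINT \<omega>|M. cis (u \<bullet> Y \<omega>)))) (1 * (B * norm a / t powr (1 / \<alpha>)))"
        unfolding Y_def by (intro FS_bound_mult FS_bound_cis B1 t')
      \<comment> \<open>The first difference as a signed sum over two translates, in the format of
        \<open>translated_expectation_bound\<close>; the second difference below is the same with
        weights 1, -1, -1, 1 on four translates.\<close>
      then have "FS_bound (\<lambda>u. (\<Sum>k\<in>{..<2::nat}. of_real ([1, -1] ! k) * cis (u \<bullet> ([x + a, x] ! k))) * (CLINT \<omega>|M. cis (u \<bullet> Y \<omega>)))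
         (B * norm a / t powr (1 / \<alpha>))"
        by (simp add: eval_nat_numeral inner_add_right cis_mult[symmetric] algebra_simps)
      from translated_expectation_bound[OF Ym _ this fm fB]
      show ?thesis by (simp add: eval_nat_numeral g_def L_def mult_ac)
    qed
    have g2: "\<bar>g (x + a + a') - g (x + a) - g (x + a') + g x\<bar> \<le> Q * norm a * norm a'" for x a a'
    proof -
      have "FS_bound (\<lambda>u. cis (u \<bullet> x) * ((cis (u \<bullet> a) - 1) * (cis (u \<bullet> a') - 1) * (CLINT \<omega>|M. cis (u \<bullet> Y \<omega>))))
          (1 * (B * norm a / (t / 2) powr (1 / \<alpha>) * (B * norm a' / (t / 2) powr (1 / \<alpha>))))"
        unfolding Y_def by (intro FS_bound_mult[OF FS_bound_cis] B2 t')
      then have "FS_bound (\<lambda>u. (\<Sum>k\<in>{..<4::nat}. of_real ([1, -1, -1, 1] ! k) * cis (u \<bullet> ([x + a + a', x + a, x + a', x] ! k))) * (CLINT \<omega>|M. cis (u \<bullet> Y \<omega>)))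
         (B * norm a / (t / 2) powr (1 / \<alpha>) * (B * norm a' / (t / 2) powr (1 / \<alpha>)))"
        by (simp add: eval_nat_numeral inner_add_right cis_mult[symmetric] algebra_simps)
      from translated_expectation_bound[OF Ym _ this fm fB]
      show ?thesis by (simp add: eval_nat_numeral g_def Q_def mult_ac)
    qed
    define E where "E = matrix_exp (t *\<^sub>R A)"
    \<comment> \<open>The starting point enters only through \<open>E *v x\<close>, so translations
      of the noise control \<open>g\<close>, and \<open>E\<close> is accounted for by the chain
      rule.\<close>
    have sg: "ou_semigroup M Z A t f = (\<lambda>x. g (E *v x))"
      by (simp add: fun_eq_iff ou_semigroup_def ou_process_def g_def E_def Y_def ou_noise_def)
    have KE: "norm (E *v a) \<le> K * e * norm a" for a
    proof -
      have "norm (E *v a) \<le> K * norm E * norm a" by (rule K(2))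
      also have "\<dots> \<le> K * e * norm a" using e[of t] t' K(1) unfolding E_def by (intro mult_right_mono mult_left_mono) auto
      finally show ?thesis .
    qed
    have L0: "L \<ge> 0" using B b_nonneg by (simp add: L_def)
    have der: "\<exists>D. (ou_semigroup M Z A t f has_derivative D) (at x) \<and> (\<forall>a. \<bar>D a\<bar> \<le> c / t powr (1 / \<alpha>) * b * norm a)" for x
    proof -
      obtain D where D: "(g has_derivative D) (at (E *v x))" "\<And>a. \<bar>D a\<bar> \<le> L * norm a"
        using second_difference_imp_derivative[OF g1 g2] by blast
      have "((\<lambda>x. E *v x) has_derivative (\<lambda>x. E *v x)) (at x)"
        by (rule bounded_linear_imp_has_derivative) (rule matrix_vector_mul_bounded_linear)
      from has_derivative_compose[OF this D(1)]
      have "(ou_semigroup M Z A t f has_derivative (\<lambda>a. D (E *v a))) (at x)" unfolding sg .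
      moreover have "\<bar>D (E *v a)\<bar> \<le> c / t powr (1 / \<alpha>) * b * norm a" for a
      proof -
        have "\<bar>D (E *v a)\<bar> \<le> L * (K * e * norm a)"
          using D(2)[of "E *v a"] mult_left_mono[OF KE[of a] L0] by linarith
        also have "\<dots> \<le> L * ((K * e + 1) * norm a)" using L0 by (intro mult_left_mono mult_right_mono) auto
        also have "\<dots> = c / t powr (1 / \<alpha>) * b * norm a" by (simp add: L_def c_def)
        finally show ?thesis .
      qed
      ultimately show ?thesis by blast
    qed
    have "norm (gradient (ou_semigroup M Z A t f) x) \<le> c / t powr (1 / \<alpha>) * b" for x
      using der[of x] gradient_bound_of_has_derivative by blast
    then have "sup_norm (gradient (ou_semigroup M Z A t f)) \<le> ennreal (c / t powr (1 / \<alpha>) * b)"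
      unfolding sup_norm_def by (intro SUP_least ennreal_leI)
    also have "\<dots> = ennreal (c / t powr (1 / \<alpha>)) * sup_norm f"
      unfolding sb using c b_nonneg by (intro ennreal_mult) auto
    finally show ?thesis using der unfolding differentiable_def by blast
  qed
  then show ?thesis using c by blast
qed

end
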